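(* The \textsf{NAE-3SAT-KS} problem is $\mathsf{NP}$-complete.
   Context: The \textsf{NAE-3SAT-KS} problem: the input is a 3SAT instance $\psi$ consisting of a collection $C$ of clauses over a set $U$ of variables such that (1) every clause of $C$ has exactly $3$ literals; (2) for every $u\in U$, each of the literals $u$ and $\bar u$ appears in at most $2$ clauses of $C$; (3) for every $u\in U$, at least one of $u$ or $\bar u$ appears in exactly $2$ clauses of $C$; (4) any two clauses share at most one literal, and no variable appears twice in the same clause. The question is whether there is a truth assignment to $U$ such that every clause of $\psi$ has at least one true literal and at least one false literal. *)

theory Defs
  imports Main "HOL-Computational_Algebra.Polynomial"
begin

section \<open>Deterministic multi-tape Turing machines\<close>

text \<open>
  A machine has \<open>tapes M\<close> two-way infinite tapes, the states \<open>{..<states M}\<close> and the tape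
  alphabet \<open>{..<symbols M}\<close>, in which 0 is the blank and 1 and 2 stand for the bits 0 and 1.
  The transition function maps a state and the symbols under the heads to a new state and, for
  each tape, the symbol to write and the direction in which to move.
\<close>

datatype dir = MoveLeft | Stay | MoveRight

record tm =
  tapes :: nat
  states :: nat
  symbols :: nat
  start :: nat
  halt :: nat
  delta :: "nat \<Rightarrow> nat list \<Rightarrow> nat \<times> (nat \<times> dir) list"

definition wf_tm :: "tm \<Rightarrow> bool" where
  "wf_tm M \<longleftrightarrow>
     tapes M \<ge> 1 \<and> symbols M \<ge> 3 \<and> start M < states M \<and> halt M < states M \<and>
     (\<forall>q < states M. \<forall>rs. length rs = tapes M \<and> (\<forall>r \<in> set rs. r < symbols M) \<longrightarrow>
        fst (delta M q rs) < states M \<and>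
        length (snd (delta M q rs)) = tapes M \<and>
        (\<forall>(s, d) \<in> set (snd (delta M q rs)). s < symbols M))"

text \<open>A tape consists of a head position and the cell contents; a configuration of the current
  state and the tapes.\<close>

type_synonym tape = "int \<times> (int \<Rightarrow> nat)"
type_synonym config = "nat \<times> tape list"

definition read :: "tape \<Rightarrow> nat" where
  "read t = snd t (fst t)"

fun displacement :: "dir \<Rightarrow> int" where
  "displacement MoveLeft = -1"
| "displacement Stay = 0"
| "displacement MoveRight = 1"

fun act :: "nat \<times> dir \<Rightarrow> tape \<Rightarrow> tape" where
  "act (s, d) (h, f) = (h + displacement d, f(h := s))"

definition step :: "tm \<Rightarrow> config \<Rightarrow> config" where
  "step M c =
     (if fst c = halt M then c
      else (let (q, as) = delta M (fst c) (map read (snd c)) in (q, map2 act as (snd c))))"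

definition word_cells :: "bool list \<Rightarrow> int \<Rightarrow> nat" where
  "word_cells w i =
     (if 0 \<le> i \<and> i < int (length w) then (if w ! nat i then 2 else 1) else 0)"

text \<open>The input is on the first tape, all other tapes are blank, all heads are on cell 0.\<close>

definition init :: "tm \<Rightarrow> bool list \<Rightarrow> config" where
  "init M w = (start M, (0, word_cells w) # replicate (tapes M - 1) (0, word_cells []))"

text \<open>The output is read off the last tape. As halting configurations are fixed by \<^const>\<open>step\<close>,
  being halted after exactly \<open>t\<close> steps means halting within \<open>t\<close> steps.\<close>

definition outputs_within :: "tm \<Rightarrow> bool list \<Rightarrow> bool list \<Rightarrow> nat \<Rightarrow> bool" where
  "outputs_within M x y t \<longleftrightarrow>
     (let (q, ts) = (step M ^^ t) (init M x) in q = halt M \<and> snd (last ts) = word_cells y)"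

section \<open>NP-completeness\<close>

definition ptime_computable :: "(bool list \<Rightarrow> bool list) \<Rightarrow> bool" where
  "ptime_computable f \<longleftrightarrow>
     (\<exists>M. \<exists>p :: nat poly. wf_tm M \<and> (\<forall>x. outputs_within M x (f x) (poly p (length x))))"

definition class_P :: "bool list set set" where
  "class_P = {L. ptime_computable (\<lambda>x. [x \<in> L])}"

text \<open>A self-delimiting code for bit strings: each bit is preceded by a 1, a single 0 marks the
  end.\<close>

definition enc_bits :: "bool list \<Rightarrow> bool list" where
  "enc_bits w = concat (map (\<lambda>b. [True, b]) w) @ [False]"

definition pair :: "bool list \<Rightarrow> bool list \<Rightarrow> bool list" where
  "pair x u = enc_bits x @ u"

definition class_NP :: "bool list set set" where
  "class_NP =
     {L. \<exists>V \<in> class_P. \<exists>p :: nat poly.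
           \<forall>x. x \<in> L \<longleftrightarrow> (\<exists>u. length u \<le> poly p (length x) \<and> pair x u \<in> V)}"

definition ptime_reducible :: "bool list set \<Rightarrow> bool list set \<Rightarrow> bool" where
  "ptime_reducible A B \<longleftrightarrow> (\<exists>f. ptime_computable f \<and> (\<forall>x. x \<in> A \<longleftrightarrow> f x \<in> B))"

definition NP_hard :: "bool list set \<Rightarrow> bool" where
  "NP_hard B \<longleftrightarrow> (\<forall>A \<in> class_NP. ptime_reducible A B)"

definition NP_complete :: "bool list set \<Rightarrow> bool" where
  "NP_complete B \<longleftrightarrow> B \<in> class_NP \<and> NP_hard B"

section \<open>The problem NAE-3SAT-KS\<close>

datatype 'v literal = Pos 'v | Neg 'v

fun var :: "'v literal \<Rightarrow> 'v" where
  "var (Pos x) = x"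
| "var (Neg x) = x"

fun lit_true :: "('v \<Rightarrow> bool) \<Rightarrow> 'v literal \<Rightarrow> bool" where
  "lit_true \<tau> (Pos x) \<longleftrightarrow> \<tau> x"
| "lit_true \<tau> (Neg x) \<longleftrightarrow> \<not> \<tau> x"

type_synonym 'v clause = "'v literal list"

text \<open>The number of clauses of a collection (given as a list) in which a literal appears.\<close>

definition occurrences :: "'v clause list \<Rightarrow> 'v literal \<Rightarrow> nat" where
  "occurrences C l = card {i. i < length C \<and> l \<in> set (C ! i)}"

definition NAE_3SAT_KS_instance :: "'v set \<Rightarrow> 'v clause list \<Rightarrow> bool" where
  "NAE_3SAT_KS_instance U C \<longleftrightarrow>
     (\<forall>c \<in> set C. \<forall>l \<in> set c. var l \<in> U) \<and>
     (\<forall>c \<in> set C. length c = 3) \<and>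
     (\<forall>u \<in> U. occurrences C (Pos u) \<le> 2 \<and> occurrences C (Neg u) \<le> 2) \<and>
     (\<forall>u \<in> U. occurrences C (Pos u) = 2 \<or> occurrences C (Neg u) = 2) \<and>
     (\<forall>i < length C. \<forall>j < length C. i \<noteq> j \<longrightarrow> card (set (C ! i) \<inter> set (C ! j)) \<le> 1) \<and>
     (\<forall>c \<in> set C. distinct (map var c))"

definition NAE_satisfiable :: "'v clause list \<Rightarrow> bool" where
  "NAE_satisfiable C \<longleftrightarrow>
     (\<exists>\<tau>. \<forall>c \<in> set C. (\<exists>l \<in> set c. lit_true \<tau> l) \<and> (\<exists>l \<in> set c. \<not> lit_true \<tau> l))"

text \<open>Variables are natural numbers, written in binary with the least significant bit first.
  The encoding of an instance lists its variables and then its clauses.\<close>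

fun binary :: "nat \<Rightarrow> bool list" where
  "binary 0 = []"
| "binary (Suc n) = odd (Suc n) # binary (Suc n div 2)"

definition enc_nat :: "nat \<Rightarrow> bool list" where
  "enc_nat n = enc_bits (binary n)"

fun enc_literal :: "nat literal \<Rightarrow> bool list" where
  "enc_literal (Pos x) = True # enc_nat x"
| "enc_literal (Neg x) = False # enc_nat x"

definition enc_list :: "('a \<Rightarrow> bool list) \<Rightarrow> 'a list \<Rightarrow> bool list" where
  "enc_list f xs = concat (map (\<lambda>x. True # f x) xs) @ [False]"

definition enc_instance :: "nat list \<Rightarrow> nat clause list \<Rightarrow> bool list" where
  "enc_instance U C = enc_list enc_nat U @ enc_list (enc_list enc_literal) C"

definition NAE_3SAT_KS :: "bool list set" where
  "NAE_3SAT_KS =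
     {enc_instance U C | U C.
        distinct U \<and> NAE_3SAT_KS_instance (set U) C \<and> NAE_satisfiable C}"

subsection \<open>The encodings are injective\<close>

lemma enc_bits_prefix_free:
  "enc_bits v @ s = enc_bits w @ t \<longleftrightarrow> v = w \<and> s = t"
proof (induction v arbitrary: w)
  case Nil
  then show ?case by (cases w) (auto simp: enc_bits_def)
next
  case (Cons a v)
  then show ?case by (cases w) (auto simp: enc_bits_def)
qed

lemma pair_inject: "pair x u = pair y v \<longleftrightarrow> x = y \<and> u = v"
  by (simp add: pair_def enc_bits_prefix_free)

lemma binary_inject: "binary m = binary n \<longleftrightarrow> m = n"
proof (induction m arbitrary: n rule: less_induct)
  case (less m)
  show ?case
  proof (cases m)
    case 0
    then show ?thesis by (cases n) auto
  next
    case (Suc m')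
    show ?thesis
    proof (cases n)
      case 0
      with Suc show ?thesis by simp
    next
      case (Suc n')
      have "m div 2 < m" using \<open>m = Suc m'\<close> by simp
      then have "binary m = binary n \<longleftrightarrow> odd m = odd n \<and> m div 2 = n div 2"
        using less.IH[of "m div 2" "n div 2"] \<open>m = Suc m'\<close> Suc by simp
      also have "\<dots> \<longleftrightarrow> m = n" by presburger
      finally show ?thesis .
    qed
  qed
qed

lemma enc_nat_prefix_free:
  "enc_nat m @ s = enc_nat n @ t \<longleftrightarrow> m = n \<and> s = t"
  by (simp add: enc_nat_def enc_bits_prefix_free binary_inject)

lemma enc_literal_prefix_free:
  "enc_literal k @ s = enc_literal l @ t \<longleftrightarrow> k = l \<and> s = t"
  by (cases k; cases l) (simp_all add: enc_nat_prefix_free)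

lemma enc_list_prefix_free:
  assumes "\<And>x y s t. f x @ s = f y @ t \<longleftrightarrow> x = y \<and> s = t"
  shows "enc_list f xs @ s = enc_list f ys @ t \<longleftrightarrow> xs = ys \<and> s = t"
proof (induction xs arbitrary: ys)
  case Nil
  then show ?case by (cases ys) (auto simp: enc_list_def)
next
  case (Cons x xs)
  then show ?case by (cases ys) (auto simp: enc_list_def assms)
qed

lemma enc_instance_inject:
  "enc_instance U C = enc_instance V D \<longleftrightarrow> U = V \<and> C = D"
proof -
  note pf = enc_list_prefix_free[of "enc_list enc_literal", OF enc_list_prefix_free,
      OF enc_literal_prefix_free, where s = "[]" and t = "[]", simplified]
  show ?thesis
    by (simp add: enc_instance_def enc_list_prefix_free[OF enc_nat_prefix_free] pf)
qed

end

theory Submission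
  imports Defs
begin

text \<open>
  Programs over stacks with while loops are Turing machines whose states are the continuations of
  the program. The functions computed by such programs in polynomial time are closed under
  composition, pairing, case distinction and folds over lists whose accumulator stays small, so
  that list functions are seen to be polynomial-time from their definitions.

  Hardness: describe every tape relative to its head. Then the next content of a cell depends on
  boundedly many cells, and a run of a verifier is described by implications of bounded length
  between statements ``cell \<open>j\<close> of tape \<open>k\<close> contains \<open>a\<close> at time \<open>t\<close>''; acceptance is the absence of
  the symbol for a rejecting answer. Clauses become not-all-equal triples by means of a variable
  standing for false and of chaining variables. To bound the occurrences of literals, the clauses
  \<open>{a, \<not>b, z}\<close>, \<open>{b, \<not>c, z}\<close>, \<open>{\<not>c, a, \<not>z}\<close> force \<open>a = b = c\<close>, and \<open>{c, \<not>b', y}\<close>, \<open>{\<not>a, b', y}\<close>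
  continue the equality to the next block \<open>a', b', c'\<close>; in a ring of such blocks each block keeps
  one free positive slot of \<open>c\<close> and one free negative slot of \<open>a\<close>, and no two clauses share two
  literals.

  Membership: the certificate consists of the parsed instance and the true variables, so that the
  verifier never parses its input: it encodes the instance, compares the result with the input and
  tests the conditions.
\<close>

section \<open>Structured tape programs\<close>

text \<open>Soundness of the tableau is one-sided: a satisfying assignment is only shown to make
  every true statement about the run true, and it may make further ones true. No clause demands that
  a cell contain a single symbol, and acceptance is therefore stated negatively, by forbidding the
  symbol of the rejecting answer. The price of addressing cells relative to the heads is that a move
  shifts the whole window, whose known part shrinks by one cell on either side in each step; the
  window is wide enough for that at the start.

  Equality of two variables cannot be imposed by clauses of two literals, since a clause has three
  distinct variables; the padding variables \<open>z\<close> and \<open>y\<close> fill them up. As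
  negating an assignment preserves not-all-equal, the value of a padding variable only decides in
  which direction the implications go round.

  Numbers are coded in unary inside the programs, so that counting up to a number is polynomial in
  its size; binary numbers occur only as words to be copied or compared.\<close>

datatype prog =
    Put nat "bool option" dir
  | Move nat dir
  | Seq prog prog
  | Ite nat "nat set" prog prog
  | While nat "nat set" prog

fun sym :: "bool option \<Rightarrow> nat" where
  "sym None = 0"
| "sym (Some False) = 1"
| "sym (Some True) = 2"

text \<open>The list is the stack of programs still to be executed; the empty list is the halted
  state. Unfolding a compound program takes a step in which no tape changes, so that one rewriting
  is exactly one machine step.\<close>

fun control :: "prog list \<Rightarrow> (nat \<Rightarrow> nat) \<Rightarrow> prog list" where
  "control [] f = []"
| "control (Put r s d # k) f = k"
| "control (Move r d # k) f = k"
| "control (Seq p q # k) f = p # q # k"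
| "control (Ite r S p q # k) f = (if f r \<in> S then p else q) # k"
| "control (While r S p # k) f = (if f r \<in> S then p # While r S p # k else k)"

fun action :: "prog list \<Rightarrow> (nat \<Rightarrow> nat) \<Rightarrow> nat \<Rightarrow> nat \<times> dir" where
  "action (Put r s d # k) f i = (if i = r then (sym s, d) else (f i, Stay))"
| "action (Move r d # k) f i = (f i, if i = r then d else Stay)"
| "action k f i = (f i, Stay)"

definition pstep :: "prog list \<times> (nat \<Rightarrow> tape) \<Rightarrow> prog list \<times> (nat \<Rightarrow> tape)" where
  "pstep c = (let f = (\<lambda>i. read (snd c i)) in
     (control (fst c) f, \<lambda>i. act (action (fst c) f i) (snd c i)))"

lemma act_read_Stay [simp]: "act (read t, Stay) t = t"
  by (cases t) (simp add: read_def)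

text \<open>The finitely many continuations a program passes through become the states of its
  Turing machine.\<close>

fun conts :: "prog \<Rightarrow> prog list \<Rightarrow> prog list set" where
  "conts (Put r s d) k = {Put r s d # k}"
| "conts (Move r d) k = {Move r d # k}"
| "conts (Seq p q) k = {Seq p q # k} \<union> conts p (q # k) \<union> conts q k"
| "conts (Ite r S p q) k = {Ite r S p q # k} \<union> conts p k \<union> conts q k"
| "conts (While r S p) k = {While r S p # k} \<union> conts p (While r S p # k)"

fun regs :: "prog \<Rightarrow> nat set" where
  "regs (Put r s d) = {r}"
| "regs (Move r d) = {r}"
| "regs (Seq p q) = regs p \<union> regs q"
| "regs (Ite r S p q) = {r} \<union> regs p \<union> regs q"
| "regs (While r S p) = {r} \<union> regs p"

lemma finite_conts: "finite (conts p k)"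
  by (induction p arbitrary: k) auto

lemma finite_regs: "finite (regs p)"
  by (induction p) auto

lemma conts_self: "p # k \<in> conts p k"
  by (cases p) auto

text \<open>A program hands over to the rest \<open>k\<close> when it is done, and this is the only
  way out of the set. At the top level \<open>k\<close> is the empty list, so that adding it yields
  a closed set of states.\<close>

lemma control_conts: "c \<in> conts p k \<Longrightarrow> control c f \<in> insert k (conts p k)"
proof (induction p arbitrary: k)
  case (Seq p q)
  then show ?case using conts_self[of p "q # k"] conts_self[of q k] by fastforce
next
  case (Ite r S p q)
  from Ite.prems consider "c = Ite r S p q # k" | "c \<in> conts p k" | "c \<in> conts q k" by auto
  then show ?case
    by cases (use conts_self[of p k] conts_self[of q k] Ite.IH(1)[of k] Ite.IH(2)[of k] in auto)
next
  case (While r S p)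
  then show ?case using conts_self[of p "While r S p # k"] by fastforce
qed auto

lemma regs_conts: "c \<in> conts p k \<Longrightarrow> q \<in> set c \<Longrightarrow> regs q \<subseteq> regs p \<union> \<Union>(regs ` set k)"
  by (induction p arbitrary: k) fastforce+

lemma control_cong: "(\<And>q r. q \<in> set k \<Longrightarrow> r \<in> regs q \<Longrightarrow> f r = g r) \<Longrightarrow> control k f = control k g"
proof -
  assume eq: "\<And>q r. q \<in> set k \<Longrightarrow> r \<in> regs q \<Longrightarrow> f r = g r"
  show ?thesis
  proof (cases "(k, f)" rule: control.cases)
    case (5 r S p q k' f')
    then have "f r = g r" using eq[of "Ite r S p q" r] by simp
    with 5 show ?thesis by simp
  next
    case (6 r S p k' f')
    then have "f r = g r" using eq[of "While r S p" r] by simp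
    with 6 show ?thesis by simp
  qed auto
qed

lemma action_bound: "f i < 3 \<Longrightarrow> fst (action k f i) < 3"
proof (cases "(k, f, i)" rule: action.cases)
  case (1 r s d k f' i')
  moreover have "sym s < 3" by (cases s rule: sym.cases) auto
  ultimately show "f i < 3 \<Longrightarrow> ?thesis" by auto
qed auto

section \<open>Simulation of programs by Turing machines\<close>

definition blank_tapes :: "bool list \<Rightarrow> nat \<Rightarrow> tape" where
  "blank_tapes w = (\<lambda>i. (0, word_cells (if i = 0 then w else [])))"

lemma compile_prog:
  assumes "regs p \<subseteq> {..<K}" "K \<ge> 1"
  shows "\<exists>M. wf_tm M \<and> (\<forall>w n T. (pstep ^^ n) ([p], blank_tapes w) = ([], T) \<longrightarrow>
    (step M ^^ n) (init M w) = (halt M, map T [0..<K]))"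
proof -
  define Q where "Q = insert [] (conts p [])"
  have "finite Q" by (simp add: Q_def finite_conts)
  then obtain num where num: "bij_betw num Q {..<card Q}"
    by (metis atLeast0LessThan ex_bij_betw_finite_nat)
  define dec where "dec = inv_into Q num"
  have dec: "dec (num k) = k" if "k \<in> Q" for k
    using num that by (simp add: dec_def bij_betw_def)
  have num_less: "num k < card Q" if "k \<in> Q" for k
    using num that by (auto simp: bij_betw_def)
  have dec_in: "dec q \<in> Q" if "q < card Q" for q
    using num that by (simp add: bij_betw_def dec_def inv_into_into)
  have closed: "control k f \<in> Q" if "k \<in> Q" for k f
    using that control_conts[of k p "[]" f] by (auto simp: Q_def)
  \<comment> \<open>Programs see a tape for every natural number, the machine only \<open>K\<close>
    of them. The default 0 never influences the control because all registers of \<open>p\<close>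
    lie below \<open>K\<close>.\<close>
  define look where "look rs = (\<lambda>i. if i < K then rs ! i else 0)" for rs :: "nat list"
  define M where "M = \<lparr>tapes = K, states = card Q, symbols = 3, start = num [p], halt = num [],
    delta = (\<lambda>q rs. (num (control (dec q) (look rs)), map (action (dec q) (look rs)) [0..<K]))\<rparr>"
  have p_in: "[p] \<in> Q" "[] \<in> Q" by (auto simp: Q_def conts_self)
  have "wf_tm M"
    unfolding wf_tm_def
  proof (intro conjI allI impI)
    fix q rs
    assume q: "q < states M" and rs: "length rs = tapes M \<and> (\<forall>r\<in>set rs. r < symbols M)"
    show "fst (delta M q rs) < states M"
      using q by (simp add: M_def closed dec_in num_less)
    show "length (snd (delta M q rs)) = tapes M" by (simp add: M_def)
    have "look rs i < 3" for i using rs by (auto simp: look_def M_def)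
    then have "fst (action (dec q) (look rs) i) < 3" for i by (rule action_bound)
    then have "\<forall>a\<in>set (snd (delta M q rs)). fst a < symbols M" by (simp add: M_def)
    then show "\<forall>(s, d)\<in>set (snd (delta M q rs)). s < symbols M" by fastforce
  qed (use assms p_in num_less in \<open>auto simp: M_def\<close>)
  have one: "step M (num k, map T [0..<K]) = (num (fst (pstep (k, T))), map (snd (pstep (k, T))) [0..<K])"
    if k: "k \<in> Q" for k T
  proof (cases "k = []")
    case True
    then show ?thesis by (simp add: step_def M_def pstep_def)
  next
    case False
    then have "num k \<noteq> num []" using dec k p_in by metis
    have regs_k: "r < K" if "q \<in> set k" "r \<in> regs q" for q r
      using regs_conts[of k p "[]" q] that k False assms by (auto simp: Q_def)
    let ?f = "\<lambda>i. read (T i)" and ?g = "look (map read (map T [0..<K]))"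
    have fg: "?g i = ?f i" if "i < K" for i using that by (simp add: look_def)
    have "control k ?g = control k ?f" 
      by (rule control_cong) (meson fg regs_k)
    moreover have "action k ?g i = action k ?f i" if "i < K" for i
      using that fg by (cases "(k, ?f, i)" rule: action.cases) auto
    ultimately show ?thesis
      using \<open>num k \<noteq> num []\<close> dec[OF k]
      by (auto simp: step_def M_def pstep_def Let_def intro!: nth_equalityI)
  qed
  have many: "(step M ^^ n) (num k, map T [0..<K]) =
      (num (fst ((pstep ^^ n) (k, T))), map (snd ((pstep ^^ n) (k, T))) [0..<K]) \<and>
      fst ((pstep ^^ n) (k, T)) \<in> Q" if "k \<in> Q" for k T n
  proof (induction n)
    case (Suc n)
    let ?c = "(pstep ^^ n) (k, T)"
    have "step M (num (fst ?c), map (snd ?c) [0..<K]) = (num (fst (pstep ?c)), map (snd (pstep ?c)) [0..<K])"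
      using one[of "fst ?c" "snd ?c"] Suc by simp
    moreover have "fst (pstep ?c) \<in> Q" using Suc closed by (simp add: pstep_def[of ?c] Let_def)
    ultimately show ?case using Suc by simp
  qed (use that in simp)
  have "init M w = (num [p], map (blank_tapes w) [0..<K])" for w
    using assms(2) by (auto simp: init_def M_def blank_tapes_def nth_Cons' intro!: nth_equalityI)
  then have "(step M ^^ n) (init M w) = (halt M, map T [0..<K])"
    if "(pstep ^^ n) ([p], blank_tapes w) = ([], T)" for w n T
    using many[OF p_in(1), of n "blank_tapes w"] that by (simp add: M_def)
  then show ?thesis using \<open>wf_tm M\<close> by blast
qed

subsection \<open>Tapes as stacks\<close>

text \<open>A stack occupies the cells from the head to the right; it grows to the left.\<close>

definition stack :: "tape \<Rightarrow> bool list \<Rightarrow> bool" where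
  "stack t w \<longleftrightarrow> snd t = (\<lambda>i. word_cells w (i - fst t))"

lemma word_cells_Nil [simp]: "word_cells [] = (\<lambda>_. 0)"
  by (auto simp: word_cells_def)

lemma word_cells_Cons:
  "word_cells (b # w) i = (if i = 0 then sym (Some b) else word_cells w (i - 1))"
proof -
  have "i > 0 \<Longrightarrow> nat i = Suc (nat (i - 1))" by simp
  then show ?thesis by (cases b) (auto simp: word_cells_def)
qed

fun head_sym :: "bool list \<Rightarrow> nat" where
  "head_sym [] = 0"
| "head_sym (b # w) = sym (Some b)"

lemma stack_read: "stack t w \<Longrightarrow> read t = head_sym w"
  by (cases w) (auto simp: stack_def read_def word_cells_Cons)

text \<open>Writing the blank before moving right keeps all cells left of the head blank, as
  \<open>stack\<close> demands. On an empty stack the head merely moves on, in agreement with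
  \<open>tl [] = []\<close>.\<close>

lemma stack_pop: "stack t w \<Longrightarrow> stack (act (0, MoveRight) t) (tl w)"
proof (cases t)
  case (Pair h f)
  have neg: "word_cells v i = 0" if "i < 0" for v i using that by (simp add: word_cells_def)
  assume "stack t w"
  then show ?thesis
    by (cases w) (auto simp: Pair stack_def word_cells_Cons neg fun_eq_iff algebra_simps)
qed

text \<open>A machine step writes before it moves, hence a push takes two steps: a move to the left
  that rewrites the symbol just read, and the writing of \<open>b\<close>.\<close>

lemma stack_push: "stack t w \<Longrightarrow> stack (act (sym (Some b), Stay) (act (read t, MoveLeft) t)) (b # w)"
  by (cases t) (auto simp: stack_def word_cells_Cons fun_eq_iff read_def algebra_simps)

section \<open>Execution with time bounds\<close>

text \<open>The run is required for every continuation \<open>k\<close>, which makes the runs of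
  subprograms composable. The time is only an upper bound, so costs can be rounded up.\<close>

definition truns :: "prog \<Rightarrow> (nat \<Rightarrow> tape) \<Rightarrow> (nat \<Rightarrow> tape) \<Rightarrow> nat \<Rightarrow> bool" where
  "truns p T T' n \<longleftrightarrow> (\<exists>m\<le>n. \<forall>k. (pstep ^^ m) (p # k, T) = (k, T'))"

lemma pstep_Suc: "(pstep ^^ Suc n) c = (pstep ^^ n) (pstep c)"
  by (simp add: funpow_swap1)

lemma pstep_add: "(pstep ^^ (m + n)) c = (pstep ^^ n) ((pstep ^^ m) c)"
  by (metis add.commute comp_apply funpow_add)

lemma truns_mono: "truns p T T' n \<Longrightarrow> n \<le> m \<Longrightarrow> truns p T T' m"
  unfolding truns_def by (meson order_trans)

lemma truns_first:
  assumes "\<And>k. pstep (p # k, T) = (q # k, T)" "truns q T T' n"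
  shows "truns p T T' (Suc n)"
proof -
  from assms(2) obtain m where "m \<le> n" "\<And>k. (pstep ^^ m) (q # k, T) = (k, T')"
    unfolding truns_def by blast
  then have "(pstep ^^ Suc m) (p # k, T) = (k, T')" for k
    unfolding pstep_Suc by (simp add: assms(1))
  then show ?thesis using \<open>m \<le> n\<close> unfolding truns_def by (meson Suc_le_mono)
qed

lemma truns_first2:
  assumes "\<And>k. pstep (p # k, T) = (q # q' # k, T)" "truns q T T' m" "truns q' T' T'' n"
  shows "truns p T T'' (Suc (m + n))"
proof -
  from assms(2) obtain m' where m: "m' \<le> m" "\<And>k. (pstep ^^ m') (q # k, T) = (k, T')"
    unfolding truns_def by blast
  from assms(3) obtain n' where n: "n' \<le> n" "\<And>k. (pstep ^^ n') (q' # k, T') = (k, T'')"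
    unfolding truns_def by blast
  have "(pstep ^^ Suc (m' + n')) (p # k, T) = (k, T'')" for k
    unfolding pstep_Suc pstep_add by (simp add: assms(1) m(2) n(2))
  then show ?thesis using m(1) n(1) unfolding truns_def by (meson Suc_le_mono add_mono)
qed

lemma truns_Seq:
  "truns p T T' m \<Longrightarrow> truns q T' T'' n \<Longrightarrow> truns (Seq p q) T T'' (Suc (m + n))"
  by (rule truns_first2[of _ _ p q]) (simp_all add: pstep_def)

lemma truns_Ite:
  "truns (if read (T r) \<in> S then p else q) T T' n \<Longrightarrow> truns (Ite r S p q) T T' (Suc n)"
  by (rule truns_first[where q = "if read (T r) \<in> S then p else q"]) (simp_all add: pstep_def)

lemma truns_While_stop: "read (T r) \<notin> S \<Longrightarrow> truns (While r S p) T T 1"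
  unfolding truns_def by (rule exI[of _ 1]) (simp add: pstep_def)

lemma truns_While_step:
  "read (T r) \<in> S \<Longrightarrow> truns p T T' m \<Longrightarrow> truns (While r S p) T' T'' n \<Longrightarrow>
    truns (While r S p) T T'' (Suc (m + n))"
  by (rule truns_first2[of _ _ p "While r S p"]) (simp_all add: pstep_def)

lemma truns_Put: "truns (Put r s d) T (T(r := act (sym s, d) (T r))) 1"
  unfolding truns_def by (rule exI[of _ 1]) (auto simp: pstep_def)

lemma truns_Move: "truns (Move r d) T (T(r := act (read (T r), d) (T r))) 1"
  unfolding truns_def by (rule exI[of _ 1]) (auto simp: pstep_def)

lemma control_regs:
  "\<forall>q\<in>set k. r \<notin> regs q \<Longrightarrow> \<forall>q\<in>set (control k f). r \<notin> regs q"
  by (cases "(k, f)" rule: control.cases) auto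

lemma action_untouched: "\<forall>q\<in>set k. r \<notin> regs q \<Longrightarrow> action k f r = (f r, Stay)"
  by (cases "(k, f, r)" rule: action.cases) auto

text \<open>For the output tape it is not enough to be an empty stack, as this leaves the head
  position open. A tape that does not occur in the program keeps its head on cell 0 as well.\<close>

lemma truns_untouched:
  assumes "truns p T T' n" "r \<notin> regs p"
  shows "T' r = T r"
proof -
  have "(\<forall>q\<in>set k. r \<notin> regs q) \<Longrightarrow> snd ((pstep ^^ m) (k, T)) r = T r \<and>
      (\<forall>q\<in>set (fst ((pstep ^^ m) (k, T))). r \<notin> regs q)" for k m
  proof (induction m)
    case (Suc m)
    let ?c = "(pstep ^^ m) (k, T)"
    have "snd (pstep ?c) r = snd ?c r \<and> (\<forall>q\<in>set (fst (pstep ?c)). r \<notin> regs q)"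
      using Suc control_regs[of "fst ?c" r] action_untouched[of "fst ?c" r]
      by (auto simp: pstep_def[of ?c] Let_def)
    then show ?case using Suc by simp
  qed simp
  moreover obtain m where "(pstep ^^ m) ([p], T) = ([], T')"
    using assms(1) unfolding truns_def by blast
  ultimately show ?thesis using assms(2) by (metis snd_conv list.set(1,2) singletonD)
qed

definition runs :: "prog \<Rightarrow> (nat \<Rightarrow> bool list) \<Rightarrow> (nat \<Rightarrow> bool list) \<Rightarrow> nat \<Rightarrow> bool" where
  "runs p \<sigma> \<sigma>' n \<longleftrightarrow> (\<forall>T. (\<forall>i. stack (T i) (\<sigma> i)) \<longrightarrow>
     (\<exists>T'. (\<forall>i. stack (T' i) (\<sigma>' i)) \<and> truns p T T' n))"

lemma runs_eq: "runs p \<sigma> \<sigma>' n \<Longrightarrow> \<sigma>' = \<sigma>'' \<Longrightarrow> n \<le> m \<Longrightarrow> runs p \<sigma> \<sigma>'' m"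
  unfolding runs_def by (meson truns_mono)

lemma runs_Seq: "runs p \<sigma> \<sigma>' m \<Longrightarrow> runs q \<sigma>' \<sigma>'' n \<Longrightarrow> runs (Seq p q) \<sigma> \<sigma>'' (Suc (m + n))"
  unfolding runs_def by (meson truns_Seq)

lemma runs_Ite:
  "runs (if head_sym (\<sigma> r) \<in> S then p else q) \<sigma> \<sigma>' n \<Longrightarrow> runs (Ite r S p q) \<sigma> \<sigma>' (Suc n)"
  unfolding runs_def using truns_Ite stack_read by metis

lemma runs_While_stop: "head_sym (\<sigma> r) \<notin> S \<Longrightarrow> runs (While r S p) \<sigma> \<sigma> 1"
  unfolding runs_def using truns_While_stop stack_read by metis

lemma runs_While_step:
  "head_sym (\<sigma> r) \<in> S \<Longrightarrow> runs p \<sigma> \<sigma>' m \<Longrightarrow> runs (While r S p) \<sigma>' \<sigma>'' n \<Longrightarrow>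
    runs (While r S p) \<sigma> \<sigma>'' (Suc (m + n))"
  unfolding runs_def using truns_While_step stack_read by metis

lemma runs_Move_Stay: "runs (Move r Stay) \<sigma> \<sigma> 1"
  unfolding runs_def using truns_Move[of r Stay] by (metis act_read_Stay fun_upd_triv)

abbreviation pop :: "nat \<Rightarrow> prog" where
  "pop r \<equiv> Put r None MoveRight"

definition push :: "nat \<Rightarrow> bool \<Rightarrow> prog" where
  "push r b = Seq (Move r MoveLeft) (Put r (Some b) Stay)"

lemma runs_pop: "runs (pop r) \<sigma> (\<sigma>(r := tl (\<sigma> r))) 1"
  unfolding runs_def
proof (intro allI impI)
  fix T assume T: "\<forall>i. stack (T i) (\<sigma> i)"
  then have "\<forall>i. stack ((T(r := act (sym None, MoveRight) (T r))) i) ((\<sigma>(r := tl (\<sigma> r))) i)"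
    using stack_pop by auto
  then show "\<exists>T'. (\<forall>i. stack (T' i) ((\<sigma>(r := tl (\<sigma> r))) i)) \<and> truns (pop r) T T' 1"
    using truns_Put by blast
qed

lemma runs_push: "runs (push r b) \<sigma> (\<sigma>(r := b # \<sigma> r)) 3"
  unfolding runs_def
proof (intro allI impI)
  fix T assume T: "\<forall>i. stack (T i) (\<sigma> i)"
  let ?T = "T(r := act (read (T r), MoveLeft) (T r))"
  let ?T' = "?T(r := act (sym (Some b), Stay) (?T r))"
  have "truns (push r b) T ?T' (Suc (1 + 1))"
    unfolding push_def by (rule truns_Seq[OF truns_Move truns_Put])
  moreover have "\<forall>i. stack (?T' i) ((\<sigma>(r := b # \<sigma> r)) i)"
    using T stack_push by auto
  ultimately show "\<exists>T'. (\<forall>i. stack (T' i) ((\<sigma>(r := b # \<sigma> r)) i)) \<and> truns (push r b) T T' 3"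
    by (metis numeral_3_eq_3 one_add_one numeral_2_eq_2)
qed


subsection \<open>Basic stack programs\<close>

fun pushw :: "nat \<Rightarrow> bool list \<Rightarrow> prog" where
  "pushw r [] = Move r Stay"
| "pushw r (b # w) = Seq (pushw r w) (push r b)"

lemma runs_pushw: "runs (pushw r w) \<sigma> (\<sigma>(r := w @ \<sigma> r)) (4 * length w + 1)"
proof (induction w)
  case Nil
  then show ?case using runs_Move_Stay by simp
next
  case (Cons b w)
  have "runs (pushw r (b # w)) \<sigma> (\<sigma>(r := w @ \<sigma> r, r := b # (\<sigma>(r := w @ \<sigma> r)) r)) (Suc ((4 * length w + 1) + 3))"
    unfolding pushw.simps by (rule runs_Seq[OF Cons runs_push])
  then show ?case by (rule runs_eq) auto
qed

text \<open>One loop from which moving, copying, clearing and recoding bit by bit arise by the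
  choice of \<open>g\<close> and \<open>h\<close>. The set \<open>{1, 2}\<close> tests for a
  nonempty stack, \<open>{2}\<close> for a 1 on its top.\<close>

definition transduce :: "nat \<Rightarrow> nat \<Rightarrow> (bool \<Rightarrow> bool list) \<Rightarrow> nat \<Rightarrow> (bool \<Rightarrow> bool list) \<Rightarrow> prog" where
  "transduce r r1 g r2 h = While r {1, 2} (Ite r {2}
     (Seq (pop r) (Seq (pushw r1 (g True)) (pushw r2 (h True))))
     (Seq (pop r) (Seq (pushw r1 (g False)) (pushw r2 (h False)))))"

text \<open>Popping reverses the order, hence \<open>rev\<close>. The constant 7 in \<open>c\<close>
  is the overhead per bit: loop test, case distinction, pop, and the sequencing of two pushes of
  empty words. The lengths for both bits are added in place of a maximum.\<close>

lemma runs_transduce: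
  fixes g h :: "bool \<Rightarrow> bool list"
  assumes "r \<noteq> r1" "r \<noteq> r2" "r1 \<noteq> r2"
  defines "c \<equiv> 7 + 4 * (length (g True) + length (g False) + length (h True) + length (h False))"
  shows "runs (transduce r r1 g r2 h) \<sigma>
    (\<sigma>(r := [], r1 := concat (map g (rev (\<sigma> r))) @ \<sigma> r1, r2 := concat (map h (rev (\<sigma> r))) @ \<sigma> r2))
    (c * length (\<sigma> r) + 1)"
proof (induction "\<sigma> r" arbitrary: \<sigma>)
  case Nil
  then have "runs (transduce r r1 g r2 h) \<sigma> \<sigma> 1"
    unfolding transduce_def by (intro runs_While_stop) (simp flip: Nil)
  then show ?case by (rule runs_eq) (auto simp flip: Nil)
next
  case (Cons b w)
  let ?\<sigma> = "\<sigma>(r := w, r1 := g b @ \<sigma> r1, r2 := h b @ \<sigma> r2)"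
  have "runs (Seq (pop r) (Seq (pushw r1 (g b)) (pushw r2 (h b)))) \<sigma> ?\<sigma> (c - 2)"
    by (rule runs_eq[OF runs_Seq[OF runs_pop runs_Seq[OF runs_pushw runs_pushw]]])
      (use assms Cons.hyps(2)[symmetric] in \<open>cases b; auto simp: c_def\<close>)+
  then have "runs (Ite r {2} (Seq (pop r) (Seq (pushw r1 (g True)) (pushw r2 (h True))))
     (Seq (pop r) (Seq (pushw r1 (g False)) (pushw r2 (h False))))) \<sigma> ?\<sigma> (Suc (c - 2))"
    by (intro runs_Ite) (cases b; simp flip: Cons.hyps(2))
  moreover have "head_sym (\<sigma> r) \<in> {1, 2}" using Cons.hyps(2)[symmetric] by (cases b) auto
  moreover note Cons.hyps(1)[of ?\<sigma>]
  ultimately have "runs (transduce r r1 g r2 h) \<sigma>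
    (?\<sigma>(r := [], r1 := concat (map g (rev (?\<sigma> r))) @ ?\<sigma> r1, r2 := concat (map h (rev (?\<sigma> r))) @ ?\<sigma> r2))
    (Suc (Suc (c - 2) + (c * length (?\<sigma> r) + 1)))"
    unfolding transduce_def using assms by (intro runs_While_step) auto
  then show ?case
    by (rule runs_eq) (use assms Cons.hyps(2)[symmetric] in auto)
qed

text \<open>\<open>Suc (r + r')\<close> is just some register different from both; nothing is pushed
  on it.\<close>

definition mv :: "nat \<Rightarrow> nat \<Rightarrow> prog" where
  "mv r r' = transduce r r' (\<lambda>b. [b]) (Suc (r + r')) (\<lambda>b. [])"

lemma runs_mv:
  "r \<noteq> r' \<Longrightarrow> runs (mv r r') \<sigma> (\<sigma>(r := [], r' := rev (\<sigma> r) @ \<sigma> r')) (15 * length (\<sigma> r) + 1)"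
proof -
  assume "r \<noteq> r'"
  have "concat (map (\<lambda>b. []) w) = []" for w :: "bool list" by (induction w) auto
  with \<open>r \<noteq> r'\<close> show ?thesis unfolding mv_def
    by (intro runs_eq[OF runs_transduce]) auto
qed

definition copy :: "nat \<Rightarrow> nat \<Rightarrow> nat \<Rightarrow> prog" where
  "copy r r1 r2 = transduce r r1 (\<lambda>b. [b]) r2 (\<lambda>b. [b])"

lemma runs_copy:
  "r \<noteq> r1 \<Longrightarrow> r \<noteq> r2 \<Longrightarrow> r1 \<noteq> r2 \<Longrightarrow>
   runs (copy r r1 r2) \<sigma> (\<sigma>(r := [], r1 := rev (\<sigma> r) @ \<sigma> r1, r2 := rev (\<sigma> r) @ \<sigma> r2)) (23 * length (\<sigma> r) + 1)"
  unfolding copy_def by (intro runs_eq[OF runs_transduce]) auto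

definition clear :: "nat \<Rightarrow> prog" where
  "clear r = transduce r (r + 1) (\<lambda>b. []) (r + 2) (\<lambda>b. [])"

lemma runs_clear: "runs (clear r) \<sigma> (\<sigma>(r := [])) (7 * length (\<sigma> r) + 1)"
proof -
  have "concat (map (\<lambda>b. []) w) = []" for w :: "bool list" by (induction w) auto
  then show ?thesis unfolding clear_def
    by (intro runs_eq[OF runs_transduce]) auto
qed

text \<open>A left inverse of \<^const>\<open>pair\<close>, total so that verifiers can apply it to arbitrary words.\<close>

fun unpair :: "bool list \<Rightarrow> bool list \<times> bool list" where
  "unpair [] = ([], [])"
| "unpair (False # w) = ([], w)"
| "unpair [True] = ([False], [])"
| "unpair (True # b # w) = (b # fst (unpair w), snd (unpair w))"

lemma unpair_pair [simp]: "unpair (pair u v) = (u, v)"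
  by (induction u) (auto simp: pair_def enc_bits_def)

lemma length_pair: "length (pair u v) = 2 * length u + length v + 1"
  by (induction u) (auto simp: pair_def enc_bits_def)

lemma length_unpair: "2 * length (fst (unpair w)) + length (snd (unpair w)) \<le> length w + 1"
  by (induction w rule: unpair.induct) auto

text \<open>The last \<open>pop\<close> removes the end marker. On the malformed word
  \<open>[True]\<close> the missing bit is read as a blank and counts as \<open>False\<close>; the
  clause for \<open>unpair [True]\<close> agrees with this.\<close>

definition split :: "nat \<Rightarrow> nat \<Rightarrow> prog" where
  "split r r' = Seq (While r {2} (Seq (pop r)
     (Ite r {2} (Seq (pop r) (push r' True)) (Seq (pop r) (push r' False))))) (pop r)"

lemma runs_split:
  assumes "r \<noteq> r'"
  shows "runs (split r r') \<sigma>
    (\<sigma>(r := snd (unpair (\<sigma> r)), r' := rev (fst (unpair (\<sigma> r))) @ \<sigma> r')) (10 * length (\<sigma> r) + 3)"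
proof -
  let ?body = "Seq (pop r) (Ite r {2} (Seq (pop r) (push r' True)) (Seq (pop r) (push r' False)))"
  have body: "runs ?body \<sigma> (\<sigma>(r := tl (tl (\<sigma> r)), r' := (head_sym (tl (\<sigma> r)) = 2) # \<sigma> r')) 8" for \<sigma>
  proof -
    let ?\<sigma> = "\<sigma>(r := tl (\<sigma> r))"
    have "runs (Seq (pop r) (push r' c)) ?\<sigma> (\<sigma>(r := tl (tl (\<sigma> r)), r' := c # \<sigma> r')) 5" for c
      by (rule runs_eq[OF runs_Seq[OF runs_pop runs_push]]) (use assms in auto)
    from this[of True] this[of False]
    have "runs (if head_sym (?\<sigma> r) \<in> {2} then Seq (pop r) (push r' True) else Seq (pop r) (push r' False))
      ?\<sigma> (\<sigma>(r := tl (tl (\<sigma> r)), r' := (head_sym (tl (\<sigma> r)) = 2) # \<sigma> r')) 5" by simp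
    from runs_Seq[OF runs_pop runs_Ite[OF this]] show ?thesis
      by (rule runs_eq) (simp_all add: fun_eq_iff)
  qed
  \<comment> \<open>The loop stops in front of the marker, so \<open>v\<close> is the marker
    followed by the second component, or empty if the word has no marker.\<close>
  have loop: "\<exists>v. tl v = snd (unpair w) \<and>
      runs (While r {2} ?body) \<sigma> (\<sigma>(r := v, r' := rev (fst (unpair w)) @ \<sigma> r')) (10 * length w + 1)"
    if "\<sigma> r = w" for w \<sigma>
    using that
  proof (induction w arbitrary: \<sigma> rule: unpair.induct)
    case 1
    then have "runs (While r {2} ?body) \<sigma> \<sigma> 1" by (intro runs_While_stop) simp
    then have "runs (While r {2} ?body) \<sigma> (\<sigma>(r := [], r' := rev (fst (unpair [])) @ \<sigma> r')) (10 * length [] + 1)"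
      by (rule runs_eq) (use 1 in auto)
    then show ?case by (intro exI[of _ "[]"] conjI) simp
  next
    case (2 w)
    then have "runs (While r {2} ?body) \<sigma> \<sigma> 1" by (intro runs_While_stop) simp
    then have "runs (While r {2} ?body) \<sigma> (\<sigma>(r := False # w, r' := rev (fst (unpair (False # w))) @ \<sigma> r')) (10 * length (False # w) + 1)"
      by (rule runs_eq) (use 2 in auto)
    then show ?case by (intro exI[of _ "False # w"] conjI) simp
  next
    case 3
    let ?\<sigma> = "\<sigma>(r := [], r' := False # \<sigma> r')"
    have "runs ?body \<sigma> ?\<sigma> 8"
      by (rule runs_eq[OF body[of \<sigma>]]) (use 3 in auto)
    moreover have "runs (While r {2} ?body) ?\<sigma> ?\<sigma> 1"
      using assms by (intro runs_While_stop) simp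
    moreover have "head_sym (\<sigma> r) \<in> {2}" using 3 by simp
    ultimately have "runs (While r {2} ?body) \<sigma> ?\<sigma> (Suc (8 + 1))"
      using runs_While_step by blast
    then have "runs (While r {2} ?body) \<sigma> (\<sigma>(r := [], r' := rev (fst (unpair [True])) @ \<sigma> r')) (10 * length [True] + 1)"
      by (rule runs_eq) auto
    then show ?case by (intro exI[of _ "[]"] conjI) simp
  next
    case (4 b w)
    let ?\<sigma> = "\<sigma>(r := w, r' := b # \<sigma> r')"
    have "?\<sigma> r = w" using assms by auto
    from "4.IH"[of ?\<sigma>, OF this] obtain v where v: "tl v = snd (unpair w)"
      "runs (While r {2} ?body) ?\<sigma> (?\<sigma>(r := v, r' := rev (fst (unpair w)) @ ?\<sigma> r')) (10 * length w + 1)"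
      by blast
    have "runs ?body \<sigma> ?\<sigma> 8"
      by (rule runs_eq[OF body[of \<sigma>]]) (use "4.prems" in \<open>cases b; auto\<close>)+
    from runs_While_step[OF _ this v(2)]
    have "runs (While r {2} ?body) \<sigma> (?\<sigma>(r := v, r' := rev (fst (unpair w)) @ ?\<sigma> r')) (Suc (8 + (10 * length w + 1)))"
      using "4.prems" by simp
    then have "runs (While r {2} ?body) \<sigma> (\<sigma>(r := v, r' := rev (fst (unpair (True # b # w))) @ \<sigma> r')) (10 * length (True # b # w) + 1)"
      by (rule runs_eq) auto
    then show ?case using v(1) by (intro exI[of _ v] conjI) simp
  qed
  from loop[where \<sigma> = \<sigma> and w = "\<sigma> r", OF refl] obtain v where v: "tl v = snd (unpair (\<sigma> r))"
    "runs (While r {2} ?body) \<sigma> (\<sigma>(r := v, r' := rev (fst (unpair (\<sigma> r))) @ \<sigma> r')) (10 * length (\<sigma> r) + 1)"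
    by blast
  show ?thesis unfolding split_def
    by (rule runs_eq[OF runs_Seq[OF v(2) runs_pop]]) (use assms in \<open>simp_all add: fun_eq_iff v(1)\<close>)
qed

section \<open>Polynomial-time functions on encodable types\<close>

definition poly_bounded :: "(nat \<Rightarrow> nat) \<Rightarrow> bool" where
  "poly_bounded t \<longleftrightarrow> (\<exists>p :: nat poly. \<forall>n. t n \<le> poly p n)"

text \<open>The coefficients are natural numbers and hence nonnegative.\<close>

lemma poly_nat_mono: "m \<le> n \<Longrightarrow> poly (p :: nat poly) m \<le> poly p n"
  by (induction p) (simp_all add: mult_le_mono)

lemma poly_bounded_const: "poly_bounded (\<lambda>n. c)"
  unfolding poly_bounded_def by (intro exI[of _ "[:c:]"]) simp

lemma poly_bounded_id: "poly_bounded (\<lambda>n. n)"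
  unfolding poly_bounded_def by (intro exI[of _ "[:0, 1:]"]) simp

lemma poly_bounded_add:
  assumes "poly_bounded s" "poly_bounded t"
  shows "poly_bounded (\<lambda>n. s n + t n)"
proof -
  obtain p q where "\<And>n. s n \<le> poly p n" "\<And>n. t n \<le> poly q n"
    using assms unfolding poly_bounded_def by blast
  then have "s n + t n \<le> poly (p + q) n" for n by (simp add: add_mono)
  then show ?thesis unfolding poly_bounded_def by blast
qed

lemma poly_bounded_mult:
  assumes "poly_bounded s" "poly_bounded t"
  shows "poly_bounded (\<lambda>n. s n * t n)"
proof -
  obtain p q where "\<And>n. s n \<le> poly p n" "\<And>n. t n \<le> poly q n"
    using assms unfolding poly_bounded_def by blast
  then have "s n * t n \<le> poly (p * q) n" for n by (simp add: mult_le_mono)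
  then show ?thesis unfolding poly_bounded_def by blast
qed

lemma poly_bounded_Suc: "poly_bounded s \<Longrightarrow> poly_bounded (\<lambda>n. Suc (s n))"
  using poly_bounded_add[OF _ poly_bounded_const[of 1]] by simp

lemma poly_bounded_poly:
  assumes "poly_bounded t"
  shows "poly_bounded (\<lambda>n. poly p (t n))"
proof -
  obtain q where "\<And>n. t n \<le> poly q n" using assms unfolding poly_bounded_def by blast
  then have "poly p (t n) \<le> poly (pcompose p q) n" for n
    by (simp add: poly_pcompose poly_nat_mono)
  then show ?thesis unfolding poly_bounded_def by blast
qed

lemmas poly_bounded_intros = poly_bounded_const poly_bounded_id poly_bounded_add poly_bounded_mult
  poly_bounded_Suc poly_bounded_poly

text \<open>Codes are injective but in general not prefix-free; \<open>enc_bits\<close> supplies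
  delimiters wherever codes are put one after the other.\<close>

class enc =
  fixes code :: "'a \<Rightarrow> bool list"
  assumes code_inject: "code x = code y \<longleftrightarrow> x = y"

abbreviation size_of :: "'a::enc \<Rightarrow> nat" where
  "size_of x \<equiv> length (code x)"

definition computes :: "prog \<Rightarrow> nat \<Rightarrow> ('a::enc \<Rightarrow> 'b::enc) \<Rightarrow> (nat \<Rightarrow> nat) \<Rightarrow> bool" where
  "computes p b f t \<longleftrightarrow> (\<forall>\<sigma> x. \<sigma> b = code x \<longrightarrow> (\<forall>i>b. \<sigma> i = []) \<longrightarrow>
     runs p \<sigma> (\<sigma>(b := code (f x))) (t (size_of x)))"

text \<open>The program for \<open>f\<close> may be placed at any base register \<open>b\<close>; it uses the registers above
  \<open>b\<close> as scratch space and leaves those below untouched.\<close>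

definition PT :: "('a::enc \<Rightarrow> 'b::enc) \<Rightarrow> bool" where
  "PT f \<longleftrightarrow> (\<exists>t. poly_bounded t \<and> (\<forall>x. size_of (f x) \<le> t (size_of x)) \<and> (\<forall>b. \<exists>p. computes p b f t))"

lemma computesI:
  fixes f :: "'a::enc \<Rightarrow> 'b::enc"
  assumes "\<And>\<sigma> x. \<sigma> b = code x \<Longrightarrow> \<forall>i>b. \<sigma> i = [] \<Longrightarrow> runs p \<sigma> (\<sigma>(b := code (f x))) (t (size_of x))"
  shows "computes p b f t"
  unfolding computes_def
proof (intro allI impI)
  fix \<sigma> and x :: 'a
  assume "\<sigma> b = code x" "\<forall>i>b. \<sigma> i = []"
  then show "runs p \<sigma> (\<sigma>(b := code (f x))) (t (size_of x))" by (rule assms[of \<sigma> x])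
qed

lemma computesD:
  fixes f :: "'a::enc \<Rightarrow> 'b::enc"
  assumes "computes p b f t" "\<sigma> b = code x" "\<forall>i>b. \<sigma> i = []"
  shows "runs p \<sigma> (\<sigma>(b := code (f x))) (t (size_of x))"
  using assms(1)[unfolded computes_def, THEN spec, of \<sigma>, THEN spec, of x] assms(2,3) by simp

lemma PT_I:
  assumes "poly_bounded t" "\<And>x. size_of (f x) \<le> t (size_of x)" "\<And>b. computes (P b) b f t"
  shows "PT f"
  unfolding PT_def by (rule exI[of _ t]) (use assms in \<open>simp; fast\<close>)

lemma PT_E:
  fixes f :: "'a::enc \<Rightarrow> 'b::enc"
  assumes "PT f"
  obtains q P where "\<And>x. size_of (f x) \<le> poly q (size_of x)" "\<And>b. computes (P b) b f (poly q)"
proof -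
  from assms obtain t where t: "poly_bounded t" "\<forall>x. size_of (f x) \<le> t (size_of x)"
    "\<forall>b. \<exists>p. computes p b f t" unfolding PT_def by blast
  from t(1) obtain q where q: "\<And>n. t n \<le> poly q n" unfolding poly_bounded_def by blast
  from t(3) obtain P where P: "\<And>b. computes (P b) b f t" by metis
  have "computes (P b) b f (poly q)" for b
  proof (rule computesI)
    fix \<sigma> and x :: 'a assume "\<sigma> b = code x" "\<forall>i>b. \<sigma> i = []"
    then have "runs (P b) \<sigma> (\<sigma>(b := code (f x))) (t (size_of x))" by (rule computesD[OF P])
    then show "runs (P b) \<sigma> (\<sigma>(b := code (f x))) (poly q (size_of x))" by (rule runs_eq[OF _ refl q])
  qed
  moreover have "size_of (f x) \<le> poly q (size_of x)" for x using t(2) q le_trans by blast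
  ultimately show ?thesis using that by blast
qed

lemma PT_size:
  assumes "PT f" obtains q where "\<And>x. size_of (f x) \<le> poly q (size_of x)"
  using assms by (rule PT_E) blast

lemma PT_recode: "(\<And>x. code (f x) = code x) \<Longrightarrow> PT f"
  by (rule PT_I[where t = "\<lambda>n. n + 1" and P = "\<lambda>b. Move b Stay"])
    (auto intro!: poly_bounded_intros computesI runs_eq[OF runs_Move_Stay])

lemma PT_id: "PT (\<lambda>x. x)"
  by (rule PT_recode) simp

lemma PT_const: "PT (\<lambda>x. c)"
  by (rule PT_I[where t = "\<lambda>n. 7 * n + 4 * size_of c + 3" and P = "\<lambda>b. Seq (clear b) (pushw b (code c))"])
    (auto intro!: poly_bounded_intros computesI runs_eq[OF runs_Seq[OF runs_clear runs_pushw]])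

lemma PT_push: "(\<And>x. code (f x) = b # code x) \<Longrightarrow> PT f"
  by (rule PT_I[where t = "\<lambda>n. n + 3" and P = "\<lambda>r. push r b"])
    (auto intro!: poly_bounded_intros computesI runs_eq[OF runs_push])

lemma PT_pop: "(\<And>x. code (f x) = tl (code x)) \<Longrightarrow> PT f"
  by (rule PT_I[where t = "\<lambda>n. n + 1" and P = "\<lambda>r. pop r"])
    (auto intro!: poly_bounded_intros computesI runs_eq[OF runs_pop])

lemma PT_comp:
  fixes f :: "'a::enc \<Rightarrow> 'b::enc" and g :: "'b \<Rightarrow> 'c::enc"
  assumes "PT g" "PT f"
  shows "PT (\<lambda>x. g (f x))"
proof -
  obtain q P where f: "\<And>x. size_of (f x) \<le> poly q (size_of x)" "\<And>b. computes (P b) b f (poly q)"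
    using PT_E[OF assms(2)] by metis
  obtain q' P' where g: "\<And>x. size_of (g x) \<le> poly q' (size_of x)" "\<And>b. computes (P' b) b g (poly q')"
    using PT_E[OF assms(1)] by metis
  have le: "poly q' (size_of (f x)) \<le> poly q' (poly q (size_of x))" for x
    by (rule poly_nat_mono[OF f(1)])
  have size: "size_of (g (f x)) \<le> Suc (poly q (size_of x) + poly q' (poly q (size_of x)))" for x
    using g(1)[of "f x"] le[of x] by linarith
  show ?thesis
  proof (rule PT_I[where t = "\<lambda>n. Suc (poly q n + poly q' (poly q n))" and P = "\<lambda>b. Seq (P b) (P' b)"])
    fix b
    show "computes (Seq (P b) (P' b)) b (\<lambda>x. g (f x)) (\<lambda>n. Suc (poly q n + poly q' (poly q n)))"
    proof (rule computesI)
      fix \<sigma> and x :: 'a assume *: "\<sigma> b = code x" "\<forall>i>b. \<sigma> i = []"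
      have 1: "runs (P b) \<sigma> (\<sigma>(b := code (f x))) (poly q (size_of x))"
        by (rule computesD[OF f(2) *])
      have 2: "runs (P' b) (\<sigma>(b := code (f x))) (\<sigma>(b := code (f x), b := code (g (f x)))) (poly q' (size_of (f x)))"
        by (rule computesD[OF g(2)]) (use * in auto)
      show "runs (Seq (P b) (P' b)) \<sigma> (\<sigma>(b := code (g (f x)))) (Suc (poly q (size_of x) + poly q' (poly q (size_of x))))"
        by (rule runs_eq[OF runs_Seq[OF 1 2]]) (use le[of x] in auto)
    qed
  qed (intro poly_bounded_intros size)+
qed

instantiation prod :: (enc, enc) enc
begin
definition code_prod :: "'a \<times> 'b \<Rightarrow> bool list" where
  "code_prod x = pair (code (fst x)) (code (snd x))"
instance by standard (auto simp: code_prod_def pair_inject code_inject prod_eq_iff)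
end

text \<open>A program may use every register above its base, so whatever has to survive is parked
  below: \<open>f\<close> runs at \<open>b+2\<close> while the input is kept at \<open>b\<close>,
  and \<open>g\<close> runs at \<open>b+3\<close>, above the result of \<open>f\<close>. Each
  transport takes an even number of reversals in total.\<close>

lemma PT_pair:
  fixes f :: "'a::enc \<Rightarrow> 'b::enc" and g :: "'a \<Rightarrow> 'c::enc"
  assumes "PT f" "PT g"
  shows "PT (\<lambda>x. (f x, g x))"
proof -
  obtain q P where f: "\<And>x. size_of (f x) \<le> poly q (size_of x)" "\<And>b. computes (P b) b f (poly q)"
    using PT_E[OF assms(1)] by metis
  obtain q' P' where g: "\<And>x. size_of (g x) \<le> poly q' (size_of x)" "\<And>b. computes (P' b) b g (poly q')"
    using PT_E[OF assms(2)] by metis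
  define e where "e b = transduce (b+1) b (\<lambda>c. [True, c]) (b+2) (\<lambda>_. [])" for b
  have nil: "concat (map (\<lambda>b. []) w) = []" for w :: "bool list" by (induction w) auto
  define R where "R b = Seq (mv b (b+1)) (Seq (copy (b+1) b (b+2)) (Seq (P (b+2)) (Seq (mv b (b+1)) (Seq (mv (b+1) (b+3))
     (Seq (P' (b+3)) (Seq (mv (b+3) (b+1)) (Seq (mv (b+1) b) (Seq (mv (b+2) (b+1)) (Seq (push b False) (e b))))))))))" for b
  have "computes (R b) b (\<lambda>x. (f x, g x)) (\<lambda>n. 200 * (n + poly q n + poly q' n) + 200)" for b
  proof (rule computesI)
    fix \<sigma> and x :: 'a assume *: "\<sigma> b = code x" "\<forall>i>b. \<sigma> i = []"
    let ?X = "code x" and ?U = "code (f x)" and ?V = "code (g x)"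
    let ?n = "length ?X"
    have 1: "runs (mv b (b+1)) \<sigma> (\<sigma>(b := [], b+1 := rev ?X)) (15 * ?n + 1)"
      by (rule runs_eq[OF runs_mv]) (use * in auto)
    have 2: "runs (copy (b+1) b (b+2)) (\<sigma>(b := [], b+1 := rev ?X)) (\<sigma>(b+2 := ?X)) (23 * ?n + 1)"
      by (rule runs_eq[OF runs_copy]) (use * in auto)
    have 3: "runs (P (b+2)) (\<sigma>(b+2 := ?X)) (\<sigma>(b+2 := ?U)) (poly q ?n)"
      by (rule runs_eq[OF computesD[OF f(2), of _ _ x]]) (use * in auto)
    have 4: "runs (mv b (b+1)) (\<sigma>(b+2 := ?U)) (\<sigma>(b+2 := ?U, b := [], b+1 := rev ?X)) (15 * ?n + 1)"
      by (rule runs_eq[OF runs_mv]) (use * in auto)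
    have 5: "runs (mv (b+1) (b+3)) (\<sigma>(b+2 := ?U, b := [], b+1 := rev ?X)) (\<sigma>(b+2 := ?U, b := [], b+3 := ?X)) (15 * ?n + 1)"
      by (rule runs_eq[OF runs_mv]) (use * in auto)
    have 6: "runs (P' (b+3)) (\<sigma>(b+2 := ?U, b := [], b+3 := ?X)) (\<sigma>(b+2 := ?U, b := [], b+3 := ?V)) (poly q' ?n)"
      by (rule runs_eq[OF computesD[OF g(2), of _ _ x]]) (use * in auto)
    have 7: "runs (mv (b+3) (b+1)) (\<sigma>(b+2 := ?U, b := [], b+3 := ?V)) (\<sigma>(b+2 := ?U, b := [], b+1 := rev ?V)) (15 * length ?V + 1)"
      by (rule runs_eq[OF runs_mv]) (use * in auto)
    have 8: "runs (mv (b+1) b) (\<sigma>(b+2 := ?U, b := [], b+1 := rev ?V)) (\<sigma>(b+2 := ?U, b := ?V)) (15 * length ?V + 1)"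
      by (rule runs_eq[OF runs_mv]) (use * in auto)
    have 9: "runs (mv (b+2) (b+1)) (\<sigma>(b+2 := ?U, b := ?V)) (\<sigma>(b := ?V, b+1 := rev ?U)) (15 * length ?U + 1)"
      by (rule runs_eq[OF runs_mv]) (use * in auto)
    have 10: "runs (push b False) (\<sigma>(b := ?V, b+1 := rev ?U)) (\<sigma>(b := False # ?V, b+1 := rev ?U)) 3"
      by (rule runs_eq[OF runs_push]) (use * in auto)
    have 11: "runs (e b) (\<sigma>(b := False # ?V, b+1 := rev ?U)) (\<sigma>(b := code (f x, g x))) (23 * length ?U + 1)"
      unfolding e_def by (rule runs_eq[OF runs_transduce]) (use * in \<open>auto simp: code_prod_def pair_def enc_bits_def nil\<close>)
    note all = runs_Seq[OF 1 runs_Seq[OF 2 runs_Seq[OF 3 runs_Seq[OF 4 runs_Seq[OF 5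
      runs_Seq[OF 6 runs_Seq[OF 7 runs_Seq[OF 8 runs_Seq[OF 9 runs_Seq[OF 10 11]]]]]]]]]]
    show "runs (R b) \<sigma> (\<sigma>(b := code (f x, g x))) (200 * (?n + poly q ?n + poly q' ?n) + 200)"
      unfolding R_def by (rule runs_eq[OF all refl]) (use f(1)[of x] g(1)[of x] in simp)
  qed
  moreover have "size_of (f x, g x) \<le> 200 * (size_of x + poly q (size_of x) + poly q' (size_of x)) + 200" for x
    using f(1)[of x] g(1)[of x] by (simp add: code_prod_def length_pair)
  ultimately show ?thesis
    by (intro PT_I[where t = "\<lambda>n. 200 * (n + poly q n + poly q' n) + 200"] poly_bounded_intros)
qed


section \<open>Codes of the basic types\<close>

instantiation bool :: enc
begin
definition code_bool :: "bool \<Rightarrow> bool list" where "code_bool b = [b]"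
instance by standard (auto simp: code_bool_def)
end

instantiation nat :: enc
begin
text \<open>Unary, so that the size of a number is its value: addition is concatenation of codes,
  and a code can serve as a loop counter. Only numbers polynomial in the input size are handled in
  this way.\<close>

definition code_nat :: "nat \<Rightarrow> bool list" where "code_nat n = replicate n True"
instance by standard (auto simp: code_nat_def)
end

instantiation list :: (enc) enc
begin
definition code_list :: "'a list \<Rightarrow> bool list" where
  "code_list xs = concat (map (\<lambda>x. enc_bits (code x)) xs)"
instance
proof
  show "code x = code y \<longleftrightarrow> x = y" for x y :: "'a list"
  proof (induction x arbitrary: y)
    case Nil
    then show ?case by (cases y) (auto simp: code_list_def enc_bits_def)
  next
    case (Cons a x)
    have "enc_bits (code a) \<noteq> []" by (simp add: enc_bits_def)
    with Cons show ?case
      by (cases y) (simp_all add: code_list_def enc_bits_prefix_free code_inject)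
  qed
qed
end

text \<open>Words that are their own code, as the input of a machine is. In contrast, a
  \<open>bool list\<close> is coded with three bits for each element.\<close>

datatype raw = Raw (unraw: "bool list")

instantiation raw :: enc
begin
definition code_raw :: "raw \<Rightarrow> bool list" where "code_raw = unraw"
instance by standard (auto simp: code_raw_def raw.expand)
end

instantiation literal :: (enc) enc
begin
fun code_literal :: "'a literal \<Rightarrow> bool list" where
  "code_literal (Pos v) = True # code v"
| "code_literal (Neg v) = False # code v"
instance
proof
  show "code x = code y \<longleftrightarrow> x = y" for x y :: "'a literal"
    by (cases x; cases y) (auto simp: code_inject)
qed
end

lemma code_Raw [simp]: "code (Raw w) = w"
  by (simp add: code_raw_def)

lemma code_Nil [simp]: "code [] = []"
  by (simp add: code_list_def)

lemma code_Cons: "code (x # xs) = pair (code x) (code xs)"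
  by (simp add: code_list_def pair_def)

lemma code_append: "code (xs @ ys) = code xs @ code ys"
  by (simp add: code_list_def)

lemma code_Pair: "code (x, y) = pair (code x) (code y)"
  by (simp add: code_prod_def)

lemma size_Pair [simp]: "size_of (x, y) = 2 * size_of x + size_of y + 1"
  by (simp add: code_Pair length_pair)

lemma size_Cons [simp]: "size_of (x # xs) = 2 * size_of x + size_of xs + 1"
  by (simp add: code_Cons length_pair)

lemma size_append [simp]: "size_of (xs @ ys) = size_of xs + size_of ys"
  by (simp add: code_append)

lemma size_bool [simp]: "size_of (b :: bool) = 1"
  by (simp add: code_bool_def)

lemma size_nat [simp]: "size_of (n :: nat) = n"
  by (simp add: code_nat_def)

lemma code_eq_Nil_list [simp]: "code (xs :: 'a::enc list) = [] \<longleftrightarrow> xs = []"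
  using code_inject[of xs "[]"] by simp

lemma length_le_size: "length xs \<le> size_of xs"
  by (induction xs) auto

lemma size_elem: "x \<in> set xs \<Longrightarrow> size_of x \<le> size_of xs"
  by (induction xs) auto

lemma size_tl: "size_of (tl xs) \<le> size_of xs"
  by (cases xs) auto

lemma size_drop: "size_of (drop i xs) \<le> size_of xs"
  by (metis append_take_drop_id le_add2 size_append)

lemma PT_code_eq: "PT f \<Longrightarrow> (\<And>x. code (g x) = code (f x)) \<Longrightarrow> PT g"
  unfolding PT_def computes_def by simp

lemma PT_unpair_fst:
  assumes "\<And>x. code (f x) = fst (unpair (code x))"
  shows "PT f"
proof -
  have "computes (Seq (split b (b+1)) (Seq (clear b) (mv (b+1) b))) b f (\<lambda>n. 50 * n + 50)" for b
  proof (rule computesI)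
    fix \<sigma> and x :: 'a assume *: "\<sigma> b = code x" "\<forall>i>b. \<sigma> i = []"
    have 1: "runs (split b (b+1)) \<sigma> (\<sigma>(b := snd (unpair (code x)), b+1 := rev (fst (unpair (code x))))) (10 * size_of x + 3)"
      by (rule runs_eq[OF runs_split]) (use * in auto)
    have 2: "runs (clear b) (\<sigma>(b := snd (unpair (code x)), b+1 := rev (fst (unpair (code x)))))
        (\<sigma>(b := [], b+1 := rev (fst (unpair (code x))))) (7 * length (snd (unpair (code x))) + 1)"
      by (rule runs_eq[OF runs_clear]) (use * in auto)
    have 3: "runs (mv (b+1) b) (\<sigma>(b := [], b+1 := rev (fst (unpair (code x)))))
        (\<sigma>(b := code (f x))) (15 * length (fst (unpair (code x))) + 1)"
      by (rule runs_eq[OF runs_mv]) (use * assms in auto)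
    show "runs (Seq (split b (b+1)) (Seq (clear b) (mv (b+1) b))) \<sigma> (\<sigma>(b := code (f x))) (50 * size_of x + 50)"
      by (rule runs_eq[OF runs_Seq[OF 1 runs_Seq[OF 2 3]] refl]) (use length_unpair[of "code x"] in simp)
  qed
  moreover have "size_of (f x) \<le> 50 * size_of x + 50" for x
    using length_unpair[of "code x"] by (simp add: assms)
  ultimately show ?thesis by (intro PT_I[where t = "\<lambda>n. 50 * n + 50"] poly_bounded_intros)
qed

lemma PT_unpair_snd:
  assumes "\<And>x. code (f x) = snd (unpair (code x))"
  shows "PT f"
proof -
  have "computes (Seq (split b (b+1)) (clear (b+1))) b f (\<lambda>n. 50 * n + 50)" for b
  proof (rule computesI)
    fix \<sigma> and x :: 'a assume *: "\<sigma> b = code x" "\<forall>i>b. \<sigma> i = []"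
    have 1: "runs (split b (b+1)) \<sigma> (\<sigma>(b := snd (unpair (code x)), b+1 := rev (fst (unpair (code x))))) (10 * size_of x + 3)"
      by (rule runs_eq[OF runs_split]) (use * in auto)
    have 2: "runs (clear (b+1)) (\<sigma>(b := snd (unpair (code x)), b+1 := rev (fst (unpair (code x)))))
        (\<sigma>(b := code (f x))) (7 * length (fst (unpair (code x))) + 1)"
      by (rule runs_eq[OF runs_clear]) (use * assms in auto)
    show "runs (Seq (split b (b+1)) (clear (b+1))) \<sigma> (\<sigma>(b := code (f x))) (50 * size_of x + 50)"
      by (rule runs_eq[OF runs_Seq[OF 1 2] refl]) (use length_unpair[of "code x"] in simp)
  qed
  moreover have "size_of (f x) \<le> 50 * size_of x + 50" for x
    using length_unpair[of "code x"] by (simp add: assms)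
  ultimately show ?thesis by (intro PT_I[where t = "\<lambda>n. 50 * n + 50"] poly_bounded_intros)
qed

text \<open>Forgets the border inside a pair. As codes of lists and of numbers are concatenations,
  this yields both appending and addition.\<close>

lemma PT_unpair_join:
  assumes "\<And>x. code (f x) = fst (unpair (code x)) @ snd (unpair (code x))"
  shows "PT f"
proof -
  have "computes (Seq (split b (b+1)) (mv (b+1) b)) b f (\<lambda>n. 50 * n + 50)" for b
  proof (rule computesI)
    fix \<sigma> and x :: 'a assume *: "\<sigma> b = code x" "\<forall>i>b. \<sigma> i = []"
    have 1: "runs (split b (b+1)) \<sigma> (\<sigma>(b := snd (unpair (code x)), b+1 := rev (fst (unpair (code x))))) (10 * size_of x + 3)"
      by (rule runs_eq[OF runs_split]) (use * in auto)
    have 2: "runs (mv (b+1) b) (\<sigma>(b := snd (unpair (code x)), b+1 := rev (fst (unpair (code x)))))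
        (\<sigma>(b := code (f x))) (15 * length (fst (unpair (code x))) + 1)"
      by (rule runs_eq[OF runs_mv]) (use * assms in auto)
    show "runs (Seq (split b (b+1)) (mv (b+1) b)) \<sigma> (\<sigma>(b := code (f x))) (50 * size_of x + 50)"
      by (rule runs_eq[OF runs_Seq[OF 1 2] refl]) (use length_unpair[of "code x"] in simp)
  qed
  moreover have "size_of (f x) \<le> 50 * size_of x + 50" for x
    using length_unpair[of "code x"] by (simp add: assms)
  ultimately show ?thesis by (intro PT_I[where t = "\<lambda>n. 50 * n + 50"] poly_bounded_intros)
qed

section \<open>Tests, case distinction and iteration\<close>

lemma PT_test:
  assumes "\<And>x. f x \<longleftrightarrow> head_sym (code x) \<in> S"
  shows "PT f"
proof -
  have "computes (Ite b S (Seq (clear b) (push b True)) (Seq (clear b) (push b False))) b f (\<lambda>n. 7 * n + 10)" for b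
  proof (rule computesI)
    fix \<sigma> and x :: 'a assume *: "\<sigma> b = code x" "\<forall>i>b. \<sigma> i = []"
    have "runs (Seq (clear b) (push b c)) \<sigma> (\<sigma>(b := [c])) (7 * size_of x + 5)" for c
      by (rule runs_eq[OF runs_Seq[OF runs_clear runs_push]]) (use * in auto)
    then have "runs (if head_sym (\<sigma> b) \<in> S then Seq (clear b) (push b True) else Seq (clear b) (push b False))
        \<sigma> (\<sigma>(b := code (f x))) (7 * size_of x + 5)"
      using * assms[of x] by (simp add: code_bool_def)
    from runs_Ite[OF this] show "runs (Ite b S (Seq (clear b) (push b True)) (Seq (clear b) (push b False))) \<sigma>
      (\<sigma>(b := code (f x))) (7 * size_of x + 10)" by (rule runs_eq) auto
  qed
  moreover have "size_of (f x) \<le> 7 * size_of x + 10" for x by simp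
  ultimately show ?thesis by (intro PT_I[where t = "\<lambda>n. 7 * n + 10"] poly_bounded_intros)
qed

lemma PT_if:
  fixes c :: "'a::enc \<Rightarrow> bool" and f g :: "'a \<Rightarrow> 'b::enc"
  assumes "PT c" "PT f" "PT g"
  shows "PT (\<lambda>x. if c x then f x else g x)"
proof -
  obtain q0 C where c: "\<And>b. computes (C b) b c (poly q0)"
    using PT_E[OF assms(1)] by metis
  obtain q P where f: "\<And>x. size_of (f x) \<le> poly q (size_of x)" "\<And>b. computes (P b) b f (poly q)"
    using PT_E[OF assms(2)] by metis
  obtain q' P' where g: "\<And>x. size_of (g x) \<le> poly q' (size_of x)" "\<And>b. computes (P' b) b g (poly q')"
    using PT_E[OF assms(3)] by metis
  define t where "t n = 50 * n + poly q0 n + poly q n + poly q' n + 50" for n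
  define R where "R b = Seq (mv b (b+2)) (Seq (copy (b+2) b (b+1)) (Seq (C (b+1))
    (Ite (b+1) {2} (Seq (pop (b+1)) (P b)) (Seq (pop (b+1)) (P' b)))))" for b
  have "computes (R b) b (\<lambda>x. if c x then f x else g x) t" for b
  proof (rule computesI)
    fix \<sigma> and x :: 'a assume *: "\<sigma> b = code x" "\<forall>i>b. \<sigma> i = []"
    let ?n = "size_of x" and ?h = "if c x then f x else g x"
    have 1: "runs (mv b (b+2)) \<sigma> (\<sigma>(b := [], b+2 := rev (code x))) (15 * ?n + 1)"
      by (rule runs_eq[OF runs_mv]) (use * in auto)
    have 2: "runs (copy (b+2) b (b+1)) (\<sigma>(b := [], b+2 := rev (code x))) (\<sigma>(b+1 := code x)) (23 * ?n + 1)"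
      by (rule runs_eq[OF runs_copy]) (use * in auto)
    have 3: "runs (C (b+1)) (\<sigma>(b+1 := code x)) (\<sigma>(b+1 := [c x])) (poly q0 ?n)"
      by (rule runs_eq[OF computesD[OF c, of _ _ x]]) (use * in \<open>auto simp: code_bool_def\<close>)
    have pop: "runs (pop (b+1)) (\<sigma>(b+1 := [c x])) \<sigma> 1"
      by (rule runs_eq[OF runs_pop]) (use * in auto)
    have P: "runs (P b) \<sigma> (\<sigma>(b := code (f x))) (poly q ?n)" and P': "runs (P' b) \<sigma> (\<sigma>(b := code (g x))) (poly q' ?n)"
      by (rule computesD[OF f(2) *], rule computesD[OF g(2) *])
    have "runs (if head_sym ((\<sigma>(b+1 := [c x])) (b+1)) \<in> {2} then Seq (pop (b+1)) (P b) else Seq (pop (b+1)) (P' b))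
      (\<sigma>(b+1 := [c x])) (\<sigma>(b := code ?h)) (poly q ?n + poly q' ?n + 2)"
    proof (cases "c x")
      case True
      then show ?thesis using runs_eq[OF runs_Seq[OF pop P]] by simp
    next
      case False
      then show ?thesis using runs_eq[OF runs_Seq[OF pop P']] by simp
    qed
    note all = runs_Seq[OF 1 runs_Seq[OF 2 runs_Seq[OF 3 runs_Ite[OF this]]]]
    show "runs (R b) \<sigma> (\<sigma>(b := code ?h)) (t ?n)"
      unfolding R_def by (rule runs_eq[OF all refl]) (simp add: t_def)
  qed
  moreover have "size_of (if c x then f x else g x) \<le> t (size_of x)" for x
    using f(1)[of x] g(1)[of x] by (simp add: t_def)
  moreover have "poly_bounded t" unfolding t_def by (intro poly_bounded_intros)
  ultimately show ?thesis by (intro PT_I)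
qed

text \<open>A copy of the code of the initial value is consumed bit by bit as the loop counter. The
  common bound \<open>B\<close> on all intermediate values makes every round equally cheap;
  composing the size bound of \<open>g\<close> with itself would not stay polynomial.\<close>

lemma PT_iterate:
  fixes g :: "'a::enc \<Rightarrow> 'a" and s :: "'e::enc \<Rightarrow> 'a"
  assumes "PT g" "PT s" "\<And>x i. size_of ((g ^^ i) (s x)) \<le> poly B (size_of x)"
  shows "PT (\<lambda>x. (g ^^ size_of (s x)) (s x))"
proof -
  obtain q P where g: "\<And>b. computes (P b) b g (poly q)"
    using PT_E[OF assms(1)] by metis
  obtain q' S where s: "\<And>b. computes (S b) b s (poly q')" "\<And>x. size_of (s x) \<le> poly q' (size_of x)"
    using PT_E[OF assms(2)] by metis
  define t where "t n = poly q' n + 38 * poly q' n + (poly q (poly B n) + 3) * poly q' n + 30 * poly B n + 20" for n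
  define W where "W b = While b {1, 2} (Seq (pop b) (P (b+1)))" for b
  define R where "R b = Seq (S b) (Seq (mv b (b+2)) (Seq (copy (b+2) b (b+1)) (Seq (W b) (Seq (mv (b+1) (b+2)) (mv (b+2) b)))))" for b
  have W: "runs (W b) (\<sigma>(b := w, b+1 := code ((g ^^ i) (s x)))) (\<sigma>(b := [], b+1 := code ((g ^^ (i + length w)) (s x))))
      ((poly q (poly B (size_of x)) + 3) * length w + 1)"
    if "\<forall>i>b. \<sigma> i = []" for b \<sigma> w i x
  proof (induction w arbitrary: i)
    case Nil
    then show ?case unfolding W_def by (intro runs_eq[OF runs_While_stop]) auto
  next
    case (Cons a w)
    let ?\<sigma> = "\<sigma>(b := a # w, b+1 := code ((g ^^ i) (s x)))"
    have 1: "runs (pop b) ?\<sigma> (\<sigma>(b := w, b+1 := code ((g ^^ i) (s x)))) 1"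
      by (rule runs_eq[OF runs_pop]) auto
    have 2: "runs (P (b+1)) (\<sigma>(b := w, b+1 := code ((g ^^ i) (s x)))) (\<sigma>(b := w, b+1 := code ((g ^^ Suc i) (s x))))
       (poly q (poly B (size_of x)))"
      by (rule runs_eq[OF computesD[OF g, of _ _ "(g ^^ i) (s x)"]])
        (use that assms(3) in \<open>auto intro!: poly_nat_mono\<close>)
    have "head_sym (?\<sigma> b) \<in> {1, 2}" by (cases a) auto
    from runs_While_step[OF this runs_Seq[OF 1 2] Cons.IH[of "Suc i", unfolded W_def]]
    show ?case unfolding W_def by (rule runs_eq) auto
  qed
  have "computes (R b) b (\<lambda>x. (g ^^ size_of (s x)) (s x)) t" for b
  proof (rule computesI)
    fix \<sigma> and x :: 'e assume *: "\<sigma> b = code x" "\<forall>i>b. \<sigma> i = []"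
    let ?n = "size_of (s x)" and ?h = "(g ^^ size_of (s x)) (s x)"
    have 0: "runs (S b) \<sigma> (\<sigma>(b := code (s x))) (poly q' (size_of x))"
      by (rule computesD[OF s(1) *])
    have 1: "runs (mv b (b+2)) (\<sigma>(b := code (s x))) (\<sigma>(b := [], b+2 := rev (code (s x)))) (15 * ?n + 1)"
      by (rule runs_eq[OF runs_mv]) (use * in auto)
    have 2: "runs (copy (b+2) b (b+1)) (\<sigma>(b := [], b+2 := rev (code (s x))))
        (\<sigma>(b := code (s x), b+1 := code ((g ^^ 0) (s x)))) (23 * ?n + 1)"
      by (rule runs_eq[OF runs_copy]) (use * in auto)
    have 3: "runs (W b) (\<sigma>(b := code (s x), b+1 := code ((g ^^ 0) (s x)))) (\<sigma>(b := [], b+1 := code ?h))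
        ((poly q (poly B (size_of x)) + 3) * ?n + 1)"
      using W[OF *(2), of "code (s x)" 0 x] by simp
    have 4: "runs (mv (b+1) (b+2)) (\<sigma>(b := [], b+1 := code ?h)) (\<sigma>(b := [], b+2 := rev (code ?h))) (15 * size_of ?h + 1)"
      by (rule runs_eq[OF runs_mv]) (use * in auto)
    have 5: "runs (mv (b+2) b) (\<sigma>(b := [], b+2 := rev (code ?h))) (\<sigma>(b := code ?h)) (15 * size_of ?h + 1)"
      by (rule runs_eq[OF runs_mv]) (use * in auto)
    note all = runs_Seq[OF 0 runs_Seq[OF 1 runs_Seq[OF 2 runs_Seq[OF 3 runs_Seq[OF 4 5]]]]]
    have le: "(poly q (poly B (size_of x)) + 3) * ?n \<le> (poly q (poly B (size_of x)) + 3) * poly q' (size_of x)"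
      using s(2) by (rule mult_le_mono2)
    show "runs (R b) \<sigma> (\<sigma>(b := code ?h)) (t (size_of x))"
      unfolding R_def 
      by (rule runs_eq[OF all refl]) (use assms(3)[of ?n x] s(2)[of x] le in \<open>unfold t_def, linarith\<close>)
  qed
  moreover have "size_of ((g ^^ size_of (s x)) (s x)) \<le> t (size_of x)" for x
    using assms(3)[of "size_of (s x)" x] by (simp add: t_def)
  moreover have "poly_bounded t" unfolding t_def by (intro poly_bounded_intros)
  ultimately show ?thesis by (intro PT_I)
qed

lemma code_bools: "code (w :: bool list) = concat (map (\<lambda>c. [True, c, False]) w)"
  by (induction w) (auto simp: code_list_def code_bool_def enc_bits_def)

text \<open>Makes codes available as data: equality tests and counting loops work on
  \<open>code x\<close> as a list of bits.\<close>

lemma PT_code_self: "PT (code :: 'a::enc \<Rightarrow> bool list)"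
proof -
  have nil: "concat (map (\<lambda>b. []) w) = []" for w :: "bool list" by (induction w) auto
  define R where "R b = Seq (mv b (b+1)) (transduce (b+1) b (\<lambda>c. [True, c, False]) (b+2) (\<lambda>_. []))" for b
  have "computes (R b) b (code :: 'a \<Rightarrow> bool list) (\<lambda>n. 50 * n + 3)" for b
  proof (rule computesI)
    fix \<sigma> and x :: 'a assume *: "\<sigma> b = code x" "\<forall>i>b. \<sigma> i = []"
    have 1: "runs (mv b (b+1)) \<sigma> (\<sigma>(b := [], b+1 := rev (code x))) (15 * size_of x + 1)"
      by (rule runs_eq[OF runs_mv]) (use * in auto)
    have 2: "runs (transduce (b+1) b (\<lambda>c. [True, c, False]) (b+2) (\<lambda>_. [])) (\<sigma>(b := [], b+1 := rev (code x)))
      (\<sigma>(b := code (code x))) (35 * size_of x + 1)"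
      by (rule runs_eq[OF runs_transduce]) (use * in \<open>auto simp: code_bools nil\<close>)
    show "runs (R b) \<sigma> (\<sigma>(b := code (code x))) (50 * size_of x + 3)"
      unfolding R_def by (rule runs_eq[OF runs_Seq[OF 1 2]]) auto
  qed
  moreover have "length (code w) = 3 * length w" for w :: "bool list"
    by (induction w) (auto simp: code_bools)
  then have "size_of (code x) \<le> 50 * size_of x + 3" for x :: 'a by simp
  ultimately show ?thesis by (intro PT_I[where t = "\<lambda>n. 50 * n + 3"] poly_bounded_intros)
qed

subsection \<open>Polynomial-time functions are computed by Turing machines\<close>

text \<open>A stack may start at any cell and holds three bits per output bit, whereas the output
  has to begin at cell 0 of the last tape. The middle bit of each triple is therefore written from
  left to right on a fresh tape.\<close>

definition flush :: "nat \<Rightarrow> prog" where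
  "flush r = While 0 {1, 2} (Seq (pop 0) (Seq (Ite 0 {2} (Put r (Some True) MoveRight) (Put r (Some False) MoveRight))
     (Seq (pop 0) (pop 0))))"

lemma word_cells_snoc: "(word_cells v)(int (length v) := sym (Some a)) = word_cells (v @ [a])"
proof
  fix i
  show "((word_cells v)(int (length v) := sym (Some a))) i = word_cells (v @ [a]) i"
    by (cases a) (auto simp: word_cells_def nth_append)
qed

lemma truns_flush:
  assumes "stack (T 0) (code (w :: bool list))" "T r = (int (length v), word_cells v)" "r \<noteq> 0"
  shows "\<exists>T'. truns (flush r) T T' (9 * length w + 1) \<and> snd (T' r) = word_cells (v @ w)"
  using assms(1,2)
proof (induction w arbitrary: T v)
  case Nil
  then have "truns (flush r) T T 1"
    unfolding flush_def by (intro truns_While_stop) (simp add: stack_read)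
  with Nil show ?case by auto
next
  case (Cons a w)
  let ?pop = "\<lambda>T. T(0 := act (sym None, MoveRight) (T 0))"
  let ?put = "\<lambda>T. T(r := act (sym (Some a), MoveRight) (T r))"
  have c: "code (a # w) = True # a # False # code w" by (simp add: code_bools)
  have s1: "stack (?pop T 0) (a # False # code w)"
    using stack_pop[OF Cons.prems(1)] c by simp
  have s2: "stack (?put (?pop T) 0) (a # False # code w)" using s1 \<open>r \<noteq> 0\<close> by simp
  have s3: "stack (?pop (?put (?pop T)) 0) (False # code w)"
    using stack_pop[OF s2] by simp
  have s4: "stack (?pop (?pop (?put (?pop T))) 0) (code w)"
    using stack_pop[OF s3] by simp
  have "truns (Ite 0 {2} (Put r (Some True) MoveRight) (Put r (Some False) MoveRight)) (?pop T) (?put (?pop T)) 2"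
    using truns_Ite[of "?pop T" 0 "{2}" "Put r (Some True) MoveRight" "Put r (Some False) MoveRight" "?put (?pop T)" 1]
      stack_read[OF s1] truns_Put[of r "Some a" MoveRight "?pop T"] by (cases a) (auto simp: numeral_2_eq_2)
  from truns_Seq[OF truns_Put truns_Seq[OF this truns_Seq[OF truns_Put truns_Put]]]
  have body: "truns (Seq (pop 0) (Seq (Ite 0 {2} (Put r (Some True) MoveRight) (Put r (Some False) MoveRight))
     (Seq (pop 0) (pop 0)))) T (?pop (?pop (?put (?pop T)))) 8"
    by (rule truns_mono) simp
  have "?pop (?pop (?put (?pop T))) r = (int (length (v @ [a])), word_cells (v @ [a]))"
    using Cons.prems(2) \<open>r \<noteq> 0\<close> by (simp add: word_cells_snoc)
  from Cons.IH[OF s4 this] obtain T' where T': "truns (flush r) (?pop (?pop (?put (?pop T)))) T' (9 * length w + 1)"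
    "snd (T' r) = word_cells ((v @ [a]) @ w)" by blast
  have "read (T 0) \<in> {1, 2}" using stack_read[OF Cons.prems(1)] c by simp
  from truns_While_step[OF this body T'(1)[unfolded flush_def]]
  have "truns (flush r) T T' (9 * length (a # w) + 1)"
    unfolding flush_def by (rule truns_mono) simp
  with T'(2) show ?case by auto
qed

theorem PT_raw_imp_ptime_computable:
  assumes "PT (f :: raw \<Rightarrow> bool list)"
  shows "ptime_computable (\<lambda>x. f (Raw x))"
proof -
  obtain q P where f: "\<And>x. size_of (f x) \<le> poly q (size_of x)" "\<And>b. computes (P b) b f (poly q)"
    using PT_E[OF assms] by metis
  let ?p = "P 0"
  \<comment> \<open>The output tape lies above all registers of the program: it is the last tape of
    the machine, and still blank with its head on cell 0 when \<open>flush\<close> starts.\<close>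
  define r where "r = Suc (Max (insert 0 (regs ?p)))"
  have less_r: "i < r" if "i \<in> insert 0 (regs ?p)" for i
    unfolding r_def using Max_ge[OF _ that] finite_regs[of ?p] by (simp add: less_Suc_eq_le)
  then have r: "r \<notin> regs ?p" "r \<noteq> 0" by (blast, simp add: r_def)
  have "regs (Seq ?p (flush r)) \<subseteq> {..<Suc r}"
    using less_r by (auto simp: flush_def less_Suc_eq)
  from compile_prog[OF this] obtain M where M: "wf_tm M"
    "\<And>w n T. (pstep ^^ n) ([Seq ?p (flush r)], blank_tapes w) = ([], T) \<Longrightarrow>
      (step M ^^ n) (init M w) = (halt M, map T [0..<Suc r])" by auto
  define t where "t n = 10 * poly q n + 10" for n
  have "poly_bounded t" unfolding t_def by (intro poly_bounded_intros)
  then obtain q' where q': "\<And>n. t n \<le> poly q' n" unfolding poly_bounded_def by blast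
  have "outputs_within M x (f (Raw x)) (poly q' (length x))" for x
  proof -
    let ?\<sigma> = "(\<lambda>_. []) (0 := x)"
    have len: "length (code w) = 3 * length w" for w :: "bool list"
      by (induction w) (auto simp: code_bools)
    have 1: "runs (P 0) ?\<sigma> (?\<sigma>(0 := code (f (Raw x)))) (poly q (size_of (Raw x)))"
      by (rule computesD[OF f(2)]) auto
    have "stack (blank_tapes x i) (?\<sigma> i)" for i
      by (auto simp: blank_tapes_def stack_def)
    then obtain T1 where T1: "\<And>i. stack (T1 i) ((?\<sigma>(0 := code (f (Raw x)))) i)"
      "truns ?p (blank_tapes x) T1 (poly q (length x))"
      using 1 unfolding runs_def code_Raw by blast
    have "stack (T1 0) (code (f (Raw x)))" using T1(1)[of 0] by simp
    moreover have "T1 r = (int (length ([]::bool list)), word_cells [])"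
      using truns_untouched[OF T1(2) r(1)] r(2) by (simp add: blank_tapes_def)
    ultimately obtain T2 where T2: "truns (flush r) T1 T2 (9 * length (f (Raw x)) + 1)"
      "snd (T2 r) = word_cells ([] @ f (Raw x))" using truns_flush r(2) by blast
    have "Suc (poly q (length x) + (9 * length (f (Raw x)) + 1)) \<le> t (length x)"
      using f(1)[of "Raw x"] by (simp add: t_def len)
    with truns_mono[OF truns_Seq[OF T1(2) T2(1)]] q'[of "length x"]
    have "truns (Seq ?p (flush r)) (blank_tapes x) T2 (poly q' (length x))" by (meson le_trans)
    then obtain m where m: "m \<le> poly q' (length x)"
      "(pstep ^^ m) ([Seq ?p (flush r)], blank_tapes x) = ([], T2)" unfolding truns_def by blast
    have fix_halt: "(step M ^^ n) (halt M, ts) = (halt M, ts)" for n ts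
      by (induction n) (auto simp: step_def)
    have "(step M ^^ poly q' (length x)) (init M x) = (step M ^^ (poly q' (length x) - m)) ((step M ^^ m) (init M x))"
      using m(1) by (metis comp_apply funpow_add le_add_diff_inverse2)
    also have "\<dots> = (halt M, map T2 [0..<Suc r])" by (simp only: M(2)[OF m(2)] fix_halt)
    finally show ?thesis using T2(2) by (simp add: outputs_within_def)
  qed
  with M(1) show ?thesis unfolding ptime_computable_def by blast
qed

theorem PT_imp_ptime_computable:
  assumes "PT (f :: bool list \<Rightarrow> bool list)"
  shows "ptime_computable f"
  using PT_raw_imp_ptime_computable[OF PT_comp[OF assms PT_code_self]] by simp


subsection \<open>A library of polynomial-time functions\<close>

lemma PT_fst: "PT f \<Longrightarrow> PT (\<lambda>x. fst (f x))"
  by (rule PT_comp[OF PT_unpair_fst]) (auto simp: code_prod_def)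

lemma PT_snd: "PT f \<Longrightarrow> PT (\<lambda>x. snd (f x))"
  by (rule PT_comp[OF PT_unpair_snd]) (auto simp: code_prod_def)

lemma PT_Cons: "PT f \<Longrightarrow> PT g \<Longrightarrow> PT (\<lambda>x. f x # g x)"
  by (rule PT_code_eq[OF PT_pair]) (auto simp: code_Cons code_Pair)

lemma PT_append: "PT f \<Longrightarrow> PT g \<Longrightarrow> PT (\<lambda>x. f x @ g x)"
  by (rule PT_comp[OF PT_unpair_join[of "\<lambda>p. fst p @ snd p"] PT_pair, simplified])
    (auto simp: code_append code_prod_def)

lemma PT_tl:
  fixes f :: "'a::enc \<Rightarrow> 'b::enc list"
  shows "PT f \<Longrightarrow> PT (\<lambda>x. tl (f x))"
proof (rule PT_comp[OF PT_unpair_snd[of tl]])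
  show "code (tl xs) = snd (unpair (code xs))" for xs :: "'b list"
    by (cases xs) (auto simp: code_Cons)
qed

lemma PT_null:
  fixes f :: "'a::enc \<Rightarrow> 'b::enc list"
  shows "PT f \<Longrightarrow> PT (\<lambda>x. f x = [])"
proof (rule PT_comp[OF PT_test[of "\<lambda>xs. xs = []" "{0}"]])
  have "head_sym w = 0 \<longleftrightarrow> w = []" for w by (cases w; cases "hd w") auto
  then show "xs = [] \<longleftrightarrow> head_sym (code xs) \<in> {0}" for xs :: "'b list" by simp
qed

text \<open>\<open>hd []\<close> is some fixed value, so the empty list is answered by the constant
  code of that value. The type \<open>raw\<close> lets both branches be stated on the level of
  codes.\<close>

lemma PT_hd:
  fixes f :: "'a::enc \<Rightarrow> 'b::enc list"
  assumes "PT f" shows "PT (\<lambda>x. hd (f x))"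
proof (rule PT_comp[OF _ assms])
  have "PT (\<lambda>xs :: 'b list. if xs = [] then Raw (code (hd ([] :: 'b list))) else Raw (fst (unpair (code xs))))"
    by (intro PT_if PT_null PT_const PT_id PT_unpair_fst) simp
  then show "PT (hd :: 'b list \<Rightarrow> 'b)"
  proof (rule PT_code_eq)
    show "code (hd xs) = code (if xs = [] then Raw (code (hd ([] :: 'b list))) else Raw (fst (unpair (code xs))))"
      for xs :: "'b list"
      by (cases xs) (auto simp: code_Cons)
  qed
qed

lemma PT_code: "PT f \<Longrightarrow> PT (\<lambda>x. code (f x))"
  by (rule PT_comp[OF PT_code_self])

lemma PT_not: "PT f \<Longrightarrow> PT (\<lambda>x. \<not> f x)"
  by (rule PT_code_eq[OF PT_if[where c = f, OF _ PT_const[of False] PT_const[of True]]]) auto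

lemma PT_conj: "PT f \<Longrightarrow> PT g \<Longrightarrow> PT (\<lambda>x. f x \<and> g x)"
  by (rule PT_code_eq[OF PT_if[where c = f and f = g, OF _ _ PT_const[of False]]]) auto

lemma PT_disj: "PT f \<Longrightarrow> PT g \<Longrightarrow> PT (\<lambda>x. f x \<or> g x)"
  by (rule PT_code_eq[OF PT_if[where c = f and g = g, OF _ PT_const[of True]]]) auto

lemma PT_imp: "PT f \<Longrightarrow> PT g \<Longrightarrow> PT (\<lambda>x. f x \<longrightarrow> g x)"
  by (rule PT_code_eq[OF PT_if[where c = f and f = g, OF _ _ PT_const[of True]]]) auto

lemma PT_Suc: "PT f \<Longrightarrow> PT (\<lambda>x. Suc (f x))"
  by (rule PT_comp[OF PT_push[of Suc True]]) (auto simp: code_nat_def)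

lemma PT_add: "PT f \<Longrightarrow> PT g \<Longrightarrow> PT (\<lambda>x. f x + g x :: nat)"
  by (rule PT_comp[OF PT_unpair_join[of "\<lambda>p. fst p + snd p"] PT_pair, simplified])
    (auto simp: code_nat_def code_prod_def replicate_add)

lemma PT_pred: "PT f \<Longrightarrow> PT (\<lambda>x. f x - 1 :: nat)"
  by (rule PT_comp[OF PT_pop[of "\<lambda>n. n - 1"]]) (auto simp: code_nat_def)

lemma PT_zero: "PT f \<Longrightarrow> PT (\<lambda>x. f x = (0 :: nat))"
proof (rule PT_comp[OF PT_test[of "\<lambda>n. n = 0" "{0}"]])
  show "n = 0 \<longleftrightarrow> head_sym (code n) \<in> {0}" for n :: nat
    by (cases n) (auto simp: code_nat_def)
qed

lemma PT_Pos: "PT f \<Longrightarrow> PT (\<lambda>x. Pos (f x))"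
  by (rule PT_comp[OF PT_push[of Pos True]]) auto

lemma PT_Neg: "PT f \<Longrightarrow> PT (\<lambda>x. Neg (f x))"
  by (rule PT_comp[OF PT_push[of Neg False]]) auto

lemma PT_var:
  fixes f :: "'a::enc \<Rightarrow> 'b::enc literal"
  shows "PT f \<Longrightarrow> PT (\<lambda>x. var (f x))"
proof (rule PT_comp[OF PT_pop[of var]])
  show "code (var l) = tl (code l)" for l :: "'b literal" by (cases l) auto
qed

definition is_Pos :: "'v literal \<Rightarrow> bool" where
  "is_Pos l \<longleftrightarrow> l = Pos (var l)"

lemma is_Pos_simps [simp]: "is_Pos (Pos v)" "\<not> is_Pos (Neg v)"
  by (auto simp: is_Pos_def)

lemma PT_is_Pos:
  fixes f :: "'a::enc \<Rightarrow> 'b::enc literal"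
  shows "PT f \<Longrightarrow> PT (\<lambda>x. is_Pos (f x))"
proof (rule PT_comp[OF PT_test[of is_Pos "{2}"]])
  show "is_Pos l \<longleftrightarrow> head_sym (code l) \<in> {2}" for l :: "'b literal" by (cases l) auto
qed

text \<open>The iterated state consists of the parameter, the accumulator and the rest of the list.
  It is a fixed point once the list is used up, so that iterating as often as the size of the state
  suffices.\<close>

lemma PT_foldl:
  fixes step :: "'e::enc \<Rightarrow> 'b::enc \<Rightarrow> 'a::enc \<Rightarrow> 'b" and init :: "'e \<Rightarrow> 'b" and xs :: "'e \<Rightarrow> 'a list"
  assumes step: "PT (\<lambda>p. step (fst p) (fst (snd p)) (snd (snd p)))"
    and init: "PT init" and xs: "PT xs"
    and bound: "\<And>x i. size_of (foldl (step x) (init x) (take i (xs x))) \<le> poly B (size_of x)"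
  shows "PT (\<lambda>x. foldl (step x) (init x) (xs x))"
proof -
  define g where "g = (\<lambda>p :: 'e \<times> 'b \<times> 'a list. if snd (snd p) = [] then p
    else (fst p, step (fst p) (fst (snd p)) (hd (snd (snd p))), tl (snd (snd p))))"
  define s where "s x = (x, init x, xs x)" for x
  have "PT (\<lambda>p :: 'e \<times> 'b \<times> 'a list. step (fst p) (fst (snd p)) (hd (snd (snd p))))"
    using PT_comp[OF step, of "\<lambda>p. (fst p, fst (snd p), hd (snd (snd p)))"]
    by (simp add: PT_pair PT_fst PT_snd PT_id PT_hd)
  then have "PT g" unfolding g_def
    by (intro PT_if PT_null PT_pair PT_fst PT_snd PT_id PT_tl)
  have "PT s" unfolding s_def by (intro PT_pair PT_id init xs)
  have iter: "(g ^^ i) (s x) = (x, foldl (step x) (init x) (take i (xs x)), drop i (xs x))" for i x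
  proof (induction i)
    case (Suc i)
    show ?case
    proof (cases "i < length (xs x)")
      case True
      then show ?thesis using Suc
        by (simp add: g_def take_Suc_conv_app_nth hd_drop_conv_nth drop_Suc tl_drop)
    next
      case False
      then show ?thesis using Suc by (simp add: g_def)
    qed
  qed (simp add: s_def)
  obtain q where q: "\<And>x. size_of (xs x) \<le> poly q (size_of x)" using PT_size[OF xs] by blast
  \<comment> \<open>In a pair the first component counts twice and one marker bit is added; the
    state is a nested pair, which gives two markers.\<close>
  let ?B = "[:2, 2:] + 2 * B + q"
  have "size_of ((g ^^ i) (s x)) \<le> poly ?B (size_of x)" for i x
    using bound[of x i] q[of x] size_drop[of i "xs x"] by (simp add: iter)
  from PT_fst[OF PT_snd[OF PT_iterate[OF \<open>PT g\<close> \<open>PT s\<close> this]]]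
  have "PT (\<lambda>x. foldl (step x) (init x) (take (size_of (s x)) (xs x)))" by (simp add: iter)
  moreover have "length (xs x) \<le> size_of (s x)" for x
    using length_le_size[of "xs x"] by (simp add: s_def)
  ultimately show ?thesis by simp
qed

text \<open>If the growth per step does not depend on the accumulator, the growths add up to at most
  the length of the list times a common bound. A step that doubled the accumulator would lead to
  exponential size.\<close>

lemma PT_foldl_additive:
  fixes step :: "'e::enc \<Rightarrow> 'b::enc \<Rightarrow> 'a::enc \<Rightarrow> 'b" and init :: "'e \<Rightarrow> 'b" and xs :: "'e \<Rightarrow> 'a list"
  assumes step: "PT (\<lambda>p. step (fst p) (fst (snd p)) (snd (snd p)))"
    and init: "PT init" and xs: "PT xs"
    and bound: "\<And>e b a. size_of (step e b a) \<le> size_of b + poly B (size_of e + size_of a)"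
  shows "PT (\<lambda>x. foldl (step x) (init x) (xs x))"
proof -
  obtain p q where p: "\<And>x. size_of (init x) \<le> poly p (size_of x)"
    and q: "\<And>x. size_of (xs x) \<le> poly q (size_of x)" using PT_size[OF init] PT_size[OF xs] by metis
  let ?B = "p + q * pcompose B ([:0, 1:] + q)"
  have *: "size_of (foldl (step e) b ys) \<le> size_of b + length ys * poly B (size_of e + m)"
    if "\<And>a. a \<in> set ys \<Longrightarrow> size_of a \<le> m" for e b ys m
    using that
  proof (induction ys arbitrary: b)
    case (Cons a ys)
    have "poly B (size_of e + size_of a) \<le> poly B (size_of e + m)"
      using Cons.prems by (intro poly_nat_mono) simp
    then show ?case using Cons.IH[of "step e b a"] Cons.prems bound[of e b a] by fastforce
  qed simp
  show ?thesis
  proof (rule PT_foldl[OF step init xs])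
    fix x i
    have "size_of a \<le> poly q (size_of x)" if "a \<in> set (take i (xs x))" for a
      using size_elem[of a "xs x"] that q[of x] in_set_takeD[OF that] by linarith
    from *[OF this] have "size_of (foldl (step x) (init x) (take i (xs x)))
      \<le> size_of (init x) + length (take i (xs x)) * poly B (size_of x + poly q (size_of x))" .
    also have "\<dots> \<le> poly p (size_of x) + poly q (size_of x) * poly B (size_of x + poly q (size_of x))"
      using p[of x] q[of x] length_le_size[of "xs x"] by (intro add_mono mult_right_mono) auto
    finally show "size_of (foldl (step x) (init x) (take i (xs x))) \<le> poly ?B (size_of x)"
      by (simp add: poly_pcompose)
  qed
qed

lemma PT_size2:
  fixes g :: "'a::enc \<Rightarrow> 'b::enc \<Rightarrow> 'c::enc"
  assumes "PT (\<lambda>p. g (fst p) (snd p))"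
  obtains q where "\<And>e a. size_of (g e a) \<le> poly q (size_of e + size_of a)"
proof -
  obtain q where q: "\<And>p. size_of (g (fst p) (snd p)) \<le> poly q (size_of p)" using PT_size[OF assms] by blast
  have "size_of (g e a) \<le> poly (pcompose q [:1, 2:]) (size_of e + size_of a)" for e a
  proof -
    have "poly q (size_of (e, a)) \<le> poly q (1 + 2 * (size_of e + size_of a))"
      by (intro poly_nat_mono) simp
    also have "\<dots> = poly (pcompose q [:1, 2:]) (size_of e + size_of a)"
      by (simp add: poly_pcompose mult.commute)
    finally show ?thesis using q[of "(e, a)"] by simp
  qed
  then show ?thesis using that by blast
qed

lemma PT_arg2:
  fixes g :: "'a::enc \<Rightarrow> 'b::enc \<Rightarrow> 'c::enc" and f :: "'d::enc \<Rightarrow> 'a" and h :: "'d \<Rightarrow> 'b"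
  assumes "PT (\<lambda>p. g (fst p) (snd p))" "PT f" "PT h"
  shows "PT (\<lambda>x. g (f x) (h x))"
  using PT_comp[OF assms(1) PT_pair[OF assms(2,3)]] by simp

section \<open>List functions obtained from folds\<close>

lemma PT_concat_map:
  fixes g :: "'a::enc \<Rightarrow> 'b::enc \<Rightarrow> 'c::enc list" and xs :: "'a \<Rightarrow> 'b list"
  assumes g: "PT (\<lambda>p. g (fst p) (snd p))" and xs: "PT xs"
  shows "PT (\<lambda>x. concat (map (g x) (xs x)))"
proof -
  have *: "foldl (\<lambda>b a. b @ h a) b ys = b @ concat (map h ys)" for h :: "'b \<Rightarrow> 'c list" and b ys
    by (induction ys arbitrary: b) auto
  obtain q where q: "\<And>e a. size_of (g e a) \<le> poly q (size_of e + size_of a)" using PT_size2[OF g] by blast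
  have "PT (\<lambda>p :: 'a \<times> 'c list \<times> 'b. g (fst p) (snd (snd p)))"
    by (rule PT_arg2[OF g]) (intro PT_fst PT_snd PT_id)+
  then have "PT (\<lambda>x. foldl (\<lambda>b a. b @ g x a) [] (xs x))"
    by (intro PT_foldl_additive[where B = q and step = "\<lambda>x b a. b @ g x a"] PT_append PT_fst PT_snd PT_id PT_const xs)
      (use q in auto)
  then show ?thesis by (simp add: *)
qed

lemma PT_map:
  fixes g :: "'a::enc \<Rightarrow> 'b::enc \<Rightarrow> 'c::enc" and xs :: "'a \<Rightarrow> 'b list"
  assumes g: "PT (\<lambda>p. g (fst p) (snd p))" and xs: "PT xs"
  shows "PT (\<lambda>x. map (g x) (xs x))"
proof -
  have "map h ys = concat (map (\<lambda>a. [h a]) ys)" for h :: "'b \<Rightarrow> 'c" and ys by (induction ys) auto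
  then show ?thesis using PT_concat_map[of "\<lambda>x a. [g x a]", OF PT_Cons[OF g PT_const] xs] by simp
qed

lemma PT_concat:
  fixes f :: "'a::enc \<Rightarrow> 'b::enc list list"
  shows "PT f \<Longrightarrow> PT (\<lambda>x. concat (f x))"
  using PT_concat_map[of "\<lambda>x a. a" f] by (simp add: PT_snd PT_id)

lemma PT_filter:
  fixes P :: "'a::enc \<Rightarrow> 'b::enc \<Rightarrow> bool" and xs :: "'a \<Rightarrow> 'b list"
  assumes g: "PT (\<lambda>p. P (fst p) (snd p))" and xs: "PT xs"
  shows "PT (\<lambda>x. filter (P x) (xs x))"
proof -
  have *: "filter h ys = concat (map (\<lambda>a. if h a then [a] else []) ys)" for h :: "'b \<Rightarrow> bool" and ys
    by (induction ys) auto
  show ?thesis unfolding *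
    by (rule PT_concat_map[of "\<lambda>x a. if P x a then [a] else []"])
      (intro PT_if g PT_Cons PT_snd PT_id PT_const xs)+
qed

lemma PT_ball:
  fixes P :: "'a::enc \<Rightarrow> 'b::enc \<Rightarrow> bool" and xs :: "'a \<Rightarrow> 'b list"
  assumes "PT (\<lambda>p. P (fst p) (snd p))" and "PT xs"
  shows "PT (\<lambda>x. \<forall>a\<in>set (xs x). P x a)"
  using PT_null[OF PT_filter[of "\<lambda>x a. \<not> P x a", OF PT_not[OF assms(1)] assms(2)]]
  by (simp add: filter_empty_conv)

lemma PT_bex:
  fixes P :: "'a::enc \<Rightarrow> 'b::enc \<Rightarrow> bool" and xs :: "'a \<Rightarrow> 'b list"
  assumes "PT (\<lambda>p. P (fst p) (snd p))" and "PT xs"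
  shows "PT (\<lambda>x. \<exists>a\<in>set (xs x). P x a)"
  using PT_not[OF PT_ball[of "\<lambda>x a. \<not> P x a", OF PT_not[OF assms(1)] assms(2)]] by simp

lemma PT_eq_bools:
  fixes f g :: "'a::enc \<Rightarrow> bool list"
  assumes "PT f" "PT g"
  shows "PT (\<lambda>x. f x = g x)"
proof -
  define st where "st = (\<lambda>(s :: bool \<times> bool list) a. if snd s \<noteq> [] \<and> hd (snd s) = a then (fst s, tl (snd s)) else (False, snd s))"
  have st: "fst (foldl st (c, ys) xs) \<and> snd (foldl st (c, ys) xs) = [] \<longleftrightarrow> c \<and> xs = ys" for c ys xs
  proof (induction xs arbitrary: c ys)
    case (Cons a xs)
    have "foldl st (c, ys) (a # xs) = foldl st (st (c, ys) a) xs" by simp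
    then show ?case using Cons.IH[of "fst (st (c, ys) a)" "snd (st (c, ys) a)"]
      by (cases ys) (auto simp: st_def)
  qed auto
  \<comment> \<open>Equality of bits is rewritten as a case distinction, since the rule for equality
    is itself derived from this lemma.\<close>
  have eqv: "(\<lambda>x. h x = (k x :: bool)) = (\<lambda>x. if h x then k x else \<not> k x)" for h k :: "'x \<Rightarrow> bool" by auto
  have "PT (\<lambda>p :: 'a \<times> (bool \<times> bool list) \<times> bool. st (fst (snd p)) (snd (snd p)))"
    unfolding st_def eqv
    by (intro PT_if PT_conj PT_not PT_null PT_hd PT_pair PT_fst PT_snd PT_tl PT_id PT_const)
  then have "PT (\<lambda>x. foldl st (True, g x) (f x))"
    by (intro PT_foldl_additive[where B = 0 and step = "\<lambda>x. st"] PT_pair PT_const assms)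
      (auto simp: st_def size_tl split: prod.splits)
  from PT_conj[OF PT_fst[OF this] PT_null[OF PT_snd[OF this]]]
  show ?thesis by (simp add: st)
qed

lemma PT_eq: "PT f \<Longrightarrow> PT g \<Longrightarrow> PT (\<lambda>x. f x = g x)"
  using PT_eq_bools[OF PT_code PT_code, of f g] by (simp add: code_inject)

lemma PT_mem: "PT f \<Longrightarrow> PT g \<Longrightarrow> PT (\<lambda>x. f x \<in> set (g x))"
  using PT_bex[of "\<lambda>x a. f x = a" g] PT_eq[OF PT_comp[of f fst] PT_snd[OF PT_id]]
  by (auto simp: PT_fst PT_id)

lemma PT_length:
  fixes f :: "'a::enc \<Rightarrow> 'b::enc list"
  shows "PT f \<Longrightarrow> PT (\<lambda>x. length (f x))"
proof -
  assume f: "PT f"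
  have "foldl (\<lambda>n a. Suc n) m ys = m + length ys" for m and ys :: "'b list"
    by (induction ys arbitrary: m) auto
  moreover have "PT (\<lambda>x. foldl (\<lambda>n a. Suc n) 0 (f x))"
    by (rule PT_foldl_additive[where B = 1 and step = "\<lambda>x n a. Suc n"])
      (auto intro!: PT_Suc PT_fst PT_snd PT_id PT_const f)
  ultimately show ?thesis by simp
qed

text \<open>The unary code of \<open>g x\<close> is a list of \<open>g x\<close> bits that drives a
  fold. Products, ranges, \<open>drop\<close> and \<open>replicate\<close> use their numeric
  argument in the same way.\<close>

lemma PT_minus:
  assumes "PT f" "PT g"
  shows "PT (\<lambda>x. f x - g x :: nat)"
proof -
  have "foldl (\<lambda>n a. n - 1) m ys = m - length ys" for m and ys :: "bool list"
    by (induction ys arbitrary: m) auto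
  moreover have "PT (\<lambda>x. foldl (\<lambda>n a. n - 1) (f x) (code (g x)))"
    by (rule PT_foldl_additive[where B = 0 and step = "\<lambda>x n a. n - 1"])
      (auto simp flip: One_nat_def intro!: PT_pred PT_fst PT_snd PT_id PT_code assms)
  ultimately show ?thesis by simp
qed

lemma PT_le:
  assumes "PT f" "PT g"
  shows "PT (\<lambda>x. f x \<le> (g x :: nat))"
  using PT_zero[OF PT_minus[OF assms]] by simp

lemma PT_mult:
  fixes f g :: "'a::enc \<Rightarrow> nat"
  assumes "PT f" "PT g"
  shows "PT (\<lambda>x. f x * g x :: nat)"
proof -
  have "foldl (\<lambda>n a. n + k) m ys = m + k * length ys" for k m :: nat and ys :: "bool list"
    by (induction ys arbitrary: m) auto
  moreover obtain q where q: "\<And>x. f x \<le> poly q (size_of x)" using PT_size[OF assms(1)] by (metis size_nat)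
  then have q': "f x \<le> poly q (size_of x + 1)" for x using poly_nat_mono[of "size_of x" "size_of x + 1" q] by (meson le_add1 le_trans)
  have "PT (\<lambda>x. foldl (\<lambda>n a. n + f x) 0 (code (g x)))"
    by (rule PT_foldl_additive[where B = q and step = "\<lambda>x n a. n + f x"])
      (use q' in \<open>auto intro!: PT_add PT_fst PT_snd PT_id PT_const PT_code assms PT_comp[OF assms(1)]\<close>)
  ultimately show ?thesis by simp
qed

lemma PT_poly: "PT f \<Longrightarrow> PT (\<lambda>x. poly p (f x) :: nat)"
proof (induction p)
  case (pCons a p)
  have "PT (\<lambda>x. a + f x * poly p (f x))" by (intro PT_add PT_mult PT_const pCons)
  then show ?case by simp
qed (simp add: PT_const)

text \<open>Here the growth does depend on the accumulator, whose length is the next element. The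
  accumulator is bounded directly: the code of \<open>[0..<n]\<close> has length
  \<open>n * n\<close>, a sum of odd numbers.\<close>

lemma PT_upt: "PT f \<Longrightarrow> PT (\<lambda>x. [0..<f x])"
proof -
  assume f: "PT f"
  have *: "foldl (\<lambda>xs a. xs @ [length xs]) [] ys = [0..<length ys]" for ys :: "bool list"
    by (induction ys rule: rev_induct) auto
  obtain q where q: "\<And>x. f x \<le> poly q (size_of x)" using PT_size[OF f] by (metis size_nat)
  have size: "size_of [0..<n] = n * n" for n by (induction n) auto
  have "PT (\<lambda>x. foldl (\<lambda>xs a. xs @ [length xs]) [] (code (f x)))"
  proof (rule PT_foldl[where B = "q * q" and step = "\<lambda>x xs a. xs @ [length xs]"])
    fix x i
    have "min (f x) i * min (f x) i \<le> poly q (size_of x) * poly q (size_of x)"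
      using q[of x] by (intro mult_le_mono) auto
    then show "size_of (foldl (\<lambda>xs a. xs @ [length xs]) [] (take i (code (f x)))) \<le> poly (q * q) (size_of x)"
      by (simp only: * size length_take size_nat poly_mult)
  qed (intro PT_append PT_Cons PT_length PT_fst PT_snd PT_id PT_const PT_code f)+
  then show ?thesis by (simp add: *)
qed

lemma PT_drop:
  fixes f :: "'a::enc \<Rightarrow> nat" and g :: "'a \<Rightarrow> 'b::enc list"
  assumes "PT f" "PT g"
  shows "PT (\<lambda>x. drop (f x) (g x))"
proof -
  have "foldl (\<lambda>zs a. tl zs) xs ys = drop (length ys) xs" for xs :: "'b list" and ys :: "bool list"
    by (induction ys arbitrary: xs) (auto simp: drop_Suc)
  moreover have "PT (\<lambda>x. foldl (\<lambda>zs a. tl zs) (g x) (code (f x)))"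
    by (rule PT_foldl_additive[where B = 0 and step = "\<lambda>x zs a. tl zs"])
      (auto simp: size_tl intro!: PT_tl PT_fst PT_snd PT_id PT_code assms)
  ultimately show ?thesis by simp
qed

definition dedup :: "'a list \<Rightarrow> 'a list" where
  "dedup xs = foldl (\<lambda>ys a. if a \<in> set ys then ys else ys @ [a]) [] xs"

lemma dedup: "set (dedup xs) = set xs" "distinct (dedup xs)"
proof -
  have "set (dedup xs) = set xs \<and> distinct (dedup xs)"
    by (induction xs rule: rev_induct) (auto simp: dedup_def)
  then show "set (dedup xs) = set xs" "distinct (dedup xs)" by auto
qed

lemma PT_dedup: "PT f \<Longrightarrow> PT (\<lambda>x. dedup (f x))"
  unfolding dedup_def
  by (rule PT_foldl_additive[where B = "[:1, 2:]" and step = "\<lambda>x ys a. if a \<in> set ys then ys else ys @ [a]"])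
    (auto intro!: PT_if PT_mem PT_append PT_Cons PT_fst PT_snd PT_id PT_const)

lemma PT_replicate:
  assumes "PT f" "PT g"
  shows "PT (\<lambda>x. replicate (f x) (g x))"
proof -
  have "PT (\<lambda>x. map (\<lambda>_. g x) (code (f x)))"
    by (rule PT_map) (intro PT_code assms PT_comp[OF assms(2)] PT_fst PT_id)+
  then show ?thesis by (simp add: map_replicate_const)
qed

lemmas PT_intros = PT_id PT_const PT_fst PT_snd PT_pair PT_Cons PT_append PT_tl PT_null PT_hd PT_code
  PT_not PT_conj PT_disj PT_imp PT_Suc PT_add PT_zero PT_Pos PT_Neg PT_var PT_is_Pos PT_concat PT_map PT_filter
  PT_ball PT_bex PT_eq PT_mem PT_length PT_minus PT_le PT_mult PT_poly PT_upt PT_drop PT_dedup PT_replicate PT_if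


section \<open>From satisfiability to NAE-3SAT-KS\<close>

definition cnf_sat :: "'v clause list \<Rightarrow> bool" where
  "cnf_sat \<phi> \<longleftrightarrow> (\<exists>\<tau>. \<forall>c\<in>set \<phi>. \<exists>l\<in>set c. lit_true \<tau> l)"

lemma lit_true_complement: "lit_true (\<lambda>v. \<not> \<tau> v) l \<longleftrightarrow> \<not> lit_true \<tau> l"
  by (cases l) auto

subsection \<open>Not-all-equal triples\<close>

text \<open>A sum type emulated by types that already have codes: the number 0 with an empty list,
  the number 0 with a singleton, and a positive number tell apart \<open>falsum\<close>, original
  variables and chaining variables.\<close>

type_synonym 'v nvar = "nat \<times> nat \<times> 'v list"

definition falsum :: "'v nvar" where "falsum = (0, 0, [])"
definition orig :: "'v \<Rightarrow> 'v nvar" where "orig v = (0, 0, [v])"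
definition link :: "nat \<Rightarrow> nat \<Rightarrow> 'v nvar" where "link k i = (Suc k, i, [])"

definition lift :: "'v literal \<Rightarrow> 'v nvar literal" where
  "lift l = (if is_Pos l then Pos (orig (var l)) else Neg (orig (var l)))"

text \<open>With \<^const>\<open>falsum\<close> false, the variable \<open>link k i\<close> says that clause \<open>k\<close> still has to be
  satisfied by one of its literals from position \<open>i\<close> on.\<close>

definition triples :: "nat \<Rightarrow> 'v clause \<Rightarrow> 'v nvar clause list" where
  "triples k c = [Pos (link k 0), Pos falsum, Pos falsum] # [Neg (link k (length c)), Pos falsum, Pos falsum] #
     map (\<lambda>i. [Neg (link k i), lift (hd (drop i c)), Pos (link k (Suc i))]) [0..<length c]"

text \<open>\<open>hd (drop k \<phi>)\<close> stands for \<open>\<phi> ! k\<close>, as it is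
  composed of functions known to be polynomial-time; the same device recurs in all constructions
  below.\<close>

definition nae3 :: "'v clause list \<Rightarrow> 'v nvar clause list" where
  "nae3 \<phi> = concat (map (\<lambda>k. triples k (hd (drop k \<phi>))) [0..<length \<phi>])"

lemma lit_true_lift: "lit_true \<tau> (lift l) \<longleftrightarrow> lit_true (\<lambda>v. \<tau> (orig v)) l"
  by (cases l) (auto simp: lift_def)

lemma length_nae3: "c \<in> set (nae3 \<phi>) \<Longrightarrow> length c = 3"
  by (auto simp: nae3_def triples_def)

definition nae :: "('v \<Rightarrow> bool) \<Rightarrow> 'v clause \<Rightarrow> bool" where
  "nae \<tau> c \<longleftrightarrow> (\<exists>l\<in>set c. lit_true \<tau> l) \<and> (\<exists>l\<in>set c. \<not> lit_true \<tau> l)"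

lemma NAE_satisfiable_nae: "NAE_satisfiable C \<longleftrightarrow> (\<exists>\<tau>. \<forall>c\<in>set C. nae \<tau> c)"
  by (simp add: NAE_satisfiable_def nae_def)

lemma nae_complement: "nae (\<lambda>v. \<not> \<tau> v) c \<longleftrightarrow> nae \<tau> c"
  by (auto simp: nae_def lit_true_complement)

text \<open>Complementing preserves not-all-equal, so \<open>falsum\<close> may be assumed false;
  the chaining variables then propagate the obligation to satisfy the clause. Triples may repeat a
  literal at this stage, because different positions later receive different blocks.\<close>

lemma NAE_satisfiable_nae3: "NAE_satisfiable (nae3 \<phi>) \<longleftrightarrow> cnf_sat \<phi>"
proof
  assume "NAE_satisfiable (nae3 \<phi>)"
  then obtain \<tau>0 where \<tau>0: "\<forall>c\<in>set (nae3 \<phi>). nae \<tau>0 c" unfolding NAE_satisfiable_nae by blast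
  define \<tau> where "\<tau> = (if \<tau>0 falsum then (\<lambda>v. \<not> \<tau>0 v) else \<tau>0)"
  have \<tau>: "nae \<tau> c" if "c \<in> set (nae3 \<phi>)" for c
    using \<tau>0 that by (simp add: \<tau>_def nae_complement)
  have false: "\<not> \<tau> falsum" by (simp add: \<tau>_def)
  have "\<exists>l\<in>set c. lit_true (\<lambda>v. \<tau> (orig v)) l" if "c \<in> set \<phi>" for c
  proof -
    from that obtain k where k: "k < length \<phi>" "c = \<phi> ! k" by (auto simp: in_set_conv_nth)
    have "nae \<tau> t" if "t \<in> set (triples k c)" for t
    proof (rule \<tau>)
      show "t \<in> set (nae3 \<phi>)" using that k
        by (auto simp: nae3_def hd_drop_conv_nth intro!: bexI[of _ k])
    qed
    then have "nae \<tau> [Pos (link k 0), Pos falsum, Pos falsum]" "nae \<tau> [Neg (link k (length c)), Pos falsum, Pos falsum]"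
      and mid: "\<And>i. i < length c \<Longrightarrow> nae \<tau> [Neg (link k i), lift (c ! i), Pos (link k (Suc i))]"
      by (auto simp: triples_def hd_drop_conv_nth)
    then have ends: "\<tau> (link k 0)" "\<not> \<tau> (link k (length c))" using false by (auto simp: nae_def)
    show ?thesis
    proof (rule ccontr)
      assume none: "\<not> ?thesis"
      have "i \<le> length c \<Longrightarrow> \<tau> (link k i)" for i
      proof (induction i)
        case (Suc i)
        then have "\<tau> (link k i)" "\<not> lit_true \<tau> (lift (c ! i))" using none by (auto simp: lit_true_lift)
        then show ?case using mid[of i] Suc.prems by (auto simp: nae_def)
      qed (use ends in simp)
      then show False using ends by simp
    qed
  qed
  then show "cnf_sat \<phi>" unfolding cnf_sat_def by blast
next
  assume "cnf_sat \<phi>"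
  then obtain \<tau> where \<tau>: "\<forall>c\<in>set \<phi>. \<exists>l\<in>set c. lit_true \<tau> l" unfolding cnf_sat_def by blast
  \<comment> \<open>A chaining variable is true as long as no earlier literal of its clause is. This
    also supplies a true and a false literal in every chaining triple.\<close>
  define \<tau>' where "\<tau>' = (\<lambda>(k, i, vs). if k = 0 then vs \<noteq> [] \<and> \<tau> (hd vs)
    else \<forall>l\<in>set (take i (\<phi> ! (k - 1))). \<not> lit_true \<tau> l)"
  have false: "\<not> \<tau>' falsum" by (simp add: \<tau>'_def falsum_def)
  have orig: "lit_true \<tau>' (lift l) \<longleftrightarrow> lit_true \<tau> l" for l
    by (simp add: lit_true_lift) (simp add: \<tau>'_def orig_def)
  have link: "\<tau>' (link k i) \<longleftrightarrow> (\<forall>l\<in>set (take i (\<phi> ! k)). \<not> lit_true \<tau> l)" for k i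
    by (simp add: \<tau>'_def link_def)
  have "nae \<tau>' t" if t: "t \<in> set (triples k (\<phi> ! k))" and k: "k < length \<phi>" for t k
  proof -
    have "\<exists>l\<in>set (\<phi> ! k). lit_true \<tau> l" using \<tau> k by simp
    then have "\<tau>' (link k 0)" "\<not> \<tau>' (link k (length (\<phi> ! k)))" by (auto simp: link)
    moreover have "nae \<tau>' [Neg (link k i), lift (\<phi> ! k ! i), Pos (link k (Suc i))]" if "i < length (\<phi> ! k)" for i
      using that by (auto simp: nae_def orig link take_Suc_conv_app_nth)
    ultimately show ?thesis using t false by (auto simp: triples_def hd_drop_conv_nth nae_def)
  qed
  then have "\<forall>c\<in>set (nae3 \<phi>). nae \<tau>' c" by (auto simp: nae3_def hd_drop_conv_nth)
  then show "NAE_satisfiable (nae3 \<phi>)" unfolding NAE_satisfiable_nae by blast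
qed

subsection \<open>Bounding the occurrences of literals\<close>

lemma occurrences_map:
  assumes "distinct ks"
  shows "occurrences (map f ks) l = card {k \<in> set ks. l \<in> set (f k)}"
proof -
  let ?I = "{i. i < length ks \<and> l \<in> set (f (ks ! i))}"
  have "occurrences (map f ks) l = card ?I"
    unfolding occurrences_def by (rule arg_cong[of _ _ card]) (rule Collect_cong, simp cong: conj_cong)
  also have "\<dots> = card ((!) ks ` ?I)"
    using assms by (intro card_image[symmetric] inj_on_nth) auto
  also have "(!) ks ` ?I = {k \<in> set ks. l \<in> set (f k)}"
  proof (intro equalityI subsetI)
    fix k assume "k \<in> {k \<in> set ks. l \<in> set (f k)}"
    then obtain i where "i < length ks" "ks ! i = k" "l \<in> set (f k)" by (metis (no_types, lifting) in_set_conv_nth mem_Collect_eq)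
    then show "k \<in> (!) ks ` ?I" by blast
  qed auto
  finally show ?thesis .
qed

text \<open>Every variable \<open>w\<close> gets one block \<open>(w, n, _)\<close> for each position \<open>n\<close> at which a literal may
  occur; the clauses of \<open>ring\<close> force the variables 0, 1, 2 of all blocks of \<open>w\<close> to agree. A
  block offers the unused literal slots \<open>Pos (w, n, 2)\<close> and \<open>Neg (w, n, 0)\<close>.\<close>

type_synonym 'w bvar = "'w \<times> nat \<times> nat"

definition nxt :: "nat \<Rightarrow> nat \<Rightarrow> nat" where
  "nxt N n = (if Suc n = N then 0 else Suc n)"

text \<open>Positions 0, 1, 2 are \<open>a\<close>, \<open>b\<close>, \<open>c\<close>; positions 3
  and 4 are the paddings \<open>z\<close> and \<open>y\<close>. If \<open>z\<close> is true,
  not-all-equal turns the leading three clauses into the implications from \<open>a\<close> to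
  \<open>b\<close>, from \<open>b\<close> to \<open>c\<close> and from \<open>c\<close> to
  \<open>a\<close>; if \<open>z\<close> is false, into their converses. Likewise the last two give
  the implications from \<open>c\<close> to \<open>b'\<close> and from \<open>b'\<close> to
  \<open>a\<close>, or their converses. In turn, equal values make two literals of every clause
  opposite, whatever the padding.\<close>

definition ring :: "nat \<Rightarrow> 'w \<Rightarrow> nat \<Rightarrow> 'w bvar clause list" where
  "ring N w n =
     [[Pos (w, n, 0), Neg (w, n, 1), Pos (w, n, 3)],
      [Pos (w, n, 1), Neg (w, n, 2), Pos (w, n, 3)],
      [Neg (w, n, 2), Pos (w, n, 0), Neg (w, n, 3)],
      [Pos (w, n, 2), Neg (w, nxt N n, 1), Pos (w, n, 4)],
      [Neg (w, n, 0), Pos (w, nxt N n, 1), Pos (w, n, 4)]]"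

definition slot :: "'w literal \<Rightarrow> nat \<Rightarrow> 'w bvar literal" where
  "slot l n = (if is_Pos l then Pos (var l, n, 2) else Neg (var l, n, 0))"

text \<open>Position \<open>p\<close> of clause \<open>i\<close> owns the block
  \<open>3 * i + p\<close>, so every slot is used at most once and different main clauses have no
  literal in common.\<close>

definition main_clause :: "nat \<Rightarrow> 'w clause \<Rightarrow> 'w bvar clause" where
  "main_clause i c = map (\<lambda>p. slot (hd (drop p c)) (3 * i + p)) [0..<3]"

definition vars_of :: "'w clause list \<Rightarrow> 'w list" where
  "vars_of ts = dedup (map var (concat ts))"

definition ks_vars :: "'w clause list \<Rightarrow> 'w bvar list" where
  "ks_vars ts = concat (map (\<lambda>w. concat (map (\<lambda>n. map (\<lambda>p. (w, n, p)) [0..<5]) [0..<3 * length ts])) (vars_of ts))"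

definition ks_clauses :: "'w clause list \<Rightarrow> 'w bvar clause list" where
  "ks_clauses ts = concat (map (\<lambda>w. concat (map (ring (3 * length ts) w) [0..<3 * length ts])) (vars_of ts))
     @ map (\<lambda>i. main_clause i (hd (drop i ts))) [0..<length ts]"

text \<open>Names for the clauses, so that occurrences are counted and clauses compared by name and
  not by position in a concatenation of lists.\<close>

datatype 'w key = Ring 'w nat nat | Main nat

fun clause_at :: "'w clause list \<Rightarrow> 'w key \<Rightarrow> 'w bvar clause" where
  "clause_at ts (Ring w n i) = ring (3 * length ts) w n ! i"
| "clause_at ts (Main i) = main_clause i (ts ! i)"

definition keys :: "'w clause list \<Rightarrow> 'w key list" where
  "keys ts = concat (map (\<lambda>w. concat (map (\<lambda>n. map (Ring w n) [0..<5]) [0..<3 * length ts])) (vars_of ts))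
     @ map Main [0..<length ts]"

lemma upt_5: "[0..<5] = [0, 1, 2, 3, 4 :: nat]"
  by (simp add: upt_rec)

lemma ks_clauses_keys: "ks_clauses ts = map (clause_at ts) (keys ts)"
proof -
  have "ring N w n = map ((!) (ring N w n)) [0..<5]" for N n and w :: 'a
    by (intro nth_equalityI) (simp_all add: ring_def)
  then have "ring (3 * length ts) w n = map (clause_at ts) (map (Ring w n) [0..<5])" for w n
    by (simp add: comp_def)
  then have "map (clause_at ts) (concat (map (\<lambda>n. map (Ring w n) [0..<5]) ns)) = concat (map (ring (3 * length ts) w) ns)" for w ns
    by (induction ns) simp_all
  then have "map (clause_at ts) (concat (map (\<lambda>w. concat (map (\<lambda>n. map (Ring w n) [0..<5]) ns)) ws))
      = concat (map (\<lambda>w. concat (map (ring (3 * length ts) w) ns)) ws)" for ns ws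
    by (induction ws) simp_all
  moreover have "map (clause_at ts) (map Main [0..<length ts]) = map (\<lambda>i. main_clause i (hd (drop i ts))) [0..<length ts]"
    by (simp add: hd_drop_conv_nth)
  ultimately show ?thesis by (simp only: ks_clauses_def keys_def map_append)
qed

lemma distinct_concat_map:
  assumes "distinct xs" "\<And>x. x \<in> set xs \<Longrightarrow> distinct (f x)"
    and "\<And>x y. x \<in> set xs \<Longrightarrow> y \<in> set xs \<Longrightarrow> x \<noteq> y \<Longrightarrow> set (f x) \<inter> set (f y) = {}"
  shows "distinct (concat (map f xs))"
  using assms by (induction xs) auto

lemma distinct_keys: "distinct (keys ts)"
  unfolding keys_def vars_of_def
  by (auto intro!: distinct_concat_map dedup simp: distinct_map inj_on_def)

lemma distinct_ks_vars: "distinct (ks_vars ts)"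
  unfolding ks_vars_def vars_of_def
  by (auto intro!: distinct_concat_map dedup simp: distinct_map inj_on_def)

lemma set_keys: "k \<in> set (keys ts) \<longleftrightarrow>
  (\<exists>w\<in>set (vars_of ts). \<exists>n<3 * length ts. k \<in> {Ring w n 0, Ring w n 1, Ring w n 2, Ring w n 3, Ring w n 4}) \<or>
  (\<exists>i<length ts. k = Main i)"
  by (auto simp: keys_def upt_5)

lemma set_ks_vars: "set (ks_vars ts) = {(w, n, p). w \<in> set (vars_of ts) \<and> n < 3 * length ts \<and> p < 5}"
  by (fastforce simp: ks_vars_def image_iff)

lemma nxt_inject: "n < N \<Longrightarrow> m < N \<Longrightarrow> nxt N n = nxt N m \<longleftrightarrow> n = m"
  by (auto simp: nxt_def)

lemma nxt_surj: "n < N \<Longrightarrow> \<exists>m<N. nxt N m = n"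
  by (cases n) (auto simp: nxt_def intro: exI[of _ "N - 1"] exI[of _ "n - 1"])

lemma nxt_less: "n < N \<Longrightarrow> nxt N n < N"
  by (auto simp: nxt_def)


section \<open>Occurrences and common literals of the clauses\<close>

lemma ring_nth:
  "ring N w n ! 0 = [Pos (w, n, 0), Neg (w, n, 1), Pos (w, n, 3)]"
  "ring N w n ! 1 = [Pos (w, n, 1), Neg (w, n, 2), Pos (w, n, 3)]"
  "ring N w n ! Suc 0 = [Pos (w, n, 1), Neg (w, n, 2), Pos (w, n, 3)]"
  "ring N w n ! 2 = [Neg (w, n, 2), Pos (w, n, 0), Neg (w, n, 3)]"
  "ring N w n ! 3 = [Pos (w, n, 2), Neg (w, nxt N n, 1), Pos (w, n, 4)]"
  "ring N w n ! 4 = [Neg (w, n, 0), Pos (w, nxt N n, 1), Pos (w, n, 4)]"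
  by (simp_all add: ring_def)

text \<open>The table of \<open>ring\<close> read by literals: pairs of clause number and position
  in the block. The separate case is the one literal that reaches into the next block.\<close>

lemma ring_mem:
  assumes "i \<in> {0, 1, 2, 3, 4}"
  shows "Pos (w, n, p) \<in> set (ring N w' n' ! i) \<Longrightarrow> w = w' \<and> (n = n' \<and>
      (i, p) \<in> {(0, 0), (0, 3), (1, 1), (1, 3), (2, 0), (3, 2), (3, 4), (4, 4)} \<or> n = nxt N n' \<and> i = 4 \<and> p = 1)"
    and "Neg (w, n, p) \<in> set (ring N w' n' ! i) \<Longrightarrow> w = w' \<and> (n = n' \<and>
      (i, p) \<in> {(0, 1), (1, 2), (2, 2), (2, 3), (4, 0)} \<or> n = nxt N n' \<and> i = 3 \<and> p = 1)"
  using assms by (elim insertE emptyE; simp add: ring_nth; blast)+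

lemma main_clause_index:
  assumes "l \<in> set (main_clause i c)"
  shows "\<exists>w n. n div 3 = i \<and> (l = Pos (w, n, 2) \<or> l = Neg (w, n, 0))"
proof -
  from assms obtain k p where "l = slot k (3 * i + p)" "p < 3"
    by (auto simp: main_clause_def)
  moreover have "(3 * i + p) div 3 = i" using \<open>p < 3\<close> by simp
  ultimately show ?thesis by (cases k) (auto simp: slot_def intro!: exI[of _ "3 * i + p"])
qed

text \<open>The ring alone contains the negative literal of position 2, and the positive literal of
  every other position, exactly twice. Hence it does not matter which free slots are used; a used
  slot only raises the count of its literal from 1 to 2.\<close>

lemma ks_var_occurrences:
  assumes "w \<in> set (vars_of ts)" "n < 3 * length ts" "p < 5"
  shows "occurrences (ks_clauses ts) (Pos (w, n, p)) \<le> 2 \<and> occurrences (ks_clauses ts) (Neg (w, n, p)) \<le> 2 \<and>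
    (occurrences (ks_clauses ts) (Pos (w, n, p)) = 2 \<or> occurrences (ks_clauses ts) (Neg (w, n, p)) = 2)"
proof -
  let ?N = "3 * length ts"
  define K where "K l = {k \<in> set (keys ts). l \<in> set (clause_at ts k)}" for l
  have occ: "occurrences (ks_clauses ts) l = card (K l)" for l
    unfolding ks_clauses_keys K_def by (rule occurrences_map[OF distinct_keys])
  \<comment> \<open>\<open>m\<close> is the predecessor of \<open>n\<close> in the ring; clauses 3
    and 4 of its block contain position 1 of block \<open>n\<close>.\<close>
  obtain m where m: "m < ?N" "nxt ?N m = n" using nxt_surj[OF assms(2)] by blast
  have m': "nxt ?N j = n \<longleftrightarrow> j = m" if "j < ?N" for j using nxt_inject[OF that m(1)] m(2) by auto
  have main: "Main i \<in> K (Pos (w, n, p)) \<Longrightarrow> p = 2 \<and> i = n div 3" "Main i \<in> K (Neg (w, n, p)) \<Longrightarrow> p = 0 \<and> i = n div 3" for i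
  proof -
    have "\<exists>w n. n div 3 = i \<and> (l = Pos (w, n, 2) \<or> l = Neg (w, n, 0))" if "Main i \<in> K l" for l
      using main_clause_index[of l i "ts ! i"] that by (simp add: K_def)
    from this[of "Pos (w, n, p)"] this[of "Neg (w, n, p)"]
    show "Main i \<in> K (Pos (w, n, p)) \<Longrightarrow> p = 2 \<and> i = n div 3" "Main i \<in> K (Neg (w, n, p)) \<Longrightarrow> p = 0 \<and> i = n div 3"
      by auto
  qed
  have sub: "K (Pos (w, n, p)) \<subseteq> (if p = 0 then {Ring w n 0, Ring w n 2} else if p = 1 then {Ring w n 1, Ring w m 4}
      else if p = 2 then {Ring w n 3, Main (n div 3)} else if p = 3 then {Ring w n 0, Ring w n 1} else {Ring w n 3, Ring w n 4})"
    "K (Neg (w, n, p)) \<subseteq> (if p = 0 then {Ring w n 4, Main (n div 3)} else if p = 1 then {Ring w n 0, Ring w m 3}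
      else if p = 2 then {Ring w n 1, Ring w n 2} else if p = 3 then {Ring w n 2} else {})" (is "_ \<subseteq> ?B")
  proof -
    have "k \<in> (if p = 0 then {Ring w n 0, Ring w n 2} else if p = 1 then {Ring w n 1, Ring w m 4}
      else if p = 2 then {Ring w n 3, Main (n div 3)} else if p = 3 then {Ring w n 0, Ring w n 1} else {Ring w n 3, Ring w n 4})"
      if k: "k \<in> K (Pos (w, n, p))" for k
    proof (cases k)
      case (Main i)
      then have "p = 2 \<and> i = n div 3" using main(1)[of i] k by simp
      then show ?thesis using Main by simp
    next
      case (Ring w' n' i)
      then have "n' < ?N" using k by (auto simp: K_def set_keys)
      then have eq: "n = nxt ?N n' \<Longrightarrow> n' = m" using m'[of n'] by blast
      have i: "i \<in> {0, 1, 2, 3, 4}" using k Ring by (auto simp: K_def set_keys)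
      have mem: "Pos (w, n, p) \<in> set (ring ?N w' n' ! i)" using k Ring by (simp add: K_def)
      have "w' = w" using ring_mem(1)[OF i mem] by (rule conjunct1[THEN sym])
      from ring_mem(1)[OF i mem, THEN conjunct2]
      have np: "n' = n \<and> (i, p) \<in> {(0, 0), (0, 3), (1, 1), (1, 3), (2, 0), (3, 2), (3, 4), (4, 4)} \<or> n' = m \<and> i = 4 \<and> p = 1"
      proof (rule disj_forward)
        show "n = nxt ?N n' \<and> i = 4 \<and> p = 1 \<Longrightarrow> n' = m \<and> i = 4 \<and> p = 1" using eq by simp
      qed (erule conj_forward, erule sym, assumption)
      from np show ?thesis unfolding Ring \<open>w' = w\<close> by (elim disjE conjE insertE emptyE) simp_all
    qed
    then show "K (Pos (w, n, p)) \<subseteq> (if p = 0 then {Ring w n 0, Ring w n 2} else if p = 1 then {Ring w n 1, Ring w m 4}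
      else if p = 2 then {Ring w n 3, Main (n div 3)} else if p = 3 then {Ring w n 0, Ring w n 1} else {Ring w n 3, Ring w n 4})"
      by blast
    have "k \<in> ?B" if k: "k \<in> K (Neg (w, n, p))" for k
    proof (cases k)
      case (Main i)
      then have "p = 0 \<and> i = n div 3" using main(2)[of i] k by simp
      then show ?thesis using Main by simp
    next
      case (Ring w' n' i)
      then have "n' < ?N" using k by (auto simp: K_def set_keys)
      then have eq: "n = nxt ?N n' \<Longrightarrow> n' = m" using m'[of n'] by blast
      have i: "i \<in> {0, 1, 2, 3, 4}" using k Ring by (auto simp: K_def set_keys)
      have mem: "Neg (w, n, p) \<in> set (ring ?N w' n' ! i)" using k Ring by (simp add: K_def)
      have "w' = w" using ring_mem(2)[OF i mem] by (rule conjunct1[THEN sym])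
      from ring_mem(2)[OF i mem, THEN conjunct2]
      have np: "n' = n \<and> (i, p) \<in> {(0, 1), (1, 2), (2, 2), (2, 3), (4, 0)} \<or> n' = m \<and> i = 3 \<and> p = 1"
      proof (rule disj_forward)
        show "n = nxt ?N n' \<and> i = 3 \<and> p = 1 \<Longrightarrow> n' = m \<and> i = 3 \<and> p = 1" using eq by simp
      qed (erule conj_forward, erule sym, assumption)
      from np show ?thesis unfolding Ring \<open>w' = w\<close> by (elim disjE conjE insertE emptyE) simp_all
    qed
    then show "K (Neg (w, n, p)) \<subseteq> ?B" by blast
  qed
  have le: "card (K (Pos (w, n, p))) \<le> 2" "card (K (Neg (w, n, p))) \<le> 2"
    by (rule order_trans[OF card_mono[OF _ sub(1)]], simp, simp add: card_insert_if)
      (rule order_trans[OF card_mono[OF _ sub(2)]], simp, simp add: card_insert_if)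
  have fin: "finite (K l)" for l by (simp add: K_def)
  have two: "card (K l) \<ge> 2" if "x \<in> K l" "y \<in> K l" "x \<noteq> y" for x y l
    using card_mono[OF fin, of "{x, y}" l] that by simp
  have "card (K (Pos (w, n, p))) \<ge> 2 \<or> card (K (Neg (w, n, p))) \<ge> 2"
  proof -
    from \<open>p < 5\<close> consider "p = 0" | "p = 1" | "p = 2" | "p = 3" | "p = 4" by linarith
    then show ?thesis
    proof cases
      case 1
      then have "Ring w n 0 \<in> K (Pos (w, n, p))" "Ring w n 2 \<in> K (Pos (w, n, p))"
        using assms by (auto simp: K_def set_keys ring_nth)
      then show ?thesis using two[of "Ring w n 0" _ "Ring w n 2"] by simp
    next
      case 2
      then have "Ring w n 1 \<in> K (Pos (w, n, p))" "Ring w m 4 \<in> K (Pos (w, n, p))"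
        using assms m by (auto simp: K_def set_keys ring_nth)
      then show ?thesis using two[of "Ring w n 1" _ "Ring w m 4"] by simp
    next
      case 3
      then have "Ring w n 1 \<in> K (Neg (w, n, p))" "Ring w n 2 \<in> K (Neg (w, n, p))"
        using assms by (auto simp: K_def set_keys ring_nth)
      then show ?thesis using two[of "Ring w n 1" _ "Ring w n 2"] by simp
    next
      case 4
      then have "Ring w n 0 \<in> K (Pos (w, n, p))" "Ring w n 1 \<in> K (Pos (w, n, p))"
        using assms by (auto simp: K_def set_keys ring_nth)
      then show ?thesis using two[of "Ring w n 0" _ "Ring w n 1"] by simp
    next
      case 5
      then have "Ring w n 3 \<in> K (Pos (w, n, p))" "Ring w n 4 \<in> K (Pos (w, n, p))"
        using assms by (auto simp: K_def set_keys ring_nth)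
      then show ?thesis using two[of "Ring w n 3" _ "Ring w n 4"] by simp
    qed
  qed
  with le show ?thesis unfolding occ by linarith
qed

text \<open>Clauses with different numbers in the ring pattern agree in at most one combination of
  sign and position, and clauses with the same number share a literal only within the same block. A
  ring clause has at most one literal of the kind offered as a slot, and main clauses use separate
  blocks.\<close>

lemma clause_at_intersection:
  assumes "k \<in> set (keys ts)" "k' \<in> set (keys ts)" "k \<noteq> k'"
    and "{l, l'} \<subseteq> set (clause_at ts k)" "{l, l'} \<subseteq> set (clause_at ts k')"
  shows "l = l'"
proof -
  let ?N = "3 * length ts"
  have MR: "l = l'" if "{l, l'} \<subseteq> set (main_clause i c)" "{l, l'} \<subseteq> set (clause_at ts (Ring w n j))"
    "Ring w n j \<in> set (keys ts)" for i c w n j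
  proof -
    have "\<exists>w n. l = Pos (w, n, 2) \<or> l = Neg (w, n, 0)" "\<exists>w n. l' = Pos (w, n, 2) \<or> l' = Neg (w, n, 0)"
      using main_clause_index[of l i c] main_clause_index[of l' i c] that(1) by auto
    then show ?thesis using that(2,3) by (auto simp: set_keys ring_nth)
  qed
  have MM: "i = j" if "l \<in> set (main_clause i c)" "l \<in> set (main_clause j d)" for i j c d
    using main_clause_index[OF that(1)] main_clause_index[OF that(2)] by auto
  show ?thesis
  proof (cases k)
    case k: (Main i)
    show ?thesis
    proof (cases k')
      case (Main j)
      then show ?thesis using MM[of i "ts ! i" j "ts ! j"] k assms by auto
    next
      case (Ring w n j)
      then show ?thesis using MR[of i "ts ! i" w n j] k assms by auto
    qed
  next
    case k: (Ring w n j)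
    show ?thesis
    proof (cases k')
      case (Main i)
      then show ?thesis using MR[of i "ts ! i" w n j] k assms by auto
    next
      case k': (Ring w' n' j')
      have "n < ?N" "n' < ?N" and j: "j \<in> {0, 1, 2, 3, 4}" "j' \<in> {0, 1, 2, 3, 4}"
        using assms(1,2) k k' by (auto simp: set_keys)
      then have nx: "nxt ?N n = nxt ?N n' \<longleftrightarrow> n = n'" by (intro nxt_inject)
      \<comment> \<open>A tag forgets variable and block. Within a single ring clause it still
        determines the literal.\<close>
      define tag where "tag l = (is_Pos l, snd (snd (var l)))" for l :: "'a bvar literal"
      define tags where "tags j = (if j = 0 then {(True, 0), (False, 1), (True, 3)}
        else if j = 1 then {(True, 1), (False, 2), (True, 3)} else if j = 2 then {(False, 2), (True, 0), (False, 3)}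
        else if j = 3 then {(True, 2), (False, 1), (True, 4)} else {(False, 0), (True, 1), (True, 4 :: nat)})"
        for j :: nat
      have tags: "tag x \<in> tags j" if "x \<in> set (ring ?N w n ! j)" "j \<in> {0, 1, 2, 3, 4}" for x w n j
        using that by (auto simp: ring_nth tag_def tags_def)
      have same: "l = l'" if "tag l = tag l'"
        using that assms(4) j(1) unfolding k by (auto simp: ring_nth tag_def)
      have disj: "tag l = tag l'" if "j \<noteq> j'"
      proof -
        have "{tag l, tag l'} \<subseteq> tags j \<inter> tags j'" using tags assms(4,5) j unfolding k k' by auto
        moreover have "\<exists>x. tags j \<inter> tags j' \<subseteq> {x}" using j that by (auto simp: tags_def)
        ultimately show ?thesis by blast
      qed
      have "w = w' \<and> n = n'" if "j = j'"
      proof -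
        have "l \<in> set (ring ?N w n ! j)" "l \<in> set (ring ?N w' n' ! j)" using assms(4,5) that unfolding k k' by auto
        then show ?thesis using j(1) nx by (auto simp: ring_nth)
      qed
      then show ?thesis using same disj assms(3) k k' by blast
    qed
  qed
qed

lemma ks_instance:
  assumes "\<And>c. c \<in> set ts \<Longrightarrow> length c = 3"
  shows "NAE_3SAT_KS_instance (set (ks_vars ts)) (ks_clauses ts)"
proof -
  let ?N = "3 * length ts"
  have main_var: "hd (drop p (ts ! i)) \<in> set (ts ! i)" if "i < length ts" "p < 3" for i p
    using assms[of "ts ! i"] that by (simp add: hd_drop_conv_nth)
  then have main_var: "var (hd (drop p (ts ! i))) \<in> set (vars_of ts)" if "i < length ts" "p < 3" for i p
    using that by (auto simp: vars_of_def dedup intro!: imageI bexI[of _ "ts ! i"])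
  have vars: "var l \<in> set (ks_vars ts)" if "c \<in> set (ks_clauses ts)" "l \<in> set c" for c l
  proof -
    from that(1) obtain k where k: "k \<in> set (keys ts)" "c = clause_at ts k" by (auto simp: ks_clauses_keys)
    show ?thesis
    proof (cases k)
      case (Main i)
      with k that(2) obtain p where "p < 3" "i < length ts" "l = slot (hd (drop p (ts ! i))) (3 * i + p)"
        by (auto simp: main_clause_def set_keys)
      then show ?thesis using main_var[of i p] by (auto simp: slot_def set_ks_vars)
    next
      case (Ring w n j)
      with k that(2) nxt_less[of n ?N] show ?thesis
        by (auto simp: set_keys ring_nth set_ks_vars)
    qed
  qed
  have shape: "length c = 3 \<and> distinct (map var c)" if "c \<in> set (ks_clauses ts)" for c
  proof -
    from that(1) obtain k where k: "k \<in> set (keys ts)" "c = clause_at ts k" by (auto simp: ks_clauses_keys)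
    show ?thesis
    proof (cases k)
      case (Main i)
      \<comment> \<open>Distinctness is already visible in the block numbers
        \<open>3 * i + p\<close>, even if two positions of the clause carry the same original
        variable.\<close>
      have "distinct (map fst (map (\<lambda>v. (fst (snd v), v)) (map var (main_clause i (ts ! i)))))"
        by (auto simp: main_clause_def slot_def comp_def distinct_map inj_on_def)
      then have "distinct (map var (main_clause i (ts ! i)))"
        by (auto simp: distinct_map inj_on_def)
      then show ?thesis using k Main by (simp add: main_clause_def)
    next
      case (Ring w n j)
      with k show ?thesis by (auto simp: set_keys ring_nth)
    qed
  qed
  have inter: "card (set (ks_clauses ts ! i) \<inter> set (ks_clauses ts ! j)) \<le> 1"
    if "i < length (ks_clauses ts)" "j < length (ks_clauses ts)" "i \<noteq> j" for i j
  proof -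
    have len: "length (ks_clauses ts) = length (keys ts)" by (simp add: ks_clauses_keys)
    have "keys ts ! i \<noteq> keys ts ! j" using that len nth_eq_iff_index_eq[OF distinct_keys] by metis
    then have "l = l'" if "{l, l'} \<subseteq> set (ks_clauses ts ! i) \<inter> set (ks_clauses ts ! j)" for l l'
      using clause_at_intersection[of "keys ts ! i" ts "keys ts ! j" l l'] that \<open>i < _\<close> \<open>j < _\<close> len
      by (simp add: ks_clauses_keys)
    then show ?thesis by (auto simp: card_le_Suc0_iff_eq)
  qed
  have occ: "(occurrences (ks_clauses ts) (Pos u) \<le> 2 \<and> occurrences (ks_clauses ts) (Neg u) \<le> 2) \<and>
      (occurrences (ks_clauses ts) (Pos u) = 2 \<or> occurrences (ks_clauses ts) (Neg u) = 2)" if "u \<in> set (ks_vars ts)" for u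
    using that ks_var_occurrences[of "fst u" ts "fst (snd u)" "snd (snd u)"] by (auto simp: set_ks_vars)
  show ?thesis
    unfolding NAE_3SAT_KS_instance_def
    using vars shape inter occ by (intro conjI ballI allI impI) blast+
qed

lemma NAE_satisfiable_ks:
  assumes len: "\<And>c. c \<in> set ts \<Longrightarrow> length c = 3"
  shows "NAE_satisfiable (ks_clauses ts) \<longleftrightarrow> NAE_satisfiable ts"
proof -
  let ?N = "3 * length ts"
  have nae_main: "nae \<tau>' (main_clause i (ts ! i)) \<longleftrightarrow> nae \<tau> (ts ! i)"
    if i: "i < length ts" and val: "\<And>w n. w \<in> set (vars_of ts) \<Longrightarrow> n < ?N \<Longrightarrow> \<tau>' (w, n, 0) = \<tau> w \<and> \<tau>' (w, n, 2) = \<tau> w" for \<tau> \<tau>' i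
  proof -
    have ci: "length (ts ! i) = 3" using len that(1) by simp
    then have "ts ! i = map (\<lambda>p. hd (drop p (ts ! i))) [0..<3]"
      by (intro nth_equalityI) (auto simp: hd_drop_conv_nth)
    then have set: "set (ts ! i) = (\<lambda>p. hd (drop p (ts ! i))) ` {0..<3}" by (metis set_map set_upt)
    have set': "set (main_clause i (ts ! i)) = (\<lambda>p. slot (hd (drop p (ts ! i))) (3 * i + p)) ` {0..<3}"
      by (simp add: main_clause_def)
    have lit: "lit_true \<tau>' (slot (hd (drop p (ts ! i))) (3 * i + p)) \<longleftrightarrow> lit_true \<tau> (hd (drop p (ts ! i)))"
      if "p < 3" for p
    proof -
      have "hd (drop p (ts ! i)) \<in> set (ts ! i)" using ci that by (simp add: hd_drop_conv_nth)
      then have "var (hd (drop p (ts ! i))) \<in> set (vars_of ts)"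
        using \<open>i < length ts\<close> by (auto simp: vars_of_def dedup intro!: imageI bexI[of _ "ts ! i"])
      then show ?thesis using \<open>i < length ts\<close> \<open>p < 3\<close> val[of "var (hd (drop p (ts ! i)))" "3 * i + p"]
        by (cases "hd (drop p (ts ! i))") (auto simp: slot_def)
    qed
    have "(\<exists>p\<in>{0..<3}. lit_true \<tau>' (slot (hd (drop p (ts ! i))) (3 * i + p))) \<longleftrightarrow> (\<exists>p\<in>{0..<3}. lit_true \<tau> (hd (drop p (ts ! i))))"
      "(\<exists>p\<in>{0..<3}. \<not> lit_true \<tau>' (slot (hd (drop p (ts ! i))) (3 * i + p))) \<longleftrightarrow> (\<exists>p\<in>{0..<3}. \<not> lit_true \<tau> (hd (drop p (ts ! i))))"
      using lit by auto
    then show ?thesis unfolding nae_def set set' by (simp only: bex_simps)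
  qed
  show ?thesis
  proof
    assume "NAE_satisfiable (ks_clauses ts)"
    then obtain \<tau>' where \<tau>': "\<And>k. k \<in> set (keys ts) \<Longrightarrow> nae \<tau>' (clause_at ts k)"
      unfolding NAE_satisfiable_nae ks_clauses_keys by auto
    define \<tau> where "\<tau> w = \<tau>' (w, 0, 1)" for w
    have "\<tau>' (w, n, 0) = \<tau> w \<and> \<tau>' (w, n, 2) = \<tau> w" if w: "w \<in> set (vars_of ts)" and n: "n < ?N" for w n
    proof -
      have block: "\<tau>' (w, m, 0) = \<tau>' (w, m, 1) \<and> \<tau>' (w, m, 2) = \<tau>' (w, m, 1) \<and> \<tau>' (w, nxt ?N m, 1) = \<tau>' (w, m, 1)"
        if m: "m < ?N" for m
      proof -
        have "\<forall>j\<in>{0, 1, 2, 3, 4}. nae \<tau>' (ring ?N w m ! j)"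
          using \<tau>'[of "Ring w m _"] w m by (auto simp: set_keys)
        then show ?thesis by (auto simp: ring_nth nae_def)
      qed
      have "m < ?N \<Longrightarrow> \<tau>' (w, m, 1) = \<tau> w" for m
      proof (induction m)
        case (Suc m)
        then have "nxt ?N m = Suc m" by (simp add: nxt_def)
        then show ?case using block[of m] Suc by simp
      qed (simp add: \<tau>_def)
      then show ?thesis using block[OF n] n by simp
    qed
    from nae_main[OF _ this] have "nae \<tau> (ts ! i)" if "i < length ts" for i
      using \<tau>'[of "Main i"] that by (simp add: set_keys)
    then have "\<forall>c\<in>set ts. nae \<tau> c" by (metis in_set_conv_nth)
    then show "NAE_satisfiable ts" unfolding NAE_satisfiable_nae by blast
  next
    assume "NAE_satisfiable ts"
    then obtain \<tau> where \<tau>: "\<forall>c\<in>set ts. nae \<tau> c" unfolding NAE_satisfiable_nae by blast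
    \<comment> \<open>The paddings receive the value of their block as well; any other value would
      do.\<close>
    define \<tau>' where "\<tau>' = (\<lambda>(w, n :: nat, p :: nat). \<tau> w)"
    have "nae \<tau>' (clause_at ts k)" if k: "k \<in> set (keys ts)" for k
    proof (cases k)
      case (Main i)
      then show ?thesis using k \<tau> nae_main[of i \<tau>' \<tau>] by (auto simp: set_keys \<tau>'_def)
    next
      case (Ring w n j)
      with k show ?thesis by (auto simp: set_keys ring_nth nae_def \<tau>'_def)
    qed
    then show "NAE_satisfiable (ks_clauses ts)" unfolding NAE_satisfiable_nae ks_clauses_keys by auto
  qed
qed


subsection \<open>Renaming variables\<close>

lemma var_map_literal [simp]: "var (map_literal f l) = f (var l)"
  by (cases l) auto

lemma lit_true_map_literal: "lit_true \<tau> (map_literal f l) \<longleftrightarrow> lit_true (\<lambda>v. \<tau> (f v)) l"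
  by (cases l) auto

lemma NAE_satisfiable_rename:
  assumes "inj f"
  shows "NAE_satisfiable (map (map (map_literal f)) C) \<longleftrightarrow> NAE_satisfiable C"
proof
  assume "NAE_satisfiable (map (map (map_literal f)) C)"
  then show "NAE_satisfiable C" by (auto simp: NAE_satisfiable_def lit_true_map_literal)
next
  assume "NAE_satisfiable C"
  then obtain \<tau> where "\<forall>c\<in>set C. (\<exists>l\<in>set c. lit_true \<tau> l) \<and> (\<exists>l\<in>set c. \<not> lit_true \<tau> l)"
    unfolding NAE_satisfiable_def by blast
  then have "\<forall>c\<in>set (map (map (map_literal f)) C). (\<exists>l\<in>set c. lit_true (\<lambda>v. \<tau> (inv f v)) l) \<and>
      (\<exists>l\<in>set c. \<not> lit_true (\<lambda>v. \<tau> (inv f v)) l)"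
    using assms by (simp add: lit_true_map_literal)
  then show "NAE_satisfiable (map (map (map_literal f)) C)" unfolding NAE_satisfiable_def by blast
qed

lemma occurrences_rename:
  assumes "inj f"
  shows "occurrences (map (map (map_literal f)) C) (map_literal f l) = occurrences C l"
proof -
  have "map_literal f l \<in> map_literal f ` A \<longleftrightarrow> l \<in> A" for A
    by (rule inj_image_mem_iff[OF literal.inj_map[OF assms]])
  then show ?thesis unfolding occurrences_def
    by (intro arg_cong[of _ _ card] Collect_cong) (simp cong: conj_cong)
qed

lemma instance_rename:
  assumes "inj f"
  shows "NAE_3SAT_KS_instance (f ` U) (map (map (map_literal f)) C) \<longleftrightarrow> NAE_3SAT_KS_instance U C"
proof -
  let ?m = "map_literal f"
  have inj: "inj ?m" by (rule literal.inj_map[OF assms])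
  have occ: "occurrences (map (map ?m) C) (Pos (f u)) = occurrences C (Pos u)"
    "occurrences (map (map ?m) C) (Neg (f u)) = occurrences C (Neg u)" for u
    using occurrences_rename[OF assms, of C "Pos u"] occurrences_rename[OF assms, of C "Neg u"] by simp_all
  have int: "card (set (map (map ?m) C ! i) \<inter> set (map (map ?m) C ! j)) = card (set (C ! i) \<inter> set (C ! j))"
    if "i < length C" "j < length C" for i j
  proof -
    have "set (map (map ?m) C ! i) \<inter> set (map (map ?m) C ! j) = ?m ` (set (C ! i) \<inter> set (C ! j))"
      using that by (simp add: image_Int[OF inj])
    then show ?thesis by (simp add: card_image[OF inj_on_subset[OF inj subset_UNIV]])
  qed
  have dist: "distinct (map var (map ?m c)) \<longleftrightarrow> distinct (map var c)" for c
  proof -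
    have "map var (map ?m c) = map f (map var c)" by simp
    then show ?thesis using inj_on_subset[OF assms subset_UNIV] by (simp only: distinct_map[of f] simp_thms)
  qed
  have "(\<forall>c\<in>set (map (map ?m) C). \<forall>l\<in>set c. var l \<in> f ` U) \<longleftrightarrow> (\<forall>c\<in>set C. \<forall>l\<in>set c. var l \<in> U)"
    by (simp add: inj_image_mem_iff[OF assms])
  moreover have "(\<forall>i<length (map (map ?m) C). \<forall>j<length (map (map ?m) C). i \<noteq> j \<longrightarrow> card (set (map (map ?m) C ! i) \<inter> set (map (map ?m) C ! j)) \<le> 1)
    \<longleftrightarrow> (\<forall>i<length C. \<forall>j<length C. i \<noteq> j \<longrightarrow> card (set (C ! i) \<inter> set (C ! j)) \<le> 1)"
    by (simp only: length_map) (use int in \<open>simp cong: all_cong\<close>)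
  moreover have "(\<forall>c\<in>set (map (map ?m) C). distinct (map var c)) \<longleftrightarrow> (\<forall>c\<in>set C. distinct (map var c))"
    by (simp only: list.set_map ball_simps dist)
  ultimately show ?thesis unfolding NAE_3SAT_KS_instance_def by (simp add: occ)
qed

text \<open>A word is the binary expansion of a number unless it ends with 0; this allows for arbitrary
  encodable values, with 1 appended to their code, as variable names.\<close>

fun val :: "bool list \<Rightarrow> nat" where
  "val [] = 0"
| "val (b # w) = of_bool b + 2 * val w"

lemma binary_pos: "n > 0 \<Longrightarrow> binary n = odd n # binary (n div 2)"
  by (cases n) auto

lemma binary_val: "binary (val (w @ [True])) = w @ [True]"
proof (induction w)
  case (Cons b w)
  have "val (w @ [True]) > 0" by (induction w) auto
  then have "binary (val ((b # w) @ [True])) = b # binary (val (w @ [True]))"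
    by (subst binary_pos) auto
  then show ?case using Cons by simp
qed (simp add: binary_pos)

definition name :: "'v::enc \<Rightarrow> nat" where
  "name v = val (code v @ [True])"

lemma binary_name: "binary (name v) = code v @ [True]"
  by (simp add: name_def binary_val)

lemma inj_name: "inj name"
proof (rule injI)
  fix x y :: 'a assume "name x = name y"
  then have "binary (name x) = binary (name y)" by simp
  then show "x = y" by (simp add: binary_name code_inject)
qed

definition put_bits :: "bool list \<Rightarrow> bool list" where
  "put_bits w = concat (map (\<lambda>b. [True, b]) w) @ [False]"

text \<open>\<open>enc_instance\<close> with numbers replaced by the words of their binary
  expansions; in this form neither the reduction nor the verifier computes with binary
  numbers.\<close>

definition put_instance :: "bool list list \<Rightarrow> bool list literal list list \<Rightarrow> bool list" where
  "put_instance U C = concat (map (\<lambda>v. True # put_bits v) U) @ [False] @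
    concat (map (\<lambda>c. True # concat (map (\<lambda>l. True # is_Pos l # put_bits (var l)) c) @ [False]) C) @ [False]"

lemma enc_instance_put:
  "enc_instance U C = put_instance (map binary U) (map (map (map_literal binary)) C)"
proof -
  have "enc_nat v = put_bits (binary v)" for v by (simp add: enc_nat_def enc_bits_def put_bits_def)
  moreover from this have "enc_literal l = is_Pos (map_literal binary l) # put_bits (binary (var l))" for l by (cases l) simp_all
  ultimately show ?thesis
    by (simp add: enc_instance_def enc_list_def put_instance_def comp_def)
qed

lemma PT_put_bits: "PT f \<Longrightarrow> PT (\<lambda>x. put_bits (f x))"
  unfolding put_bits_def by (intro PT_intros)

lemma PT_put_instance: "PT f \<Longrightarrow> PT g \<Longrightarrow> PT (\<lambda>x. put_instance (f x) (g x))"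
  unfolding put_instance_def by (intro PT_intros PT_put_bits)

lemma enc_instance_in_NAE_3SAT_KS:
  "enc_instance U C \<in> NAE_3SAT_KS \<longleftrightarrow> distinct U \<and> NAE_3SAT_KS_instance (set U) C \<and> NAE_satisfiable C"
  by (auto simp: NAE_3SAT_KS_def enc_instance_inject)

lemma enc_named_instance:
  assumes "distinct U" "NAE_3SAT_KS_instance (set U) C"
  shows "enc_instance (map name U) (map (map (map_literal name)) C) \<in> NAE_3SAT_KS \<longleftrightarrow> NAE_satisfiable C"
  using assms inj_name instance_rename[OF inj_name, of "set U" C] NAE_satisfiable_rename[OF inj_name, of C]
  by (auto simp: enc_instance_in_NAE_3SAT_KS distinct_map inj_on_def inj_def)

text \<open>The renaming by \<open>name\<close>, carried out on binary expansions.\<close>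

definition rename_code :: "'v::enc literal \<Rightarrow> bool list literal" where
  "rename_code l = (if is_Pos l then Pos (code (var l) @ [True]) else Neg (code (var l) @ [True]))"

definition ks_word :: "'v::enc clause list \<Rightarrow> bool list" where
  "ks_word \<phi> = put_instance (map (\<lambda>v. code v @ [True]) (ks_vars (nae3 \<phi>)))
     (map (map rename_code) (ks_clauses (nae3 \<phi>)))"

lemma ks_word_correct: "ks_word \<phi> \<in> NAE_3SAT_KS \<longleftrightarrow> cnf_sat \<phi>"
proof -
  have "rename_code l = map_literal binary (map_literal name l)" for l :: "'a nvar bvar literal"
    by (cases l) (auto simp: rename_code_def binary_name)
  then have "rename_code = (\<lambda>l :: 'a nvar bvar literal. map_literal binary (map_literal name l))" by blast
  then have "ks_word \<phi> = enc_instance (map name (ks_vars (nae3 \<phi>))) (map (map (map_literal name)) (ks_clauses (nae3 \<phi>)))"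
    by (simp add: ks_word_def enc_instance_put comp_def binary_name)
  then show ?thesis
    using enc_named_instance[OF distinct_ks_vars ks_instance, of "nae3 \<phi>"]
    by (simp add: length_nae3 NAE_satisfiable_ks NAE_satisfiable_nae3)
qed

lemma PT_nae3: "PT (\<lambda>\<phi>. nae3 \<phi>)"
  unfolding nae3_def triples_def lift_def orig_def link_def falsum_def
  by (intro PT_intros)

lemma PT_ks_vars: "PT (\<lambda>ts. ks_vars ts)"
  unfolding ks_vars_def vars_of_def by (intro PT_intros)

lemma PT_ks_clauses: "PT (\<lambda>ts. ks_clauses ts)"
  unfolding ks_clauses_def vars_of_def ring_def main_clause_def slot_def nxt_def
  by (intro PT_intros)

lemma PT_ks_word: "PT (\<lambda>\<phi>. ks_word \<phi>)"
  unfolding ks_word_def rename_code_def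
  by (intro PT_put_instance PT_comp[OF PT_ks_vars] PT_comp[OF PT_ks_clauses] PT_nae3 PT_intros)


section \<open>Computations as satisfying assignments\<close>

text \<open>The variable \<open>(k, t, j, a)\<close> with \<open>k < tapes M\<close> says that at time \<open>t\<close> the cell of tape \<open>k\<close> at
  distance \<open>j - c\<close> from the head contains \<open>a\<close>; the variable \<open>(tapes M, t, 0, q)\<close> says that the state
  is \<open>q\<close>. As cells are addressed relative to the heads, the next content of a cell depends only on
  the state, the cells under the heads and a neighbouring cell.\<close>

type_synonym tvar = "nat \<times> nat \<times> nat \<times> nat"

text \<open>The halting state becomes an idle step, so that every run can be described for exactly
  \<open>T\<close> steps.\<close>

definition delta_total :: "tm \<Rightarrow> nat \<Rightarrow> nat list \<Rightarrow> nat \<times> (nat \<times> dir) list" where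
  "delta_total M q rs = (if q = halt M then (q, map (\<lambda>r. (r, Stay)) rs) else delta M q rs)"

text \<open>A head movement as the amounts added to and subtracted from the addresses of the cells.\<close>

fun shift :: "dir \<Rightarrow> nat \<times> nat" where
  "shift MoveLeft = (1, 0)"
| "shift Stay = (0, 0)"
| "shift MoveRight = (0, 1)"

text \<open>A transition as a value of an encodable type: state and symbols read, new state, and the
  written symbol and shift for each tape. As \<open>rules M\<close> does not depend on the input, it
  is a constant for the polynomial-time calculus.\<close>

definition rule_of :: "tm \<Rightarrow> nat \<times> nat list \<Rightarrow> (nat \<times> (nat \<times> nat) list) \<times> nat \<times> (nat \<times> nat \<times> nat \<times> nat) list" where
  "rule_of M = (\<lambda>(q, rs). ((q, map (\<lambda>k. (k, rs ! k)) [0..<tapes M]), fst (delta_total M q rs),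
     map (\<lambda>k. (k, fst (snd (delta_total M q rs) ! k), shift (snd (snd (delta_total M q rs) ! k)))) [0..<tapes M]))"

definition rules :: "tm \<Rightarrow> ((nat \<times> (nat \<times> nat) list) \<times> nat \<times> (nat \<times> nat \<times> nat \<times> nat) list) list" where
  "rules M = map (rule_of M) (List.product [0..<states M] (List.n_lists (tapes M) [0..<symbols M]))"

definition prems_at :: "nat \<Rightarrow> nat \<Rightarrow> nat \<Rightarrow> nat \<times> (nat \<times> nat) list \<Rightarrow> tvar clause" where
  "prems_at K c t pr = Neg (K, t, 0, fst pr) # map (\<lambda>kr. Neg (fst kr, t, c, snd kr)) (snd pr)"

text \<open>Address \<open>c\<close> is the cell under the head, where the written symbol appears;
  every other cell passes its symbol on. The old addresses start from 1, since a move to the right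
  subtracts 1 and must not be cut off at 0.\<close>

definition cell_clauses :: "nat \<Rightarrow> nat \<Rightarrow> nat \<Rightarrow> tvar clause \<Rightarrow> nat \<times> nat \<times> nat \<times> nat \<Rightarrow> tvar clause list" where
  "cell_clauses S c t pr a = concat (map (\<lambda>i.
     if Suc i = c then [Pos (fst a, Suc t, Suc i + fst (snd (snd a)) - snd (snd (snd a)), fst (snd a)) # pr]
     else map (\<lambda>s. Neg (fst a, t, Suc i, s) # Pos (fst a, Suc t, Suc i + fst (snd (snd a)) - snd (snd (snd a)), s) # pr) [0..<S])
     [0..<2 * c])"

definition step_clauses :: "tm \<Rightarrow> nat \<Rightarrow> nat \<Rightarrow> tvar clause list" where
  "step_clauses M c t = concat (map (\<lambda>e. (Pos (tapes M, Suc t, 0, fst (snd e)) # prems_at (tapes M) c t (fst e)) #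
     concat (map (\<lambda>a. cell_clauses (symbols M) c t (prems_at (tapes M) c t (fst e)) a) (snd (snd e)))) (rules M))"

text \<open>The \<open>m\<close> open cells hold the certificate; \<open>init_clauses\<close> adds
  that blanks are followed by blanks. With the last \<open>c + 1\<close> blanks all addresses up to
  \<open>2 * c\<close> are covered, however short the input is.\<close>

definition allowed :: "nat \<Rightarrow> bool list \<Rightarrow> nat \<Rightarrow> nat list list" where
  "allowed c v m = replicate c [0] @ map (\<lambda>b. [if b then 2 else 1]) v @ replicate m [0, 1, 2] @ replicate (c + 1) [0]"

definition init_clauses :: "tm \<Rightarrow> nat \<Rightarrow> bool list \<Rightarrow> nat \<Rightarrow> tvar clause list" where
  "init_clauses M c v m =
     map (\<lambda>j. map (\<lambda>a. Pos (0, 0, j, a)) (hd (drop j (allowed c v m)))) [0..<length (allowed c v m)] @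
     map (\<lambda>i. [Neg (0, 0, c + length v + i, 0), Pos (0, 0, c + length v + Suc i, 0)]) [0..<m] @
     concat (map (\<lambda>k. map (\<lambda>j. [Pos (k, 0, j, 0)]) [0..<2 * c + 1]) (map Suc [0..<tapes M - 1])) @
     [[Pos (tapes M, 0, 0, start M)]]"

text \<open>At time \<open>t\<close> the addresses from \<open>t + 1\<close> to
  \<open>2 * c - t\<close> are known. The answer stands in cell 0, at an address between
  \<open>c - T\<close> and \<open>c + T\<close> at time \<open>T\<close>;
  \<open>c = 2 * T + 1\<close> is the least value for which these are known. Forbidding the symbol 1
  on the whole last tape avoids any reference to the head position.\<close>

definition tableau :: "tm \<Rightarrow> nat \<Rightarrow> bool list \<Rightarrow> nat \<Rightarrow> tvar clause list" where
  "tableau M T v m = (let c = 2 * T + 1 in init_clauses M c v m @ concat (map (step_clauses M c) [0..<T]) @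
     map (\<lambda>j. [Neg (tapes M - 1, T, j, 1)]) [0..<2 * c + 1])"

lemma PT_tableau: "PT f \<Longrightarrow> PT g \<Longrightarrow> PT h \<Longrightarrow> PT (\<lambda>x. tableau M (f x) (g x) (h x))"
proof -
  have "PT (\<lambda>p. tableau M (fst p) (fst (snd p)) (snd (snd p)))"
    unfolding tableau_def Let_def init_clauses_def allowed_def step_clauses_def cell_clauses_def prems_at_def
    by (intro PT_intros)
  moreover assume "PT f" "PT g" "PT h"
  then have "PT (\<lambda>x. (f x, g x, h x))" by (intro PT_pair)
  ultimately show ?thesis using PT_comp by fastforce
qed

section \<open>Configurations seen from the heads\<close>

definition cell :: "config \<Rightarrow> nat \<Rightarrow> int \<Rightarrow> nat" where
  "cell cf k r = snd (snd cf ! k) (fst (snd cf ! k) + r)"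

definition wf_config :: "tm \<Rightarrow> config \<Rightarrow> bool" where
  "wf_config M cf \<longleftrightarrow> fst cf < states M \<and> length (snd cf) = tapes M \<and> (\<forall>t\<in>set (snd cf). \<forall>i. snd t i < symbols M)"

lemma cell_act:
  "snd (act (s, d) t) (fst (act (s, d) t) + r) = (if r + displacement d = 0 then s else snd t (fst t + (r + displacement d)))"
  by (cases t) (auto simp: algebra_simps)

definition reads :: "config \<Rightarrow> nat list" where
  "reads cf = map read (snd cf)"

lemma reads_nth: "k < length (snd cf) \<Longrightarrow> reads cf ! k = cell cf k 0"
  by (simp add: reads_def cell_def read_def)

lemma step_total:
  assumes "wf_config M cf"
  shows "step M cf = (fst (delta_total M (fst cf) (reads cf)), map2 act (snd (delta_total M (fst cf) (reads cf))) (snd cf))"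
proof (cases "fst cf = halt M")
  case True
  have "map2 act (map (\<lambda>r. (r, Stay)) (map read ts)) ts = ts" for ts
    by (induction ts) auto
  with True show ?thesis by (simp add: step_def delta_total_def reads_def prod_eq_iff)
next
  case False
  then show ?thesis by (simp add: step_def delta_total_def reads_def case_prod_beta)
qed

lemma delta_total_wf:
  assumes "wf_tm M" "wf_config M cf"
  defines "dq \<equiv> delta_total M (fst cf) (reads cf)"
  shows "fst dq < states M" "length (snd dq) = tapes M" "\<forall>a\<in>set (snd dq). fst a < symbols M"
    "length (reads cf) = tapes M" "set (reads cf) \<subseteq> {..<symbols M}"
proof -
  show len: "length (reads cf) = tapes M" using assms(2) by (simp add: reads_def wf_config_def)
  show sub: "set (reads cf) \<subseteq> {..<symbols M}" using assms(2) by (auto simp: reads_def wf_config_def read_def)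
  have q: "fst cf < states M" using assms(2) by (simp add: wf_config_def)
  have "fst (delta M (fst cf) (reads cf)) < states M \<and> length (snd (delta M (fst cf) (reads cf))) = tapes M \<and>
    (\<forall>(s, d)\<in>set (snd (delta M (fst cf) (reads cf))). s < symbols M)"
    using assms(1) q len sub unfolding wf_tm_def by blast
  then show "fst dq < states M" "length (snd dq) = tapes M" "\<forall>a\<in>set (snd dq). fst a < symbols M"
    using q len sub unfolding dq_def delta_total_def by auto
qed

lemma step_wf:
  assumes "wf_tm M" "wf_config M cf"
  shows "wf_config M (step M cf)"
proof -
  note d = delta_total_wf[OF assms]
  have "snd t i < symbols M" if t_in: "t \<in> set (map2 act (snd (delta_total M (fst cf) (reads cf))) (snd cf))" for t i
  proof -
    obtain a t0 where a: "a \<in> set (snd (delta_total M (fst cf) (reads cf)))" "t0 \<in> set (snd cf)" "t = act a t0"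
    proof -
      from t_in obtain p where p: "p \<in> set (zip (snd (delta_total M (fst cf) (reads cf))) (snd cf))"
        "t = act (fst p) (snd p)" by (auto simp only: set_map image_iff case_prod_beta)
      show thesis
        using set_zip_leftD[of "fst p" "snd p"] set_zip_rightD[of "fst p" "snd p"] p
        by (intro that[of "fst p" "snd p"]) simp_all
    qed
    have "fst a < symbols M" "snd t0 i < symbols M" using d(3) a assms(2) by (auto simp: wf_config_def)
    then show ?thesis unfolding a(3) by (cases a; cases t0) auto
  qed
  then show ?thesis using d(1,2) assms(2) by (simp add: step_total[OF assms(2)] wf_config_def)
qed

lemma step_cell:
  assumes "wf_tm M" "wf_config M cf" "k < tapes M"
  defines "a \<equiv> snd (delta_total M (fst cf) (reads cf)) ! k"
  shows "cell (step M cf) k r = (if r + displacement (snd a) = 0 then fst a else cell cf k (r + displacement (snd a)))"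
proof -
  have len: "length (snd (delta_total M (fst cf) (reads cf))) = tapes M" "length (snd cf) = tapes M"
    using delta_total_wf[OF assms(1,2)] assms(2) by (auto simp: wf_config_def)
  have "snd (step M cf) ! k = act a (snd cf ! k)"
    using assms(3) len by (simp add: step_total[OF assms(2)] a_def)
  then show ?thesis unfolding cell_def by (metis cell_act surjective_pairing)
qed

lemma init_wf:
  assumes "wf_tm M"
  shows "wf_config M (init M w)"
proof -
  have "word_cells w i < symbols M" "word_cells [] i < symbols M" for i
    using assms by (auto simp: word_cells_def wf_tm_def)
  moreover have "tapes M \<ge> 1" "start M < states M" using assms by (auto simp: wf_tm_def)
  ultimately show ?thesis by (auto simp: wf_config_def init_def)
qed

lemma funpow_step_wf: "wf_tm M \<Longrightarrow> wf_config M ((step M ^^ t) (init M w))"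
  by (induction t) (simp_all add: init_wf step_wf)

text \<open>Limits the address at which the answer in cell 0 can be found at the end.\<close>

lemma head_bound:
  assumes "wf_tm M" "k < tapes M"
  shows "\<bar>fst (snd ((step M ^^ t) (init M w)) ! k)\<bar> \<le> int t"
proof (induction t)
  case 0
  then show ?case using assms(2) by (cases k) (auto simp: init_def)
next
  case (Suc t)
  let ?cf = "(step M ^^ t) (init M w)"
  note wf = funpow_step_wf[OF assms(1), of t w]
  have len: "length (snd (delta_total M (fst ?cf) (reads ?cf))) = tapes M" "length (snd ?cf) = tapes M"
    using delta_total_wf[OF assms(1) wf] wf by (auto simp: wf_config_def)
  let ?a = "snd (delta_total M (fst ?cf) (reads ?cf)) ! k"
  have "snd (step M ?cf) ! k = act ?a (snd ?cf ! k)"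
    using assms(2) len by (simp add: step_total[OF wf])
  moreover have "\<bar>displacement d\<bar> \<le> 1" for d by (cases d) auto
  moreover have "fst (act a u) = fst u + displacement (snd a)" for a u by (cases a; cases u) auto
  ultimately have "fst (snd (step M ?cf) ! k) = fst (snd ?cf ! k) + displacement (snd ?a)"
    "\<bar>displacement (snd ?a)\<bar> \<le> 1" by simp_all
  then show ?case using Suc by simp
qed

lemma shift_displacement:
  "int (Suc i + fst (shift d) - snd (shift d)) = int (Suc i) - displacement d"
  by (cases d) auto


text \<open>The interface between the clause lists and the two simulation proofs: the clauses of a
  rule share their negated premises, so together they form one implication.\<close>

lemma step_clauses_iff:
  "(\<forall>C\<in>set (step_clauses M c t). \<exists>l\<in>set C. lit_true \<tau> l) \<longleftrightarrow>
   (\<forall>q<states M. \<forall>rs. length rs = tapes M \<longrightarrow> set rs \<subseteq> {..<symbols M} \<longrightarrow>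
     \<tau> (tapes M, t, 0, q) \<longrightarrow> (\<forall>k<tapes M. \<tau> (k, t, c, rs ! k)) \<longrightarrow>
     (let d = delta_total M q rs in \<tau> (tapes M, Suc t, 0, fst d) \<and>
       (\<forall>k<tapes M. \<forall>i<2 * c. let a = snd d ! k; j = Suc i + fst (shift (snd a)) - snd (shift (snd a)) in
         if Suc i = c then \<tau> (k, Suc t, j, fst a)
         else \<forall>s<symbols M. \<tau> (k, t, Suc i, s) \<longrightarrow> \<tau> (k, Suc t, j, s))))"
proof -
  have pr: "(\<exists>l\<in>set (prems_at K c t (q, map (\<lambda>k. (k, rs ! k)) [0..<K])). lit_true \<tau> l) \<longleftrightarrow>
      \<not> (\<tau> (K, t, 0, q) \<and> (\<forall>k<K. \<tau> (k, t, c, rs ! k)))" for K q rs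
    by (auto simp: prems_at_def)
  have cells: "(\<forall>C\<in>set (cell_clauses S c t P (k, s, sh)). \<exists>l\<in>set C. lit_true \<tau> l) \<longleftrightarrow>
      (\<exists>l\<in>set P. lit_true \<tau> l) \<or> (\<forall>i<2 * c. let j = Suc i + fst sh - snd sh in
         if Suc i = c then \<tau> (k, Suc t, j, s) else \<forall>s<S. \<tau> (k, t, Suc i, s) \<longrightarrow> \<tau> (k, Suc t, j, s))" for S P k s sh
    by (auto simp: cell_clauses_def Let_def split: if_splits)
  have rule: "(\<forall>C\<in>set ((Pos (tapes M, Suc t, 0, fst (snd e)) # prems_at (tapes M) c t (fst e)) #
     concat (map (\<lambda>a. cell_clauses (symbols M) c t (prems_at (tapes M) c t (fst e)) a) (snd (snd e)))).
       \<exists>l\<in>set C. lit_true \<tau> l) \<longleftrightarrow>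
     (\<tau> (tapes M, t, 0, q) \<longrightarrow> (\<forall>k<tapes M. \<tau> (k, t, c, rs ! k)) \<longrightarrow>
     (let d = delta_total M q rs in \<tau> (tapes M, Suc t, 0, fst d) \<and>
       (\<forall>k<tapes M. \<forall>i<2 * c. let a = snd d ! k; j = Suc i + fst (shift (snd a)) - snd (shift (snd a)) in
         if Suc i = c then \<tau> (k, Suc t, j, fst a)
         else \<forall>s<symbols M. \<tau> (k, t, Suc i, s) \<longrightarrow> \<tau> (k, Suc t, j, s))))"
    if "e = rule_of M (q, rs)" for e q rs
  proof -
    let ?P = "prems_at (tapes M) c t (fst e)"
    have P: "(\<exists>l\<in>set ?P. lit_true \<tau> l) \<longleftrightarrow> \<not> (\<tau> (tapes M, t, 0, q) \<and> (\<forall>k<tapes M. \<tau> (k, t, c, rs ! k)))"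
      using pr by (simp add: that rule_of_def)
    have "(\<forall>C\<in>set (concat (map (cell_clauses (symbols M) c t ?P) (snd (snd e)))). \<exists>l\<in>set C. lit_true \<tau> l) \<longleftrightarrow>
      (\<forall>k<tapes M. \<forall>C\<in>set (cell_clauses (symbols M) c t ?P (k, fst (snd (delta_total M q rs) ! k),
         shift (snd (snd (delta_total M q rs) ! k)))). \<exists>l\<in>set C. lit_true \<tau> l)"
      by (auto simp: that rule_of_def)
    also have "\<dots> \<longleftrightarrow> (\<exists>l\<in>set ?P. lit_true \<tau> l) \<or> (\<forall>k<tapes M. \<forall>i<2 * c.
       let a = snd (delta_total M q rs) ! k; j = Suc i + fst (shift (snd a)) - snd (shift (snd a)) in
         if Suc i = c then \<tau> (k, Suc t, j, fst a)
         else \<forall>s<symbols M. \<tau> (k, t, Suc i, s) \<longrightarrow> \<tau> (k, Suc t, j, s))"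
      unfolding cells Let_def by blast
    finally have C: "(\<forall>C\<in>set (concat (map (cell_clauses (symbols M) c t ?P) (snd (snd e)))). \<exists>l\<in>set C. lit_true \<tau> l) \<longleftrightarrow> \<dots>" .
    have D: "(\<exists>l\<in>set (Pos (tapes M, Suc t, 0, fst (snd e)) # ?P). lit_true \<tau> l) \<longleftrightarrow>
      \<tau> (tapes M, Suc t, 0, fst (delta_total M q rs)) \<or> (\<exists>l\<in>set ?P. lit_true \<tau> l)"
      by (simp add: that rule_of_def)
    show ?thesis using C D P unfolding Let_def list.set(2)[of "_ # _" "concat _"] ball_simps by argo
  qed
  define cl where "cl e = (Pos (tapes M, Suc t, 0, fst (snd e)) # prems_at (tapes M) c t (fst e)) #
     concat (map (\<lambda>a. cell_clauses (symbols M) c t (prems_at (tapes M) c t (fst e)) a) (snd (snd e)))" for e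
  have "step_clauses M c t = concat (map cl (rules M))"
    by (simp only: step_clauses_def cl_def[abs_def])
  then have "(\<forall>C\<in>set (step_clauses M c t). \<exists>l\<in>set C. lit_true \<tau> l) \<longleftrightarrow>
    (\<forall>e\<in>set (rules M). \<forall>C\<in>set (cl e). \<exists>l\<in>set C. lit_true \<tau> l)" by simp
  moreover have "set (rules M) = rule_of M ` {(q, rs). q < states M \<and> length rs = tapes M \<and> set rs \<subseteq> {..<symbols M}}"
    unfolding rules_def set_map by (rule arg_cong[of _ _ "image _"]) (auto simp: set_n_lists)
  ultimately have "(\<forall>C\<in>set (step_clauses M c t). \<exists>l\<in>set C. lit_true \<tau> l) \<longleftrightarrow>
    (\<forall>q<states M. \<forall>rs. length rs = tapes M \<longrightarrow> set rs \<subseteq> {..<symbols M} \<longrightarrow>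
      (\<forall>C\<in>set (cl (rule_of M (q, rs))). \<exists>l\<in>set C. lit_true \<tau> l))" by (simp add: imp_conjL)
  then show ?thesis unfolding cl_def rule[OF refl] .
qed


section \<open>Correctness of the tableau\<close>

lemma outputs_within_mono:
  assumes "outputs_within M x y t" "t \<le> t'"
  shows "outputs_within M x y t'"
proof -
  obtain ts where ts: "(step M ^^ t) (init M x) = (halt M, ts)" "snd (last ts) = word_cells y"
    using assms(1) by (auto simp: outputs_within_def split: prod.splits)
  have "(step M ^^ n) (halt M, ts) = (halt M, ts)" for n
    by (induction n) (auto simp: step_def)
  moreover have "(step M ^^ t') (init M x) = (step M ^^ (t' - t)) ((step M ^^ t) (init M x))"
    using assms(2) by (metis comp_apply funpow_add le_add_diff_inverse2)
  ultimately show ?thesis using ts by (simp add: outputs_within_def)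
qed

lemma allowed_nth:
  "j < c \<Longrightarrow> allowed c v m ! j = [0]"
  "i < length v \<Longrightarrow> allowed c v m ! (c + i) = [if v ! i then 2 else 1]"
  "i < m \<Longrightarrow> allowed c v m ! (c + length v + i) = [0, 1, 2]"
  "i < c + 1 \<Longrightarrow> allowed c v m ! (c + length v + m + i) = [0]"
  by (simp_all add: allowed_def nth_append del: replicate.simps)

lemma length_allowed: "length (allowed c v m) = 2 * c + 1 + length v + m"
  by (simp add: allowed_def)

lemma allowed_cases:
  assumes "j < 2 * c + 1 + length v + m"
  obtains "j < c" | i where "i < length v" "j = c + i" | i where "i < m" "j = c + length v + i"
    | i where "i < c + 1" "j = c + length v + m + i"
proof -
  consider "j < c" | "c \<le> j" "j < c + length v" | "c + length v \<le> j" "j < c + length v + m" | "c + length v + m \<le> j"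
    by linarith
  then show thesis
  proof cases
    case 1 then show thesis by (rule that(1))
  next
    case 2 then show thesis using that(2)[of "j - c"] by simp
  next
    case 3 then show thesis using that(3)[of "j - (c + length v)"] by simp
  next
    case 4 then show thesis using that(4)[of "j - (c + length v + m)"] assms by simp
  qed
qed

lemma cell_init_0: "wf_tm M \<Longrightarrow> cell (init M w) 0 r = word_cells w r"
  by (simp add: cell_def init_def)

lemma cell_init_other: "wf_tm M \<Longrightarrow> 0 < k \<Longrightarrow> k < tapes M \<Longrightarrow> cell (init M w) k r = 0"
  by (cases k) (simp_all add: cell_def init_def)

lemma init_clauses_iff:
  assumes "wf_tm M"
  shows "(\<forall>C\<in>set (init_clauses M c v m). \<exists>l\<in>set C. lit_true \<tau> l) \<longleftrightarrow>
    (\<forall>j<length (allowed c v m). \<exists>a\<in>set (allowed c v m ! j). \<tau> (0, 0, j, a)) \<and>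
    (\<forall>i<m. \<tau> (0, 0, c + length v + i, 0) \<longrightarrow> \<tau> (0, 0, c + length v + Suc i, 0)) \<and>
    (\<forall>k<tapes M - 1. \<forall>j<2 * c + 1. \<tau> (Suc k, 0, j, 0)) \<and> \<tau> (tapes M, 0, 0, start M)"
  unfolding init_clauses_def by (auto simp: hd_drop_conv_nth ball_Un simp del: upt_Suc)

lemma word_cells_prefix: "i < length v \<Longrightarrow> word_cells (v @ u) (int i) = (if v ! i then 2 else 1)"
  by (simp add: word_cells_def nth_append)

lemma word_cells_suffix: "word_cells (v @ u) (int (length v + i)) = word_cells u (int i)"
  by (auto simp: word_cells_def nth_append nat_add_distrib)

lemma word_cells_beyond: "i < 0 \<or> int (length w) \<le> i \<Longrightarrow> word_cells w i = 0"
  by (auto simp: word_cells_def)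

text \<open>By induction on time, the assignment makes the actual run true inside the shrinking
  window. If the run answered \<open>[False]\<close>, a forbidden variable would be true.\<close>

lemma tableau_sound:
  assumes M: "wf_tm M" and out: "\<And>u. length u \<le> m \<Longrightarrow> outputs_within M (v @ u) [v @ u \<in> V] T"
    and sat: "cnf_sat (tableau M T v m)"
  shows "\<exists>u. length u \<le> m \<and> v @ u \<in> V"
proof -
  define c where "c = 2 * T + 1"
  obtain \<tau> where \<tau>: "\<forall>C\<in>set (tableau M T v m). \<exists>l\<in>set C. lit_true \<tau> l" using sat unfolding cnf_sat_def by blast
  then have "\<forall>C\<in>set (init_clauses M c v m). \<exists>l\<in>set C. lit_true \<tau> l"
    and steps: "\<And>t. t < T \<Longrightarrow> \<forall>C\<in>set (step_clauses M c t). \<exists>l\<in>set C. lit_true \<tau> l"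
    and final: "\<And>j. j < 2 * c + 1 \<Longrightarrow> \<not> \<tau> (tapes M - 1, T, j, 1)"
    unfolding tableau_def Let_def c_def[symmetric] by (auto simp: ball_Un simp del: upt_Suc)
  note init = this(1)[unfolded init_clauses_iff[OF M]]
  let ?z = "\<lambda>i. i = m \<or> \<tau> (0, 0, c + length v + i, 0)"
  \<comment> \<open>The certificate ends at the earliest open cell declared blank, or after all
    \<open>m\<close> of them.\<close>
  define n where "n = (LEAST i. ?z i)"
  have n: "?z n" unfolding n_def by (rule LeastI[of ?z m]) simp
  have "n \<le> m" unfolding n_def by (rule Least_le) simp
  have less_n: "\<not> \<tau> (0, 0, c + length v + i, 0)" if "i < n" for i
    using not_less_Least[of i ?z] that unfolding n_def by blast
  have from_n: "\<tau> (0, 0, c + length v + i, 0)" if "n \<le> i" "i < m" for i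
    using that
  proof (induction i rule: dec_induct)
    case base
    then show ?case using n by simp
  next
    case (step i)
    then show ?case using init by simp
  qed
  \<comment> \<open>A cell may be assigned both 1 and 2; then 2 is preferred. If 2 is not assigned,
    then 1 is, because the cell is not blank.\<close>
  define u where "u = map (\<lambda>i. \<tau> (0, 0, c + length v + i, 2)) [0..<n]"
  have len_u: "length u = n" by (simp add: u_def)
  let ?w = "v @ u"
  have tape0: "\<tau> (0, 0, j, word_cells ?w (int j - int c))" if "j \<le> 2 * c" for j
  proof -
    have j: "j < 2 * c + 1 + length v + m" using that by simp
    then obtain a where a: "a \<in> set (allowed c v m ! j)" "\<tau> (0, 0, j, a)" using init by (auto simp: length_allowed)
    from j show ?thesis
    proof (cases rule: allowed_cases)
      case 1
      then show ?thesis using a by (simp add: allowed_nth word_cells_beyond)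
    next
      case (2 i)
      then show ?thesis using a by (simp add: allowed_nth word_cells_prefix)
    next
      case (3 i)
      have "int j - int c = int (length v + i)" using 3 by simp
      then have w: "word_cells ?w (int j - int c) = word_cells u (int i)" by (simp only: word_cells_suffix)
      show ?thesis
      proof (cases "i < n")
        case True
        then have "a = 1 \<or> a = 2" using a less_n[of i] 3 by (auto simp: allowed_nth)
        then show ?thesis using a True w 3 len_u by (auto simp: word_cells_def u_def)
      next
        case False
        then show ?thesis using from_n[of i] 3 w len_u by (simp add: word_cells_beyond)
      qed
    next
      case (4 i)
      then show ?thesis using a len_u \<open>n \<le> m\<close> by (simp add: allowed_nth word_cells_beyond)
    qed
  qed
  let ?cf = "\<lambda>t. (step M ^^ t) (init M ?w)"
  have main: "\<tau> (tapes M, t, 0, fst (?cf t)) \<and>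
      (\<forall>k<tapes M. \<forall>j. Suc t \<le> j \<and> j + t \<le> 2 * c \<longrightarrow> \<tau> (k, t, j, cell (?cf t) k (int j - int c)))" if "t \<le> T" for t
    using that
  proof (induction t)
    case 0
    have "\<tau> (k, 0, j, cell (init M ?w) k (int j - int c))" if "k < tapes M" "j \<le> 2 * c" for k j
    proof (cases k)
      case 0
      then show ?thesis using tape0 that M by (simp add: cell_init_0)
    next
      case (Suc k')
      then show ?thesis using init that M by (simp add: cell_init_other)
    qed
    then show ?case using init by (simp add: init_def)
  next
    case (Suc t)
    note wf = funpow_step_wf[OF M, of t ?w]
    note d = delta_total_wf[OF M wf]
    let ?d = "delta_total M (fst (?cf t)) (reads (?cf t))"
    have IH: "\<tau> (tapes M, t, 0, fst (?cf t))"
      "\<And>k j. k < tapes M \<Longrightarrow> Suc t \<le> j \<Longrightarrow> j + t \<le> 2 * c \<Longrightarrow> \<tau> (k, t, j, cell (?cf t) k (int j - int c))"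
      using Suc by simp_all
    have ct: "Suc t \<le> c" "c + t \<le> 2 * c" using Suc.prems by (simp_all add: c_def)
    have "\<tau> (k, t, c, reads (?cf t) ! k)" if "k < tapes M" for k
      using IH(2)[OF that ct] that wf by (simp add: reads_nth wf_config_def)
    moreover have "fst (?cf t) < states M" using wf by (simp add: wf_config_def)
    moreover have "t < T" using Suc.prems by simp
    ultimately have "\<tau> (tapes M, Suc t, 0, fst ?d) \<and>
       (\<forall>k<tapes M. \<forall>i<2 * c. if Suc i = c
         then \<tau> (k, Suc t, Suc i + fst (shift (snd (snd ?d ! k))) - snd (shift (snd (snd ?d ! k))), fst (snd ?d ! k))
         else \<forall>s<symbols M. \<tau> (k, t, Suc i, s) \<longrightarrow>
           \<tau> (k, Suc t, Suc i + fst (shift (snd (snd ?d ! k))) - snd (shift (snd (snd ?d ! k))), s))"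
      using steps[of t, unfolded step_clauses_iff Let_def, THEN spec, of "fst (?cf t)", THEN mp, THEN spec, of "reads (?cf t)"]
        d(4,5) IH(1) by blast
    then have new: "\<tau> (tapes M, Suc t, 0, fst ?d)"
      "\<And>k i. k < tapes M \<Longrightarrow> i < 2 * c \<Longrightarrow> Suc i = c \<Longrightarrow>
         \<tau> (k, Suc t, Suc i + fst (shift (snd (snd ?d ! k))) - snd (shift (snd (snd ?d ! k))), fst (snd ?d ! k))"
      "\<And>k i s. k < tapes M \<Longrightarrow> i < 2 * c \<Longrightarrow> Suc i \<noteq> c \<Longrightarrow> s < symbols M \<Longrightarrow> \<tau> (k, t, Suc i, s) \<Longrightarrow>
         \<tau> (k, Suc t, Suc i + fst (shift (snd (snd ?d ! k))) - snd (shift (snd (snd ?d ! k))), s)"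
      by metis+
    have "\<tau> (k, Suc t, j, cell (?cf (Suc t)) k (int j - int c))"
      if k: "k < tapes M" and j: "Suc (Suc t) \<le> j" "j + Suc t \<le> 2 * c" for k j
    proof -
      let ?a = "snd ?d ! k"
      \<comment> \<open>\<open>Suc i\<close> is the old address of the cell that has address
        \<open>j\<close> after the move.\<close>
      define i where "i = nat (int j + displacement (snd ?a) - 1)"
      have i: "int (Suc i) = int j + displacement (snd ?a)"
        using j(1) unfolding i_def by (cases "snd ?a") auto
      have disp: "\<bar>displacement (snd ?a)\<bar> \<le> 1" by (cases "snd ?a") auto
      have i_bounds: "Suc t \<le> Suc i" "Suc i + t \<le> 2 * c" "i < 2 * c" using i disp j by linarith+
      have "int (Suc i + fst (shift (snd ?a)) - snd (shift (snd ?a))) = int j"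
        using shift_displacement[of i "snd ?a"] i by simp
      then have ji: "Suc i + fst (shift (snd ?a)) - snd (shift (snd ?a)) = j" by (simp only: of_nat_eq_iff)
      have cell: "cell (?cf (Suc t)) k (int j - int c) = (if Suc i = c then fst ?a else cell (?cf t) k (int (Suc i) - int c))"
      proof -
        have e: "int j - int c + displacement (snd ?a) = int (Suc i) - int c" using i by simp
        have "cell (?cf (Suc t)) k (int j - int c) = (if int (Suc i) - int c = 0 then fst ?a else cell (?cf t) k (int (Suc i) - int c))"
          using step_cell[OF M wf k, of "int j - int c"] unfolding e by simp
        then show ?thesis by (cases "Suc i = c") auto
      qed
      show ?thesis
      proof (cases "Suc i = c")
        case True
        then show ?thesis using new(2)[OF k i_bounds(3) True] cell ji by simp
      next
        case False
        have "cell (?cf t) k (int (Suc i) - int c) < symbols M"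
          using wf k by (simp add: cell_def wf_config_def)
        with new(3)[OF k i_bounds(3) False] IH(2)[OF k i_bounds(1,2)] ji cell False show ?thesis by simp
      qed
    qed
    moreover have "fst (?cf (Suc t)) = fst ?d" by (simp add: step_total[OF wf])
    ultimately show ?case using new(1) by simp
  qed
  have "?w \<in> V"
  proof (rule ccontr)
    assume "?w \<notin> V"
    then have o: "snd (last (snd (?cf T))) = word_cells [False]"
      using out[of u] \<open>n \<le> m\<close> len_u by (auto simp: outputs_within_def split: prod.splits)
    have K: "tapes M - 1 < tapes M" using M by (auto simp: wf_tm_def)
    have len: "length (snd (?cf T)) = tapes M" using funpow_step_wf[OF M, of T ?w] by (simp add: wf_config_def)
    then have l: "last (snd (?cf T)) = snd (?cf T) ! (tapes M - 1)" using K by (subst last_conv_nth) auto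
    define h where "h = fst (snd (?cf T) ! (tapes M - 1))"
    have h: "\<bar>h\<bar> \<le> int T" unfolding h_def by (rule head_bound[OF M K])
    \<comment> \<open>The address of cell 0, which lies at distance \<open>- h\<close> from the head
      and would contain the symbol 1 of \<open>[False]\<close>.\<close>
    define j where "j = nat (int c - h)"
    have j: "int j = int c - h" using h by (simp add: j_def c_def)
    have "cell (?cf T) (tapes M - 1) (int j - int c) = 1"
      using o unfolding cell_def j l h_def by (simp add: word_cells_def)
    moreover have "Suc T \<le> j" "j + T \<le> 2 * c" using j h by (simp_all add: c_def)
    ultimately have "\<tau> (tapes M - 1, T, j, 1)" using main[of T] K by (metis order_refl)
    then show False using final[of j] \<open>j + T \<le> 2 * c\<close> by simp
  qed
  then show ?thesis using len_u \<open>n \<le> m\<close> by blast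
qed

text \<open>The assignment describing the run exactly satisfies all clauses, also at the borders of
  the window, as \<open>cell\<close> is defined at every distance.\<close>

lemma tableau_complete:
  assumes M: "wf_tm M" and out: "outputs_within M (v @ u) [True] T" and u: "length u \<le> m"
  shows "cnf_sat (tableau M T v m)"
proof -
  define c where "c = 2 * T + 1"
  let ?w = "v @ u"
  let ?cf = "\<lambda>t. (step M ^^ t) (init M ?w)"
  define \<tau> where "\<tau> = (\<lambda>(k, t, j, a). if k < tapes M then cell (?cf t) k (int j - int c) = a else fst (?cf t) = a)"
  have K: "tapes M \<ge> 1" using M by (simp add: wf_tm_def)
  have "\<forall>C\<in>set (init_clauses M c v m). \<exists>l\<in>set C. lit_true \<tau> l"
    unfolding init_clauses_iff[OF M]
  proof (intro conjI allI impI)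
    fix j assume "j < length (allowed c v m)"
    then have "j < 2 * c + 1 + length v + m" by (simp add: length_allowed)
    then have "word_cells ?w (int j - int c) \<in> set (allowed c v m ! j)"
    proof (cases rule: allowed_cases)
      case 1
      then show ?thesis by (simp add: allowed_nth word_cells_beyond)
    next
      case (2 i)
      then show ?thesis by (simp add: allowed_nth word_cells_prefix)
    next
      case (3 i)
      then show ?thesis by (simp add: allowed_nth word_cells_def)
    next
      case (4 i)
      then show ?thesis using u by (simp add: allowed_nth word_cells_beyond)
    qed
    then show "\<exists>a\<in>set (allowed c v m ! j). \<tau> (0, 0, j, a)"
      using K M by (auto simp: \<tau>_def cell_init_0)
  next
    fix i assume "i < m" "\<tau> (0, 0, c + length v + i, 0)"
    then have "word_cells ?w (int (length v + i)) = 0" using K M by (simp add: \<tau>_def cell_init_0)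
    then have "length u \<le> i" unfolding word_cells_suffix by (auto simp: word_cells_def split: if_splits)
    then show "\<tau> (0, 0, c + length v + Suc i, 0)" using K M by (simp add: \<tau>_def cell_init_0 word_cells_beyond)
  next
    fix k j assume "k < tapes M - 1" "j < 2 * c + 1"
    then show "\<tau> (Suc k, 0, j, 0)" using M by (simp add: \<tau>_def cell_init_other)
  next
    show "\<tau> (tapes M, 0, 0, start M)" by (simp add: \<tau>_def init_def)
  qed
  moreover have "\<forall>C\<in>set (step_clauses M c t). \<exists>l\<in>set C. lit_true \<tau> l" for t
    unfolding step_clauses_iff
  proof (intro allI impI)
    fix q rs
    assume rs: "length rs = tapes M" and q: "\<tau> (tapes M, t, 0, q)" and r: "\<forall>k<tapes M. \<tau> (k, t, c, rs ! k)"
    note wf = funpow_step_wf[OF M, of t ?w]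
    have "fst (?cf t) = q" using q by (simp add: \<tau>_def)
    moreover have "reads (?cf t) = rs"
      using r rs wf by (intro nth_equalityI) (auto simp: reads_nth wf_config_def \<tau>_def reads_def[THEN arg_cong[of _ _ length]])
    ultimately have d: "delta_total M q rs = delta_total M (fst (?cf t)) (reads (?cf t))" by simp
    have "(let a = snd (delta_total M q rs) ! k; j = Suc i + fst (shift (snd a)) - snd (shift (snd a))
            in if Suc i = c then \<tau> (k, Suc t, j, fst a)
               else \<forall>s<symbols M. \<tau> (k, t, Suc i, s) \<longrightarrow> \<tau> (k, Suc t, j, s))" if k: "k < tapes M" for k i
    proof -
      let ?a = "snd (delta_total M q rs) ! k"
      define j where "j = Suc i + fst (shift (snd ?a)) - snd (shift (snd ?a))"
      have e: "int j - int c + displacement (snd ?a) = int (Suc i) - int c"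
        unfolding j_def shift_displacement by simp
      have "cell (?cf (Suc t)) k (int j - int c) = (if int (Suc i) - int c = 0 then fst ?a else cell (?cf t) k (int (Suc i) - int c))"
        using step_cell[OF M wf k, of "int j - int c"] unfolding d[symmetric] e by simp
      then have cell: "cell (?cf (Suc t)) k (int j - int c) = (if Suc i = c then fst ?a else cell (?cf t) k (int (Suc i) - int c))"
        by (cases "Suc i = c") auto
      show ?thesis unfolding Let_def j_def[symmetric] using k cell by (simp add: \<tau>_def)
    qed
    moreover have "\<tau> (tapes M, Suc t, 0, fst (delta_total M q rs))"
      using step_total[OF wf] d by (simp add: \<tau>_def)
    ultimately show "let d = delta_total M q rs in \<tau> (tapes M, Suc t, 0, fst d) \<and>
       (\<forall>k<tapes M. \<forall>i<2 * c. let a = snd d ! k; j = Suc i + fst (shift (snd a)) - snd (shift (snd a)) in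
         if Suc i = c then \<tau> (k, Suc t, j, fst a)
         else \<forall>s<symbols M. \<tau> (k, t, Suc i, s) \<longrightarrow> \<tau> (k, Suc t, j, s))"
      unfolding Let_def by blast
  qed
  moreover have "\<not> \<tau> (tapes M - 1, T, j, 1)" for j
  proof -
    have "length (snd (?cf T)) = tapes M" using funpow_step_wf[OF M, of T ?w] by (simp add: wf_config_def)
    then have "last (snd (?cf T)) = snd (?cf T) ! (tapes M - 1)" using K by (subst last_conv_nth) auto
    moreover have "snd (last (snd (?cf T))) = word_cells [True]"
      using out by (auto simp: outputs_within_def split: prod.splits)
    ultimately have "cell (?cf T) (tapes M - 1) r \<noteq> 1" for r
      by (simp add: cell_def word_cells_def)
    then show ?thesis using K by (simp add: \<tau>_def)
  qed
  ultimately have "\<forall>C\<in>set (tableau M T v m). \<exists>l\<in>set C. lit_true \<tau> l"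
    unfolding tableau_def Let_def c_def[symmetric] by (auto simp: ball_Un simp del: upt_Suc)
  then show ?thesis unfolding cnf_sat_def by blast
qed

theorem NP_hard_NAE_3SAT_KS: "NP_hard NAE_3SAT_KS"
  unfolding NP_hard_def ptime_reducible_def
proof
  fix A assume "A \<in> class_NP"
  then obtain V p where V: "V \<in> class_P" and A: "\<And>x. x \<in> A \<longleftrightarrow> (\<exists>u. length u \<le> poly p (length x) \<and> pair x u \<in> V)"
    unfolding class_NP_def by blast
  from V obtain M q where M: "wf_tm M" "\<And>w. outputs_within M w [w \<in> V] (poly q (length w))"
    unfolding class_P_def ptime_computable_def by blast
  \<comment> \<open>\<open>2 * length x + 1 + poly p (length x)\<close> is the greatest length of
    \<open>pair x u\<close> for an admissible \<open>u\<close>, so one time bound serves all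
    certificates.\<close>
  define f where "f x = ks_word (tableau M (poly q (2 * length x + 1 + poly p (length x))) (put_bits x) (poly p (length x)))" for x
  have "PT f" unfolding f_def
    by (intro PT_comp[OF PT_ks_word] PT_tableau PT_put_bits PT_intros)
  then have "ptime_computable f" by (rule PT_imp_ptime_computable)
  moreover have "x \<in> A \<longleftrightarrow> f x \<in> NAE_3SAT_KS" for x
  proof -
    let ?m = "poly p (length x)" and ?v = "put_bits x"
    let ?T = "poly q (2 * length x + 1 + ?m)"
    have v: "?v @ u = pair x u" for u by (simp add: put_bits_def pair_def enc_bits_def)
    have out: "outputs_within M (?v @ u) [?v @ u \<in> V] ?T" if "length u \<le> ?m" for u
      by (rule outputs_within_mono[OF M(2)], rule poly_nat_mono) (use that in \<open>simp add: v length_pair\<close>)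
    have "cnf_sat (tableau M ?T ?v ?m) \<longleftrightarrow> (\<exists>u. length u \<le> ?m \<and> ?v @ u \<in> V)"
    proof
      assume "cnf_sat (tableau M ?T ?v ?m)"
      then show "\<exists>u. length u \<le> ?m \<and> ?v @ u \<in> V"
        using tableau_sound[OF M(1), of ?m ?v V ?T] out by blast
    next
      assume "\<exists>u. length u \<le> ?m \<and> ?v @ u \<in> V"
      then obtain u where u: "length u \<le> ?m" "?v @ u \<in> V" by blast
      then have "outputs_within M (?v @ u) [True] ?T" using out[of u] by simp
      then show "cnf_sat (tableau M ?T ?v ?m)" using u(1) by (rule tableau_complete[OF M(1)])
    qed
    then show ?thesis unfolding f_def ks_word_correct A v by (rule sym)
  qed
  ultimately show "\<exists>f. ptime_computable f \<and> (\<forall>x. (x \<in> A) = (f x \<in> NAE_3SAT_KS))" by blast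
qed


section \<open>Membership in NP\<close>

definition raw_fst :: "raw \<Rightarrow> raw" where "raw_fst r = Raw (fst (unpair (code r)))"
definition raw_snd :: "raw \<Rightarrow> raw" where "raw_snd r = Raw (snd (unpair (code r)))"

lemma PT_raw_fst: "PT f \<Longrightarrow> PT (\<lambda>x. raw_fst (f x))"
  by (rule PT_comp[OF PT_unpair_fst[of raw_fst]]) (simp_all add: raw_fst_def)

lemma PT_raw_snd: "PT f \<Longrightarrow> PT (\<lambda>x. raw_snd (f x))"
  by (rule PT_comp[OF PT_unpair_snd[of raw_snd]]) (simp_all add: raw_snd_def)

lemma raw_pair [simp]: "raw_fst (Raw (pair u v)) = Raw u" "raw_snd (Raw (pair u v)) = Raw v"
  by (simp_all add: raw_fst_def raw_snd_def)

definition item_step :: "raw \<times> raw list \<Rightarrow> raw \<times> raw list" where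
  "item_step s = (if fst s = Raw [] then s else (raw_snd (fst s), snd s @ [raw_fst (fst s)]))"

text \<open>A total left inverse of the encoding of lists.\<close>

definition items :: "raw \<Rightarrow> raw list" where
  "items r = snd (foldl (\<lambda>s b. item_step s) (r, []) (code r))"

lemma items_code [simp]: "items (Raw (code ws)) = ws"
proof -
  have ne: "pair u v \<noteq> []" for u v by (simp add: pair_def enc_bits_def)
  have "length ws \<le> length bs \<Longrightarrow> foldl (\<lambda>s b. item_step s) (Raw (code ws), acc) bs = (Raw [], acc @ ws)"
    for bs :: "bool list" and acc
  proof (induction bs arbitrary: ws acc)
    case IH: (Cons b bs)
    show ?case
    proof (cases ws)
      case Nil
      then show ?thesis using IH.IH[of "[]" acc] by (simp add: item_step_def)
    next
      case (Cons w ws')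
      then have "item_step (Raw (code ws), acc) = (Raw (code ws'), acc @ [w])"
        by (simp add: item_step_def code_Cons ne code_raw_def)
      then show ?thesis using IH.IH[of ws' "acc @ [w]"] Cons IH.prems by simp
    qed
  qed auto
  then show ?thesis using length_le_size[of ws] by (simp add: items_def)
qed

lemma PT_items: "PT f \<Longrightarrow> PT (\<lambda>x. items (f x))"
proof (rule PT_comp[of items])
  \<comment> \<open>An item only moves from the remaining word to the list, so the total size grows
    by a constant.\<close>
  have "size_of (item_step s) \<le> size_of s + 3" for s
    using length_unpair[of "code (fst s)"] by (cases s) (simp add: item_step_def raw_fst_def raw_snd_def)
  then show "PT items" unfolding items_def
    by (intro PT_snd PT_foldl_additive[where B = "[:3:]" and step = "\<lambda>x s b. item_step s"] PT_pair PT_id PT_const PT_code)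
      (simp_all add: item_step_def PT_intros PT_raw_fst PT_raw_snd)
qed

definition to_literal :: "bool list \<Rightarrow> bool list literal" where
  "to_literal w = (if hd w then Pos (tl w) else Neg (tl w))"

definition wit_vars :: "raw \<Rightarrow> bool list list" where
  "wit_vars r = map code (items (raw_fst r))"

definition wit_true :: "raw \<Rightarrow> bool list list" where
  "wit_true r = map code (items (raw_fst (raw_snd r)))"

definition wit_clauses :: "raw \<Rightarrow> bool list clause list" where
  "wit_clauses r = map (\<lambda>c. map (\<lambda>l. to_literal (code l)) (items c)) (items (raw_snd (raw_snd r)))"

text \<open>The bit tested is the most significant one, as \<open>binary\<close> begins with the
  least significant.\<close>

definition canonical :: "bool list \<Rightarrow> bool" where
  "canonical v \<longleftrightarrow> v = [] \<or> hd (drop (length v - 1) v)"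

definition occs :: "'v clause list \<Rightarrow> 'v literal \<Rightarrow> nat" where
  "occs C l = length (filter (\<lambda>c. l \<in> set c) C)"

text \<open>The instance conditions by quantifiers over lists: an intersection has at most one
  element if any two common literals coincide, and distinctness means that removing duplicates keeps
  the length.\<close>

definition instance_check :: "'v list \<Rightarrow> 'v clause list \<Rightarrow> bool" where
  "instance_check U C \<longleftrightarrow>
     (\<forall>c\<in>set C. \<forall>l\<in>set c. var l \<in> set U) \<and>
     (\<forall>c\<in>set C. length c = 3) \<and>
     (\<forall>u\<in>set U. occs C (Pos u) \<le> 2 \<and> occs C (Neg u) \<le> 2) \<and>
     (\<forall>u\<in>set U. occs C (Pos u) = 2 \<or> occs C (Neg u) = 2) \<and>
     (\<forall>i\<in>set [0..<length C]. \<forall>j\<in>set [0..<length C]. i \<noteq> j \<longrightarrow>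
        (\<forall>k\<in>set (hd (drop i C)). \<forall>l\<in>set (hd (drop i C)).
           k \<in> set (hd (drop j C)) \<longrightarrow> l \<in> set (hd (drop j C)) \<longrightarrow> k = l)) \<and>
     (\<forall>c\<in>set C. length (dedup (map var c)) = length (map var c))"

lemma distinct_dedup: "length (dedup xs) = length xs \<longleftrightarrow> distinct xs"
proof -
  have "length (dedup xs) = card (set xs)" using dedup[of xs] by (metis distinct_card)
  then show ?thesis by (metis card_distinct distinct_card)
qed

lemma instance_check: "instance_check U C \<longleftrightarrow> NAE_3SAT_KS_instance (set U) C"
proof -
  have occ: "occs C l = occurrences C l" for l
    by (simp add: occs_def occurrences_def length_filter_conv_card)
  have inter: "(\<forall>k\<in>A. \<forall>l\<in>A. k \<in> B \<longrightarrow> l \<in> B \<longrightarrow> k = l) \<longleftrightarrow> card (A \<inter> B) \<le> 1" if "finite A" for A B :: "'a literal set"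
    using that by (auto simp: card_le_Suc0_iff_eq)
  have "(\<forall>i\<in>set [0..<length C]. \<forall>j\<in>set [0..<length C]. i \<noteq> j \<longrightarrow>
        (\<forall>k\<in>set (hd (drop i C)). \<forall>l\<in>set (hd (drop i C)).
           k \<in> set (hd (drop j C)) \<longrightarrow> l \<in> set (hd (drop j C)) \<longrightarrow> k = l)) \<longleftrightarrow>
      (\<forall>i<length C. \<forall>j<length C. i \<noteq> j \<longrightarrow> card (set (C ! i) \<inter> set (C ! j)) \<le> 1)"
    unfolding inter[OF finite_set] by (simp add: hd_drop_conv_nth Ball_def)
  then show ?thesis
    unfolding instance_check_def NAE_3SAT_KS_instance_def occ distinct_dedup by simp
qed

definition check :: "bool list \<Rightarrow> raw \<Rightarrow> bool" where
  "check x r \<longleftrightarrow> x = put_instance (wit_vars r) (wit_clauses r) \<and> (\<forall>v\<in>set (wit_vars r). canonical v) \<and>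
     length (dedup (wit_vars r)) = length (wit_vars r) \<and> instance_check (wit_vars r) (wit_clauses r) \<and>
     (\<forall>c\<in>set (wit_clauses r). (\<exists>l\<in>set c. (var l \<in> set (wit_true r)) = is_Pos l) \<and>
        (\<exists>l\<in>set c. \<not> (var l \<in> set (wit_true r)) = is_Pos l))"

lemma PT_check: "PT (\<lambda>r. check (code (raw_fst r)) (raw_snd r))"
  unfolding check_def instance_check_def occs_def canonical_def wit_vars_def wit_true_def wit_clauses_def to_literal_def
  by (intro PT_put_instance PT_items PT_raw_fst PT_raw_snd PT_intros)

lemma canonical_iff: "canonical v \<longleftrightarrow> (\<exists>n. v = binary n)"
proof
  assume c: "canonical v"
  show "\<exists>n. v = binary n"
  proof (cases v rule: rev_cases)
    case Nil
    then show ?thesis by (intro exI[of _ 0]) simp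
  next
    case (snoc w b)
    with c have b by (simp add: canonical_def)
    with snoc binary_val[of w] show ?thesis by metis
  qed
next
  have last: "n > 0 \<Longrightarrow> last (binary n)" for n
  proof (induction n rule: less_induct)
    case (less n)
    show ?case
    proof (cases "n div 2 = 0")
      case True
      with less.prems have "n = 1" by auto
      then show ?thesis by simp
    next
      case False
      then have "binary (n div 2) \<noteq> []" by (simp add: binary_pos)
      moreover have "last (binary (n div 2))" using less.IH[of "n div 2"] False less.prems by simp
      ultimately show ?thesis using binary_pos[OF less.prems] by simp
    qed
  qed
  assume "\<exists>n. v = binary n"
  then obtain n where n: "v = binary n" by blast
  show "canonical v"
  proof (cases "n = 0")
    case False
    then have "v \<noteq> []" "last v" using n last[of n] binary_pos[of n] by auto
    then show ?thesis by (simp add: canonical_def hd_drop_conv_nth last_conv_nth)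
  qed (simp add: n canonical_def)
qed

lemma lit_true_is_Pos: "lit_true \<tau> l \<longleftrightarrow> \<tau> (var l) = is_Pos l"
  by (cases l) auto

lemma inj_binary: "inj binary"
  by (simp add: inj_def binary_inject)

text \<open>Distinct canonical words are expansions of distinct numbers, so the certificate
  describes a genuine instance. Testing the variable list suffices, since every variable of a clause
  occurs in it.\<close>

lemma check_sound:
  assumes "check x r"
  shows "x \<in> NAE_3SAT_KS"
proof -
  let ?U = "wit_vars r" and ?C = "wit_clauses r"
  have U: "distinct ?U" "\<And>v. v \<in> set ?U \<Longrightarrow> canonical v" and inst: "NAE_3SAT_KS_instance (set ?U) ?C"
    and x: "x = put_instance ?U ?C"
    using assms by (auto simp: check_def distinct_dedup instance_check)
  have sat: "NAE_satisfiable ?C"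
    unfolding NAE_satisfiable_def
    by (rule exI[of _ "\<lambda>v. v \<in> set (wit_true r)"]) (use assms in \<open>simp add: check_def lit_true_is_Pos\<close>)
  define un where "un v = (SOME n. v = binary n)" for v
  have un: "binary (un v) = v" if "v \<in> set ?U" for v
    using someI_ex[OF U(2)[OF that, unfolded canonical_iff]] by (simp add: un_def)
  define U' C' where "U' = map un ?U" and "C' = map (map (map_literal un)) ?C"
  have U': "map binary U' = ?U" by (simp add: U'_def un map_idI)
  have "map_literal binary (map_literal un l) = l" if "c \<in> set ?C" "l \<in> set c" for c l
  proof -
    have "var l \<in> set ?U" using inst that by (auto simp: NAE_3SAT_KS_instance_def)
    then show ?thesis using un by (cases l) auto
  qed
  then have C': "map (map (map_literal binary)) C' = ?C" by (simp add: C'_def map_idI)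
  have "x = enc_instance U' C'" by (simp only: enc_instance_put U' C' x)
  moreover have "distinct U'" using U(1) U' by (metis distinct_map)
  moreover have "NAE_3SAT_KS_instance (set U') C'"
    using instance_rename[OF inj_binary, of "set U'" C'] inst U' C' by (metis set_map)
  moreover have "NAE_satisfiable C'" using NAE_satisfiable_rename[OF inj_binary, of C'] sat C' by simp
  ultimately show ?thesis by (simp add: enc_instance_in_NAE_3SAT_KS)
qed

definition literal_word :: "bool list literal \<Rightarrow> bool list" where
  "literal_word l = is_Pos l # var l"

lemma to_literal_word: "to_literal (literal_word l) = l"
  by (cases l) (auto simp: to_literal_def literal_word_def)

definition witness :: "bool list list \<Rightarrow> bool list list \<Rightarrow> bool list clause list \<Rightarrow> bool list" where
  "witness U T C = code (map Raw U, map Raw T, map (\<lambda>c. Raw (code (map (\<lambda>l. Raw (literal_word l)) c))) C)"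

lemma wit_witness:
  "wit_vars (Raw (witness U T C)) = U" "wit_true (Raw (witness U T C)) = T" "wit_clauses (Raw (witness U T C)) = C"
  by (simp_all add: witness_def wit_vars_def wit_true_def wit_clauses_def code_Pair comp_def to_literal_word)

lemma length_put_bits: "length (put_bits w) = 2 * length w + 1"
  by (induction w) (auto simp: put_bits_def)

text \<open>The nested pair doubles the codes of \<open>U\<close> and of its true part, in total
  four times the variable part of the word; the code of the clauses is at most twice the clause
  part.\<close>

lemma length_witness:
  "length (witness U (filter P U) C) \<le> 6 * length (put_instance U C) + 2"
proof -
  have U: "size_of (map Raw ws) \<le> length (concat (map (\<lambda>v. True # put_bits v) ws))" for ws
    by (induction ws) (auto simp: length_put_bits)
  have T: "size_of (map Raw (filter P ws)) \<le> size_of (map Raw ws)" for ws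
    by (induction ws) auto
  have c: "size_of (map (\<lambda>l. Raw (literal_word l)) c) \<le> length (concat (map (\<lambda>l. True # is_Pos l # put_bits (var l)) c))" for c
    by (induction c) (auto simp: length_put_bits literal_word_def)
  have C: "size_of (map (\<lambda>c. Raw (code (map (\<lambda>l. Raw (literal_word l)) c))) C) \<le>
    2 * length (concat (map (\<lambda>c. True # concat (map (\<lambda>l. True # is_Pos l # put_bits (var l)) c) @ [False]) C))"
  proof (induction C)
    case (Cons d C)
    then show ?case using c[of d] by simp
  qed simp
  show ?thesis using U[of U] T[of U] C unfolding witness_def put_instance_def by simp
qed

lemma check_complete:
  assumes "x \<in> NAE_3SAT_KS"
  shows "\<exists>u. length u \<le> 6 * length x + 2 \<and> check x (Raw u)"
proof -
  from assms obtain U C where UC: "x = enc_instance U C" "distinct U" "NAE_3SAT_KS_instance (set U) C" "NAE_satisfiable C"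
    by (auto simp: NAE_3SAT_KS_def)
  define U' C' where "U' = map binary U" and "C' = map (map (map_literal binary)) C"
  have inst: "NAE_3SAT_KS_instance (set U') C'"
    using UC(3) instance_rename[OF inj_binary, of "set U" C] by (simp add: U'_def C'_def)
  have x: "x = put_instance U' C'" by (simp add: UC(1) enc_instance_put U'_def C'_def)
  have "NAE_satisfiable C'" using UC(4) NAE_satisfiable_rename[OF inj_binary, of C] by (simp add: C'_def)
  then obtain \<tau> where \<tau>: "\<And>c. c \<in> set C' \<Longrightarrow> (\<exists>l\<in>set c. lit_true \<tau> l) \<and> (\<exists>l\<in>set c. \<not> lit_true \<tau> l)"
    unfolding NAE_satisfiable_def by blast
  \<comment> \<open>Restricted to \<open>U'\<close>, the assignment becomes a list no longer than
    the list of variables.\<close>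
  define T where "T = filter \<tau> U'"
  have T: "lit_true \<tau> l \<longleftrightarrow> (var l \<in> set T) = is_Pos l" if "c \<in> set C'" "l \<in> set c" for c l
  proof -
    have "var l \<in> set U'" using inst that by (auto simp: NAE_3SAT_KS_instance_def)
    then show ?thesis by (simp add: lit_true_is_Pos T_def)
  qed
  have "(\<exists>l\<in>set c. (var l \<in> set T) = is_Pos l) \<and> (\<exists>l\<in>set c. \<not> (var l \<in> set T) = is_Pos l)" if "c \<in> set C'" for c
    using \<tau>[OF that] T[OF that] by blast
  moreover have "distinct U'" using UC(2) inj_on_subset[OF inj_binary subset_UNIV] by (simp add: U'_def distinct_map)
  moreover have "\<forall>v\<in>set U'. canonical v" by (auto simp: U'_def canonical_iff)
  ultimately have "check x (Raw (witness U' T C'))"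
    using inst x by (simp add: check_def wit_witness distinct_dedup instance_check)
  moreover have "length (witness U' T C') \<le> 6 * length x + 2" unfolding x T_def by (rule length_witness)
  ultimately show ?thesis by blast
qed

theorem NAE_3SAT_KS_in_NP: "NAE_3SAT_KS \<in> class_NP"
proof -
  define V where "V = {w. check (code (raw_fst (Raw w))) (raw_snd (Raw w))}"
  have "PT (\<lambda>r. [check (code (raw_fst r)) (raw_snd r)])"
    by (intro PT_Cons PT_check PT_const)
  from PT_raw_imp_ptime_computable[OF this] have "V \<in> class_P"
    by (simp add: class_P_def V_def)
  moreover have "x \<in> NAE_3SAT_KS \<longleftrightarrow> (\<exists>u. length u \<le> poly [:2, 6:] (length x) \<and> pair x u \<in> V)" for x
    using check_complete[of x] check_sound[of x] by (auto simp: V_def algebra_simps)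
  ultimately show ?thesis unfolding class_NP_def by blast
qed

theorem theorem3: "NP_complete NAE_3SAT_KS"
  unfolding NP_complete_def using NAE_3SAT_KS_in_NP NP_hard_NAE_3SAT_KS by blast

end
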